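(* 1. Let $u=\alpha v_n\in A_1$ where $0\neq n\in\mathbb{Z}$ and $\alpha$ is a monic polynomial of $K[H]$. Let $v$, $t$, $\gamma$, $\mu$, $f_i$, $g_i$ be the data attached to $u$ as defined in the context. Then: (i) $$N(u,A_1)=\bigoplus_{i\geq\mu}K[H]v_{-it}\ \oplus\ \Big(\bigoplus_{i=1}^{\mu-1}K[H]f_iv_{-it}\Big)\oplus K[H]\oplus\Big(\bigoplus_{i=1}^{\mu-1}K[H]g_iv^i\Big)\oplus\Big(\bigoplus_{i\geq\mu}K[H]v^i\Big).$$ (ii) The set $S=\{H^kv_{-it},\ H^kf_jv_{-jt},\ H^k,\ H^kg_jv^j,\ H^kv^i\mid k\geq 0,\ i\geq\mu,\ j=1,\ldots,\mu-1\}$ is a principal basis of the algebra $N(u,A_1)$, with $\mathrm{ndeg}\,v_{-it}=i(|t|+\deg_H\gamma)$ for $i\geq\mu$, and $\mathrm{ndeg}\,f_jv_{-jt}=\deg f_j+j(|t|+\deg_H\gamma)$ and $\mathrm{ndeg}\,g_jv^j=\deg_Hg_j$ for $j=1,\ldots,\mu-1$. (iii) The algebra $\mathcal{G}(u,A_1)$ is an affine (commutative) algebra, hence Noetherian. (iv) The algebra $N(u,A_1)$ is an affine Noetherian algebra. 2. Let $u\in K[H]\setminus K$. Then $N(u,A_1)=K[H]=C(u,A_1)$.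
   Context: $K$ is a field of characteristic zero. $A_1$ is the first Weyl algebra over $K$, generated by $X,Y$ with $YX-XY=1$, and $H=YX$. Put $v_n=X^n$ for $n>0$, $v_n=Y^{-n}$ for $n<0$, $v_0=1$; then $A_1=\bigoplus_{i\in\mathbb{Z}}K[H]v_i$ is $\mathbb{Z}$-graded. Let $\sigma$ be the $K$-automorphism of $K(H)$ with $\sigma(H)=H-1$ and $B=K(H)[X,X^{-1};\sigma]$ the skew Laurent polynomial ring with $Xf=\sigma(f)X$ for $f\in K(H)$. $A_1$ is identified with a subalgebra of $B$ via $X\mapsto X$, $Y\mapsto HX^{-1}$. An element of $K(H)$ is monic if it is a quotient of two polynomials with leading coefficient $1$; $\deg_H(f/g)=\deg f-\deg g$. "Affine" means finitely generated as a $K$-algebra. For non-scalar $u\in A_1$: $\mathrm{ad}\,u(a)=ua-au$; $N(u,i,A_1)=\ker(\mathrm{ad}\,u)^{i+1}$ for $i\geq 0$, $N(u,-1,A_1)=0$; $N(u,A_1)=\bigcup_{i\geq 0}N(u,i,A_1)$, an $\mathbb{N}$-filtered algebra; $C(u,A_1)=N(u,0,A_1)$; $\mathcal{G}(u,A_1)=\bigoplus_{i\geq 0}N(u,i,A_1)/N(u,i-1,A_1)$ is its associated graded algebra. For $0\neq a\in N(u,A_1)$, $\mathrm{ndeg}\,a$ is the unique $i$ with $a\in N(u,i,A_1)\setminus N(u,i-1,A_1)$, and the principal symbol of $a$ is $\pi(a)=a+N(u,i-1,A_1)\in\mathcal{G}(u,A_1)$. A $K$-basis $E=\{e_j\}_{j\in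 J}$ of $N(u,A_1)$ is a principal basis if $\{\pi(e_j)\}_{j\in J}$ is a $K$-basis of $\mathcal{G}(u,A_1)$. Data attached to $u=\alpha v_n$ as in part 1: in $B$, $u=\alpha'X^n$ with $\alpha'\in K(H)$ monic. Let $s$ be the minimal positive divisor of $n$ for which, with $t=\mathrm{sign}(n)s$, there exists a monic $\beta\in K(H)$ (then unique) with $\beta\,\sigma^{t}(\beta)\cdots\sigma^{(n/t-1)t}(\beta)=\alpha'$. Put $v=\beta X^t$ (the canonical generator of the centralizer $C(u,B)=K[v,v^{-1}]$), so $v^m=u$ with $m=n/t\geq 1$. Let $\gamma\in K(H)$ be the monic element with $v=\gamma v_t$ (so $\gamma=\beta$ if $t>0$, and $\gamma=\beta\,(H(H+1)\cdots(H-t-1))^{-1}$ if $t<0$). For $i=0,\ldots,m-1$ put $\mu_i=\min\{j\geq 0\mid v^j\in A_1,\ j\equiv i\ (\mathrm{mod}\ m)\}$ (these exist), and let $\mu=\max\{1,\mu_0,\ldots,\mu_{m-1}\}$. For $i=1,\ldots,\mu-1$, $g_i\in K[H]$ is the unique monic polynomial of minimal possible degree such that $g_iv^i\in A_1$. For $i\geq 1$, $f_i\in K[H]$ is the unique monic polynomial such that $K[H]v^{-i}\cap K[H]v_{-it}=K[H]f_iv_{-it}$. *)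

theory Defs
  imports "HOL-Algebra.Algebraic_Closure_Type" "HOL-Algebra.Generated_Rings"
begin

section \<open>The field of rational functions and its shift automorphism\<close>

text \<open>\<open>K[H]\<close> is the type \<open>'k poly\<close> and \<open>K(H)\<close> the type \<open>'k poly fract\<close>.
  The function \<open>sigma i\<close> is the \<open>i\<close>-th power of the automorphism with \<open>H \<mapsto> H - 1\<close>,
  so it substitutes \<open>H - i\<close> for \<open>H\<close>; negative \<open>i\<close> are allowed.\<close>

definition poly_translate :: "int \<Rightarrow> 'k::field poly \<Rightarrow> 'k poly" where
  "poly_translate i p = pcompose p [:- of_int i, 1:]"

lemma poly_translate_simps [simp]:
  "poly_translate i 0 = 0" "poly_translate i 1 = 1"
  "poly_translate i (p + q) = poly_translate i p + poly_translate i q"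
  "poly_translate i (p * q) = poly_translate i p * poly_translate i q"
  "poly_translate 0 p = p"
  by (simp_all add: poly_translate_def pcompose_add pcompose_mult pcompose_1)

lemma poly_translate_shift [simp]: "poly_translate i (poly_translate j p) = poly_translate (i + j) p"
  by (simp add: poly_translate_def pcompose_assoc [symmetric] pcompose_pCons algebra_simps)

lemma poly_translate_eq_0_iff [simp]: "poly_translate i p = 0 \<longleftrightarrow> p = 0"
proof
  assume "poly_translate i p = 0"
  then have "poly_translate (- i) (poly_translate i p) = 0" by simp
  then show "p = 0" by (simp del: poly_translate_simps(1) add: poly_translate_simps(5))
qed simp

definition sigma :: "int \<Rightarrow> 'k::field poly fract \<Rightarrow> 'k poly fract" where
  "sigma i f = (THE g. \<exists>p q. q \<noteq> 0 \<and> f = Fract p q \<and> g = Fract (poly_translate i p) (poly_translate i q))"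

lemma sigma_Fract: "sigma i (Fract p q) = Fract (poly_translate i p) (poly_translate i q)"
proof -
  have main: "sigma i (Fract p q) = Fract (poly_translate i p) (poly_translate i q)" if "q \<noteq> 0" for p q :: "'a poly"
    unfolding sigma_def
  proof (rule the_equality)
    show "\<exists>p' q'. q' \<noteq> 0 \<and> Fract p q = Fract p' q' \<and>
        Fract (poly_translate i p) (poly_translate i q) = Fract (poly_translate i p') (poly_translate i q')"
      using that by blast
  next
    fix g assume "\<exists>p' q'. q' \<noteq> 0 \<and> Fract p q = Fract p' q' \<and>
        g = Fract (poly_translate i p') (poly_translate i q')"
    then obtain p' q' where *: "q' \<noteq> 0" "Fract p q = Fract p' q'"
        "g = Fract (poly_translate i p') (poly_translate i q')"
      by blast
    from *(2) have "p * q' = p' * q" using eq_fract(1) [OF that *(1)] by blast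
    then have "poly_translate i (p * q') = poly_translate i (p' * q)" by (rule arg_cong)
    then have "poly_translate i p * poly_translate i q' = poly_translate i p' * poly_translate i q"
      by (simp only: poly_translate_simps)
    with * that show "g = Fract (poly_translate i p) (poly_translate i q)"
      by (simp add: eq_fract(1))
  qed
  show ?thesis
  proof (cases "q = 0")
    case True
    then have "Fract p q = Fract 0 1" by (simp add: eq_fract(2))
    with True main [where p = 0 and q = 1] show ?thesis by (simp add: fract_collapse)
  qed (rule main)
qed

lemma sigma_simps [simp]:
  "sigma i 0 = 0" "sigma i 1 = 1"
  "sigma i (f + g) = sigma i f + sigma i g"
  "sigma i (f * g) = sigma i f * sigma i g"
  "sigma 0 f = f"
  "sigma i (sigma j f) = sigma (i + j) f"
proof -
  show "sigma i 0 = 0" "sigma i 1 = 1"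
    by (simp_all add: Zero_fract_def One_fract_def sigma_Fract)
  show "sigma i (f + g) = sigma i f + sigma i g"
    by (cases f, cases g) (simp add: sigma_Fract)
  show "sigma i (f * g) = sigma i f * sigma i g"
    by (cases f, cases g) (simp add: sigma_Fract)
  show "sigma 0 f = f" by (cases f) (simp add: sigma_Fract)
  show "sigma i (sigma j f) = sigma (i + j) f" by (cases f) (simp add: sigma_Fract)
qed

lemma sigma_sum: "sigma i (sum f A) = (\<Sum>x\<in>A. sigma i (f x))"
  by (induction A rule: infinite_finite_induct) auto

definition monic_fract :: "'k::field poly fract \<Rightarrow> bool" where
  "monic_fract f \<longleftrightarrow> (\<exists>p q. lead_coeff p = 1 \<and> lead_coeff q = 1 \<and> f = Fract p q)"

text \<open>Meaningful for nonzero rational functions only.\<close>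

definition deg_H :: "'k::field poly fract \<Rightarrow> int" where
  "deg_H f = (THE d. \<exists>p q. p \<noteq> 0 \<and> q \<noteq> 0 \<and> f = Fract p q \<and>
                 d = int (Polynomial.degree p) - int (Polynomial.degree q))"


section \<open>The skew Laurent polynomial ring\<close>

text \<open>The element \<open>\<Sum>\<^sub>i a\<^sub>i X\<^sup>i\<close> of \<open>B = K(H)[X, X\<^sup>-\<^sup>1; \<sigma>]\<close> is represented by its
  family of left coefficients \<open>i \<mapsto> a\<^sub>i\<close>.\<close>

typedef (overloaded) 'k skew =
  "{a :: int \<Rightarrow> 'k::field_char_0 poly fract. finite {i. a i \<noteq> 0}}"
  morphisms coord Abs_skew
  by (rule exI [of _ "\<lambda>_. 0"]) simp

lemma finite_coord [simp, intro]: "finite {i. coord a i \<noteq> 0}"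
  using coord by auto

lemma skew_eqI: "(\<And>i. coord a i = coord b i) \<Longrightarrow> a = b"
  by (simp add: coord_inject [symmetric] fun_eq_iff)

lemma coord_Abs: "finite {i. a i \<noteq> 0} \<Longrightarrow> coord (Abs_skew a) = a"
  by (simp add: Abs_skew_inverse)

definition skew_monom :: "'k::field_char_0 poly fract \<Rightarrow> int \<Rightarrow> 'k skew" where
  "skew_monom f i = Abs_skew (\<lambda>j. if j = i then f else 0)"

lemma coord_monom: "coord (skew_monom f i) j = (if j = i then f else 0)"
proof -
  have "finite {j. (if j = i then f else 0) \<noteq> 0}"
    by (rule finite_subset [of _ "{i}"]) auto
  then show ?thesis by (simp add: skew_monom_def coord_Abs)
qed

instantiation skew :: (field_char_0) ab_group_add
begin

definition zero_skew :: "'a skew" where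
  "0 = Abs_skew (\<lambda>_. 0)"

definition plus_skew :: "'a skew \<Rightarrow> 'a skew \<Rightarrow> 'a skew" where
  "a + b = Abs_skew (\<lambda>i. coord a i + coord b i)"

definition uminus_skew :: "'a skew \<Rightarrow> 'a skew" where
  "- a = Abs_skew (\<lambda>i. - coord a i)"

definition minus_skew :: "'a skew \<Rightarrow> 'a skew \<Rightarrow> 'a skew" where
  "a - b = Abs_skew (\<lambda>i. coord a i - coord b i)"

lemma coord_add_simps [simp]:
  fixes a b :: "'a skew"
  shows "coord (0 :: 'a skew) i = 0" "coord (a + b) i = coord a i + coord b i"
    "coord (- a) i = - coord a i" "coord (a - b) i = coord a i - coord b i"
proof -
  have "finite {i. coord a i + coord b i \<noteq> 0}" "finite {i. coord a i - coord b i \<noteq> 0}"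
    by (rule finite_subset [of _ "{i. coord a i \<noteq> 0} \<union> {i. coord b i \<noteq> 0}"]; auto)+
  then show "coord (0 :: 'a skew) i = 0" "coord (a + b) i = coord a i + coord b i"
    "coord (- a) i = - coord a i" "coord (a - b) i = coord a i - coord b i"
    by (simp_all add: zero_skew_def plus_skew_def uminus_skew_def minus_skew_def coord_Abs)
qed

instance
  by standard (rule skew_eqI; simp add: algebra_simps)+

end

instantiation skew :: (field_char_0) ring_1
begin

definition one_skew :: "'a skew" where "1 = skew_monom 1 0"

definition times_skew :: "'a skew \<Rightarrow> 'a skew \<Rightarrow> 'a skew" where
  "a * b = Abs_skew (\<lambda>n. \<Sum>i | coord a i \<noteq> 0. coord a i * sigma i (coord b (n - i)))"

lemma coord_times:
  "coord (a * b) n = (\<Sum>i | coord a i \<noteq> 0. coord a i * sigma i (coord b (n - i)))"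
proof -
  let ?A = "{i. coord a i \<noteq> 0}" and ?B = "{i. coord b i \<noteq> 0}"
  have "{n. (\<Sum>i\<in>?A. coord a i * sigma i (coord b (n - i))) \<noteq> 0}
          \<subseteq> (\<lambda>(i, j). i + j) ` (?A \<times> ?B)"
  proof
    fix n assume "n \<in> {n. (\<Sum>i\<in>?A. coord a i * sigma i (coord b (n - i))) \<noteq> 0}"
    then obtain i where i: "coord a i \<noteq> 0" "coord a i * sigma i (coord b (n - i)) \<noteq> 0"
      by (auto elim: sum.not_neutral_contains_not_neutral)
    then have "coord b (n - i) \<noteq> 0" by auto
    with i show "n \<in> (\<lambda>(i, j). i + j) ` (?A \<times> ?B)"
      by (intro image_eqI [of _ _ "(i, n - i)"]) auto
  qed
  then have "finite {n. (\<Sum>i\<in>?A. coord a i * sigma i (coord b (n - i))) \<noteq> 0}"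
    by (rule finite_subset) auto
  then show ?thesis by (simp add: times_skew_def coord_Abs)
qed

lemma coord_mult:
  assumes "finite S" "{i. coord a i \<noteq> 0} \<subseteq> S"
  shows "coord (a * b) n = (\<Sum>i\<in>S. coord a i * sigma i (coord b (n - i)))"
  using assms by (auto simp: coord_times intro!: sum.mono_neutral_left)

instance
proof
  fix a b c :: "'a skew"
  let ?A = "{i. coord a i \<noteq> 0}" and ?B = "{i. coord b i \<noteq> 0}"
  let ?S = "(\<lambda>(i, j). i + j) ` (?A \<times> ?B)"
  show "a * b * c = a * (b * c)"
  proof (rule skew_eqI)
    fix n
    have finS: "finite ?S" by blast
    have sub: "{i. coord (a * b) i \<noteq> 0} \<subseteq> ?S"
    proof
      fix n assume "n \<in> {i. coord (a * b) i \<noteq> 0}"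
      then obtain i where i: "coord a i \<noteq> 0" "coord a i * sigma i (coord b (n - i)) \<noteq> 0"
        by (auto simp: coord_mult [OF finite_coord subset_refl]
                 elim: sum.not_neutral_contains_not_neutral)
      then have "coord b (n - i) \<noteq> 0" by auto
      with i show "n \<in> ?S" by (intro image_eqI [of _ _ "(i, n - i)"]) auto
    qed
    have inner: "(\<Sum>k\<in>?S. sigma i (coord b (k - i)) * sigma k (coord c (n - k)))
        = (\<Sum>j\<in>?B. sigma i (coord b j) * sigma (i + j) (coord c (n - i - j)))"
      if "i \<in> ?A" for i
    proof -
      have "(\<Sum>k\<in>?S. sigma i (coord b (k - i)) * sigma k (coord c (n - k)))
          = (\<Sum>k\<in>(+) i ` ?B. sigma i (coord b (k - i)) * sigma k (coord c (n - k)))"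
      proof (rule sum.mono_neutral_right [OF finS])
        show "(+) i ` ?B \<subseteq> ?S" using that by auto
        show "\<forall>k\<in>?S - (+) i ` ?B. sigma i (coord b (k - i)) * sigma k (coord c (n - k)) = 0"
        proof
          fix k assume "k \<in> ?S - (+) i ` ?B"
          then have "coord b (k - i) = 0"
            by (metis (mono_tags, lifting) DiffD2 add_diff_cancel_left' diff_add_cancel
                add.commute image_eqI mem_Collect_eq)
          then show "sigma i (coord b (k - i)) * sigma k (coord c (n - k)) = 0" by simp
        qed
      qed
      also have "\<dots> = (\<Sum>j\<in>?B. sigma i (coord b j) * sigma (i + j) (coord c (n - i - j)))"
        by (subst sum.reindex) (auto simp: o_def diff_diff_eq)
      finally show ?thesis .
    qed
    have "coord (a * b * c) n
        = (\<Sum>k\<in>?S. \<Sum>i\<in>?A. coord a i * (sigma i (coord b (k - i)) * sigma k (coord c (n - k))))"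
      by (simp only: coord_mult [OF finS sub] coord_times [of a b] sum_distrib_right mult.assoc)
    also have "\<dots> = (\<Sum>i\<in>?A. coord a i *
                     (\<Sum>k\<in>?S. sigma i (coord b (k - i)) * sigma k (coord c (n - k))))"
      by (subst sum.swap) (simp add: sum_distrib_left)
    also have "\<dots> = coord (a * (b * c)) n"
      unfolding coord_mult [OF finite_coord subset_refl]
      by (rule sum.cong) (simp_all only: inner sigma_sum sigma_simps)
    finally show "coord (a * b * c) n = coord (a * (b * c)) n" .
  qed
  show "1 * a = a"
  proof (rule skew_eqI)
    fix n show "coord (1 * a) n = coord a n"
      by (subst coord_mult [of "{0}"]) (auto simp: one_skew_def coord_monom)
  qed
  show "a * 1 = a"
  proof (rule skew_eqI)
    fix n
    have "coord (a * 1) n = (\<Sum>i\<in>insert n ?A. coord a i * sigma i (coord 1 (n - i)))"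
      by (rule coord_mult) auto
    also have "\<dots> = (\<Sum>i\<in>insert n ?A. if n = i then coord a i else 0)"
      by (rule sum.cong) (auto simp: one_skew_def coord_monom)
    also have "\<dots> = coord a n" by (subst sum.delta') auto
    finally show "coord (a * 1) n = coord a n" .
  qed
  show "(a + b) * c = a * c + b * c"
  proof (rule skew_eqI)
    fix n
    have "coord ((a + b) * c) n
        = (\<Sum>i\<in>?A \<union> ?B. coord (a + b) i * sigma i (coord c (n - i)))"
      by (rule coord_mult) auto
    also have "\<dots> = coord (a * c + b * c) n"
      by (simp add: distrib_right sum.distrib coord_mult [of "?A \<union> ?B"])
    finally show "coord ((a + b) * c) n = coord (a * c + b * c) n" .
  qed
  show "a * (b + c) = a * b + a * c"
    by (rule skew_eqI)
       (simp add: coord_mult [OF finite_coord subset_refl] distrib_left sum.distrib)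
  have "coord (0 :: 'a skew) 0 \<noteq> coord 1 0" by (simp add: one_skew_def coord_monom)
  then show "(0 :: 'a skew) \<noteq> 1" by metis
qed

end

lemma skew_monom_mult [simp]:
  "skew_monom f i * skew_monom g j = skew_monom (f * sigma i g) (i + j)"
proof (rule skew_eqI)
  fix n show "coord (skew_monom f i * skew_monom g j) n
      = coord (skew_monom (f * sigma i g) (i + j)) n"
    by (subst coord_mult [of "{i}"]) (auto simp: coord_monom)
qed

text \<open>The inverse of a unit; it is what gives \<open>powi\<close> its meaning for negative exponents.
  On non-units the value is irrelevant.\<close>

instantiation skew :: (field_char_0) inverse
begin

definition inverse_skew :: "'a skew \<Rightarrow> 'a skew" where
  "inverse_skew a = (if \<exists>b. a * b = 1 \<and> b * a = 1 then THE b. a * b = 1 \<and> b * a = 1 else 0)"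

definition divide_skew :: "'a skew \<Rightarrow> 'a skew \<Rightarrow> 'a skew" where
  "divide_skew a b = a * inverse b"

instance ..

end

lemma skew_inverse_unique:
  fixes a b :: "'k::field_char_0 skew"
  assumes "a * b = 1" "b * a = 1"
  shows "inverse a = b"
proof -
  have "c = b" if "a * c = 1 \<and> c * a = 1" for c
    using that assms by (metis mult.assoc mult_1_left mult_1_right)
  with assms have "(THE b. a * b = 1 \<and> b * a = 1) = b" by blast
  with assms show ?thesis unfolding inverse_skew_def by auto
qed

lemma inverse_skew_monom:
  assumes "f \<noteq> 0"
  shows "inverse (skew_monom f i) = skew_monom (sigma (- i) (inverse f)) (- i)"
proof (rule skew_inverse_unique)
  have "sigma (- i) (inverse f) * sigma (- i) f = sigma (- i) (inverse f * f)"
    by (simp only: sigma_simps)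
  with assms show "skew_monom (sigma (- i) (inverse f)) (- i) * skew_monom f i = 1"
    by (simp add: one_skew_def del: sigma_simps(4))
qed (use assms in \<open>simp add: one_skew_def\<close>)


section \<open>The first Weyl algebra\<close>

definition of_fract :: "'k::field_char_0 poly fract \<Rightarrow> 'k skew" where
  "of_fract f = skew_monom f 0"

definition of_poly :: "'k::field_char_0 poly \<Rightarrow> 'k skew" where
  "of_poly p = of_fract (to_fract p)"

definition scal :: "'k::field_char_0 \<Rightarrow> 'k skew \<Rightarrow> 'k skew" where
  "scal c a = of_poly [:c:] * a"

definition genX :: "'k::field_char_0 skew" where
  "genX = skew_monom 1 1"

definition genH :: "'k::field_char_0 skew" where
  "genH = of_poly [:0, 1:]"

definition genY :: "'k::field_char_0 skew" where
  "genY = genH * genX powi (- 1)"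

text \<open>The \<open>K\<close>-subalgebra of \<open>B\<close> generated by \<open>X\<close> and \<open>Y = H X\<^sup>-\<^sup>1\<close>.\<close>

inductive_set weyl :: "'k::field_char_0 skew set" where
  const: "scal c 1 \<in> weyl"
| X: "genX \<in> weyl"
| Y: "genY \<in> weyl"
| add: "a \<in> weyl \<Longrightarrow> b \<in> weyl \<Longrightarrow> a + b \<in> weyl"
| mult: "a \<in> weyl \<Longrightarrow> b \<in> weyl \<Longrightarrow> a * b \<in> weyl"

lemma genX_commute: "genX * of_fract f = of_fract (sigma 1 f) * genX"
  by (simp add: genX_def of_fract_def)

lemma genY_eq: "genY = skew_monom (to_fract [:0, 1:]) (- 1)"
  by (simp add: genY_def genH_def genX_def of_poly_def of_fract_def power_int_def
      inverse_skew_monom)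

lemma genY_genX: "genY * genX = (genH :: 'k::field_char_0 skew)"
  by (simp add: genY_eq genX_def genH_def of_poly_def of_fract_def)

lemma weyl_relation: "genY * genX - genX * genY = (1 :: 'k::field_char_0 skew)"
proof (rule skew_eqI)
  fix i show "coord (genY * genX - genX * genY) i = coord (1 :: 'k skew) i"
    by (simp add: genY_eq genX_def one_skew_def coord_monom to_fract_def sigma_Fract
        poly_translate_def pcompose_pCons)
       (simp add: One_fract_def one_pCons)
qed

definition vgen :: "int \<Rightarrow> 'k::field_char_0 skew" where
  "vgen n = (if n \<ge> 0 then genX ^ nat n else genY ^ nat (- n))"

definition KH_span :: "'k::field_char_0 skew \<Rightarrow> 'k skew set" where
  "KH_span w = range (\<lambda>p. of_poly p * w)"


section \<open>Generic notions for algebras\<close>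

definition assoc_algebra :: "('c, 'd) ring_scheme \<Rightarrow> ('c, 'a, 'e) module_scheme \<Rightarrow> bool" where
  "assoc_algebra R M \<longleftrightarrow> module R M \<and> ring M \<and>
     (\<forall>c\<in>carrier R. \<forall>x\<in>carrier M. \<forall>y\<in>carrier M.
        (c \<odot>\<^bsub>M\<^esub> x) \<otimes>\<^bsub>M\<^esub> y = c \<odot>\<^bsub>M\<^esub> (x \<otimes>\<^bsub>M\<^esub> y) \<and>
        x \<otimes>\<^bsub>M\<^esub> (c \<odot>\<^bsub>M\<^esub> y) = c \<odot>\<^bsub>M\<^esub> (x \<otimes>\<^bsub>M\<^esub> y))"

text \<open>Finitely generated as an algebra over the field \<open>'k\<close>: the ring generated by the image of
  the scalars and a finite set is everything.\<close>

definition affine_algebra :: "('k, 'a, 'e) module_scheme \<Rightarrow> bool" where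
  "affine_algebra M \<longleftrightarrow> (\<exists>S. finite S \<and> S \<subseteq> carrier M \<and>
     generate_ring M (range (\<lambda>c. c \<odot>\<^bsub>M\<^esub> \<one>\<^bsub>M\<^esub>) \<union> S) = carrier M)"

text \<open>The predicate \<open>noetherian_ring\<close> of the library refers to two-sided ideals only,
  which is too weak for noncommutative rings.\<close>

definition left_ideal :: "'a set \<Rightarrow> ('a, 'e) ring_scheme \<Rightarrow> bool" where
  "left_ideal I R \<longleftrightarrow> additive_subgroup I R \<and> (\<forall>a\<in>I. \<forall>x\<in>carrier R. x \<otimes>\<^bsub>R\<^esub> a \<in> I)"

definition right_ideal :: "'a set \<Rightarrow> ('a, 'e) ring_scheme \<Rightarrow> bool" where
  "right_ideal I R \<longleftrightarrow> additive_subgroup I R \<and> (\<forall>a\<in>I. \<forall>x\<in>carrier R. a \<otimes>\<^bsub>R\<^esub> x \<in> I)"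

definition left_noetherian :: "('a, 'e) ring_scheme \<Rightarrow> bool" where
  "left_noetherian R \<longleftrightarrow> ring R \<and>
     (\<forall>I. left_ideal I R \<longrightarrow>
        (\<exists>A \<subseteq> carrier R. finite A \<and> I = \<Inter> {J. left_ideal J R \<and> A \<subseteq> J}))"

definition right_noetherian :: "('a, 'e) ring_scheme \<Rightarrow> bool" where
  "right_noetherian R \<longleftrightarrow> ring R \<and>
     (\<forall>I. right_ideal I R \<longrightarrow>
        (\<exists>A \<subseteq> carrier R. finite A \<and> I = \<Inter> {J. right_ideal J R \<and> A \<subseteq> J}))"

text \<open>The family \<open>(e j)\<close>, \<open>j \<in> J\<close>, is a basis of \<open>M\<close> over the field \<open>'k\<close>.\<close>

definition family_basis :: "('k::field, 'a, 'e) module_scheme \<Rightarrow> 'j set \<Rightarrow> ('j \<Rightarrow> 'a) \<Rightarrow> bool" where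
  "family_basis M J e \<longleftrightarrow> e ` J \<subseteq> carrier M \<and>
     (\<forall>F c. finite F \<and> F \<subseteq> J \<and> finsum M (\<lambda>j. c j \<odot>\<^bsub>M\<^esub> e j) F = \<zero>\<^bsub>M\<^esub> \<longrightarrow> (\<forall>j\<in>F. c j = 0)) \<and>
     (\<forall>x\<in>carrier M. \<exists>F c. finite F \<and> F \<subseteq> J \<and> x = finsum M (\<lambda>j. c j \<odot>\<^bsub>M\<^esub> e j) F)"

definition internal_direct_sum :: "'a::ab_group_add set \<Rightarrow> 'i set \<Rightarrow> ('i \<Rightarrow> 'a set) \<Rightarrow> bool" where
  "internal_direct_sum V I M \<longleftrightarrow>
     V = {sum x F | x F. finite F \<and> F \<subseteq> I \<and> (\<forall>i\<in>F. x i \<in> M i)} \<and>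
     (\<forall>x F. finite F \<and> F \<subseteq> I \<and> (\<forall>i\<in>F. x i \<in> M i) \<and> sum x F = 0 \<longrightarrow> (\<forall>i\<in>F. x i = 0))"


section \<open>The filtration defined by an inner derivation\<close>

definition ad :: "'k::field_char_0 skew \<Rightarrow> 'k skew \<Rightarrow> 'k skew" where
  "ad u a = u * a - a * u"

definition nil_filt :: "'k::field_char_0 skew \<Rightarrow> int \<Rightarrow> 'k skew set" where
  "nil_filt u i = (if i < 0 then {0} else {a \<in> weyl. (ad u ^^ nat (i + 1)) a = 0})"

definition nil_set :: "'k::field_char_0 skew \<Rightarrow> 'k skew set" where
  "nil_set u = (\<Union>i::nat. nil_filt u (int i))"

definition centralizer :: "'k::field_char_0 skew \<Rightarrow> 'k skew set" where
  "centralizer u = nil_filt u 0"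

definition nil_alg :: "'k::field_char_0 skew \<Rightarrow> ('k, 'k skew) module" where
  "nil_alg u = \<lparr>carrier = nil_set u, monoid.mult = (*), one = 1, ring.zero = 0, add = (+),
     module.smult = scal\<rparr>"

definition ndeg :: "'k::field_char_0 skew \<Rightarrow> 'k skew \<Rightarrow> nat" where
  "ndeg u a = (THE i. a \<in> nil_filt u (int i) - nil_filt u (int i - 1))"

text \<open>The associated graded algebra. An element is a family whose \<open>i\<close>-th member is a coset of
  \<open>N(u, i - 1)\<close> in \<open>N(u, i)\<close>, almost all members being the zero coset. The homogeneous product
  is \<open>(a + N(u, i - 1)) (b + N(u, j - 1)) = a b + N(u, i + j - 1)\<close>.\<close>

definition filt_coset :: "'k::field_char_0 skew \<Rightarrow> nat \<Rightarrow> 'k skew \<Rightarrow> 'k skew set" where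
  "filt_coset u i a = (+) a ` nil_filt u (int i - 1)"

definition graded_elem :: "'k::field_char_0 skew \<Rightarrow> nat \<Rightarrow> 'k skew \<Rightarrow> nat \<Rightarrow> 'k skew set" where
  "graded_elem u i a = (\<lambda>j. filt_coset u j (if j = i then a else 0))"

definition graded_alg :: "'k::field_char_0 skew \<Rightarrow> ('k, nat \<Rightarrow> 'k skew set) module" where
  "graded_alg u =
     \<lparr>carrier = {F. (\<forall>i. F i \<in> filt_coset u i ` nil_filt u (int i)) \<and>
                   finite {i. F i \<noteq> filt_coset u i 0}},
      monoid.mult = (\<lambda>F G k. {(\<Sum>i\<le>k. a i * b (k - i)) + c | a b c.
                   (\<forall>i. a i \<in> F i) \<and> (\<forall>j. b j \<in> G j) \<and> c \<in> nil_filt u (int k - 1)}),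
      one = graded_elem u 0 1,
      ring.zero = (\<lambda>i. filt_coset u i 0),
      add = (\<lambda>F G i. {a + b | a b. a \<in> F i \<and> b \<in> G i}),
      module.smult = (\<lambda>c F i. {scal c a + b | a b. a \<in> F i \<and> b \<in> nil_filt u (int i - 1)})\<rparr>"

definition principal_symbol :: "'k::field_char_0 skew \<Rightarrow> 'k skew \<Rightarrow> nat \<Rightarrow> 'k skew set" where
  "principal_symbol u a = graded_elem u (ndeg u a) a"

definition principal_basis :: "'k::field_char_0 skew \<Rightarrow> 'j set \<Rightarrow> ('j \<Rightarrow> 'k skew) \<Rightarrow> bool" where
  "principal_basis u J e \<longleftrightarrow>
     family_basis (nil_alg u) J e \<and> family_basis (graded_alg u) J (\<lambda>j. principal_symbol u (e j))"


section \<open>The data attached to a homogeneous element of nonzero degree\<close>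

text \<open>Throughout, \<open>n\<close> is the (nonzero) degree of \<open>u = \<alpha>' X\<^sup>n\<close>, so that \<open>\<alpha>' = coord u n\<close>.
  The predicate \<open>root_coeff u n t \<beta>\<close> says that \<open>(\<beta> X\<^sup>t)\<^sup>n\<^sup>/\<^sup>t = u\<close>, with \<open>\<beta>\<close> monic.\<close>

definition root_coeff ::
    "'k::field_char_0 skew \<Rightarrow> int \<Rightarrow> int \<Rightarrow> 'k poly fract \<Rightarrow> bool" where
  "root_coeff u n t \<beta> \<longleftrightarrow> monic_fract \<beta> \<and> (\<Prod>k<nat (n div t). sigma (int k * t) \<beta>) = coord u n"

definition canon_s :: "'k::field_char_0 skew \<Rightarrow> int \<Rightarrow> nat" where
  "canon_s u n = (LEAST s. 0 < s \<and> int s dvd n \<and> (\<exists>\<beta>. root_coeff u n (sgn n * int s) \<beta>))"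

definition canon_t :: "'k::field_char_0 skew \<Rightarrow> int \<Rightarrow> int" where
  "canon_t u n = sgn n * int (canon_s u n)"

definition canon_m :: "'k::field_char_0 skew \<Rightarrow> int \<Rightarrow> nat" where
  "canon_m u n = nat (n div canon_t u n)"

definition canon_beta :: "'k::field_char_0 skew \<Rightarrow> int \<Rightarrow> 'k poly fract" where
  "canon_beta u n = (THE \<beta>. root_coeff u n (canon_t u n) \<beta>)"

definition canon_v :: "'k::field_char_0 skew \<Rightarrow> int \<Rightarrow> 'k skew" where
  "canon_v u n = of_fract (canon_beta u n) * genX powi (canon_t u n)"

definition canon_gamma :: "'k::field_char_0 skew \<Rightarrow> int \<Rightarrow> 'k poly fract" where
  "canon_gamma u n =
     (THE \<gamma>. monic_fract \<gamma> \<and> canon_v u n = of_fract \<gamma> * vgen (canon_t u n))"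

definition canon_mu_i :: "'k::field_char_0 skew \<Rightarrow> int \<Rightarrow> nat \<Rightarrow> nat" where
  "canon_mu_i u n i =
     (LEAST j. canon_v u n ^ j \<in> weyl \<and> j mod canon_m u n = i mod canon_m u n)"

definition canon_mu :: "'k::field_char_0 skew \<Rightarrow> int \<Rightarrow> nat" where
  "canon_mu u n = Max (insert 1 (canon_mu_i u n ` {..<canon_m u n}))"

definition canon_g :: "'k::field_char_0 skew \<Rightarrow> int \<Rightarrow> nat \<Rightarrow> 'k poly" where
  "canon_g u n i =
     (THE g. is_arg_min Polynomial.degree
               (\<lambda>h. lead_coeff h = 1 \<and> of_poly h * canon_v u n ^ i \<in> weyl) g)"

definition canon_f :: "'k::field_char_0 skew \<Rightarrow> int \<Rightarrow> nat \<Rightarrow> 'k poly" where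
  "canon_f u n i =
     (THE f. lead_coeff f = 1 \<and>
        KH_span (canon_v u n powi (- int i)) \<inter> KH_span (vgen (- int i * canon_t u n))
          = KH_span (of_poly f * vgen (- int i * canon_t u n)))"

end

theory Submission
  imports Defs "HOL-Library.Poly_Mapping"
begin

text \<open>In \<open>B\<close> the nilpotent elements of \<open>ad u\<close> are the sums \<open>\<Sum>\<^sub>j p\<^sub>j v\<^sup>j\<close> with polynomials \<open>p\<^sub>j\<close>, since
  \<open>ad u\<close> maps \<open>p v\<^sup>j\<close> to \<open>(\<sigma>\<^sup>n(p) - p) v\<^bsup>j+m\<^esup>\<close>, and a difference operator lowers degrees by one and has
  no rational solutions beyond the polynomial ones. Intersecting with the Weyl algebra replaces
  \<open>K[H] v\<^sup>j\<close> by \<open>K[H] d\<^sub>j v\<^sup>j\<close>, where \<open>d\<^sub>j\<close> is the denominator of the coefficient of \<open>v\<^sup>j\<close> with respect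
  to \<open>v\<^bsub>jt\<^esub>\<close>, and the filtration is by the degree in \<open>H\<close>. With \<open>a\<^sub>j = deg d\<^sub>j\<close>, the graded algebra is
  therefore the monoid algebra of \<open>{(k, j). a\<^sub>j \<le> k}\<close>. This monoid is finitely generated, since \<open>a\<^sub>j\<close> is
  zero for \<open>j \<ge> \<mu>\<close> and linear for \<open>j \<le> -\<mu>\<close>. Noetherianity of both algebras follows from
  Dickson's lemma by reduction with respect to leading exponents.\<close>

section \<open>Translations and differences\<close>

text \<open>Two normalisations of a homogeneous component compete. Relative to the powers of v, ad u
  is a pure difference operator and nilpotency is a bound on degrees; relative to the elements v_l,
  membership in A_1 is polynomiality. The quotient \<open>\<rho> j\<close> of v^j by v_{jt} converts
  one into the other: its reduced denominator \<open>d j\<close> and numerator \<open>F j\<close>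
  give the same generator b_j = d_j v^j = F_j v_{jt} of K[H] v^j \<inter> A_1, and comparing degrees
  in this identity yields the ndeg formulas. In degrees not divisible by t, ad u is injective, and
  this is where the minimality of s enters. The twist by \<sigma> is invisible on top coefficients
  in H, so symbols are commutative Laurent polynomials. Noetherianity is not lifted from the graded
  algebra: one reduction argument over an abstract filtered group with such symbols is applied to
  left multiplication, to right multiplication and to the graded product. The slope e \<ge> 1, which
  controls the negative indices there, comes from \<alpha> being a polynomial and t being
  nonzero.\<close>

lemma poly_translate_diff [simp]:
  "poly_translate i (p - q) = poly_translate i p - poly_translate i q"
  by (simp add: poly_translate_def pcompose_diff)

lemma poly_translate_const [simp]: "poly_translate i [:c:] = [:c:]"
  by (simp add: poly_translate_def)

lemma degree_poly_translate [simp]: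
  "degree (poly_translate i p) = degree p"
  by (simp add: poly_translate_def degree_pcompose)

lemma lead_coeff_poly_translate [simp]:
  "coeff (poly_translate i p) (degree p) = lead_coeff p"
proof -
  have "lead_coeff (pcompose p [:- of_int i, 1:]) = lead_coeff p * lead_coeff [:- of_int i, 1:] ^ degree p"
    by (rule lead_coeff_comp) simp
  then show ?thesis by (simp add: poly_translate_def degree_pcompose)
qed

lemma coeff_poly_translate_degree:
  assumes "degree p \<le> d"
  shows "coeff (poly_translate i p) d = coeff p d"
  using assms lead_coeff_poly_translate [of i p]
  by (cases "degree p = d") (auto simp: coeff_eq_0)

text \<open>Taylor expansion p(H - i) = p - i p' + ...: for degree at most d + 1, only the
  derivative term reaches position d besides p itself.\<close>

lemma coeff_poly_translate_Suc:
  assumes "degree p \<le> Suc d"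
  shows "coeff (poly_translate i p) d =
    coeff p d - of_int i * of_nat (Suc d) * coeff p (Suc d)"
  using assms
proof (induction p arbitrary: d)
  case 0
  then show ?case by simp
next
  case (pCons a p)
  have *: "poly_translate i (pCons a p)
      = [:a:] + (smult (- of_int i) (poly_translate i p) + pCons 0 (poly_translate i p))"
    by (simp add: poly_translate_def pcompose_pCons)
  have deg: "degree p \<le> d"
    using pCons.prems by (cases "p = 0") auto
  show ?case
  proof (cases d)
    case 0
    with deg obtain c where "p = [:c:]"
      using degree_eq_zeroE by blast
    with 0 show ?thesis by (simp add: poly_translate_def pcompose_pCons)
  next
    case (Suc e)
    then show ?thesis
      using deg pCons.IH [of e] coeff_poly_translate_degree [of p d i]
      by (simp add: * algebra_simps)
  qed
qed

text \<open>In characteristic zero a nontrivial translation minus the identity lowers the degree of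
  a nonconstant polynomial by exactly one, since -i (deg h) times the leading coefficient is
  nonzero. Degree bounds are written as vanishing of the coefficients from k on, so that k = 0 means
  the zero polynomial.\<close>

lemma poly_difference_bound:
  fixes h :: "'k::field_char_0 poly"
  assumes "i \<noteq> 0"
  shows "(\<forall>l\<ge>k. coeff (poly_translate i h - h) l = 0) \<longleftrightarrow>
         (\<forall>l\<ge>Suc k. coeff h l = 0)"
proof
  assume *: "\<forall>l\<ge>Suc k. coeff h l = 0"
  show "\<forall>l\<ge>k. coeff (poly_translate i h - h) l = 0"
  proof (intro allI impI)
    fix l assume "l \<ge> k"
    with * have "degree h \<le> l" by (intro degree_le) auto
    then show "coeff (poly_translate i h - h) l = 0"
      by (simp add: coeff_poly_translate_degree)
  qed
next
  assume *: "\<forall>l\<ge>k. coeff (poly_translate i h - h) l = 0"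
  show "\<forall>l\<ge>Suc k. coeff h l = 0"
  proof (rule ccontr)
    assume "\<not> ?thesis"
    then obtain l where l: "l \<ge> Suc k" "coeff h l \<noteq> 0" by blast
    then have "Suc k \<le> degree h" "h \<noteq> 0"
      using le_degree [OF l(2)] by auto
    then obtain d where d: "degree h = Suc d" "k \<le> d"
      by (cases "degree h") auto
    with * have "coeff (poly_translate i h) d - coeff h d = 0" by simp
    then have "of_int i * of_nat (Suc d) * lead_coeff h = 0"
      using coeff_poly_translate_Suc [of h d i] d by simp
    with assms \<open>h \<noteq> 0\<close> show False by (auto simp del: of_nat_Suc)
  qed
qed

lemma poly_difference_surj:
  fixes g :: "'k::field_char_0 poly"
  assumes "i \<noteq> 0"
  obtains h where "poly_translate i h - h = g"
proof -
  have "\<exists>h. poly_translate i h - h = g" if "\<forall>l\<ge>k. coeff g l = 0" for k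
    using that
  proof (induction k arbitrary: g)
    case 0
    then have "g = 0" by (simp add: poly_eqI)
    then show ?case by (intro exI [of _ 0]) simp
  next
    case (Suc k)
    \<comment> \<open>Forced by the coefficient of degree k: the difference of c H^(k+1) contributes
      -i (k+1) c there, and this has to cancel the top coefficient of g.\<close>
    define c where "c = - coeff g k / (of_int i * of_nat (Suc k))"
    define h where "h = monom c (Suc k)"
    have deg: "degree h \<le> Suc k"
      by (simp add: h_def degree_monom_le)
    have "coeff (g - (poly_translate i h - h)) l = 0" if "l \<ge> k" for l
    proof (cases "l = k")
      case True
      then show ?thesis
        using assms coeff_poly_translate_Suc [OF deg, of i]
        by (simp add: h_def c_def del: of_nat_Suc)
    next
      case False
      with that have "Suc k \<le> l" by simp
      then have "coeff (poly_translate i h) l = coeff h l"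
        using deg by (intro coeff_poly_translate_degree) simp
      with Suc.prems \<open>Suc k \<le> l\<close> show ?thesis by simp
    qed
    then obtain h' where "poly_translate i h' - h' = g - (poly_translate i h - h)"
      using Suc.IH by blast
    then have "poly_translate i (h + h') - (h + h') = g" by (simp add: algebra_simps)
    then show ?case by blast
  qed
  moreover have "\<forall>l\<ge>Suc (degree g). coeff g l = 0"
    by (simp add: coeff_eq_0)
  ultimately show ?thesis using that by blast
qed

lemma poly_translate_fixed:
  fixes p :: "'k::field_char_0 poly"
  assumes "i \<noteq> 0" "poly_translate i p = p"
  obtains c where "p = [:c:]"
proof -
  have "\<forall>l\<ge>Suc 0. coeff p l = 0"
    using poly_difference_bound [OF assms(1), of 0 p] assms(2) by simp
  then have "degree p = 0" by (metis degree_le le_0_eq Suc_leI)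
  then show ?thesis using that degree_eq_zeroE by metis
qed

section \<open>Rational functions\<close>

lemma fract_cases_nz:
  fixes f :: "'k::field poly fract"
  obtains p q where "f = to_fract p / to_fract q" "lead_coeff q = 1"
proof -
  obtain a b where ab: "f = Fract a b" "b \<noteq> 0" by (cases f)
  let ?c = "inverse (lead_coeff b)"
  have "f = to_fract (smult ?c a) / to_fract (smult ?c b)"
    using ab by (simp add: Fract_conv_to_fract [symmetric] eq_fract)
  moreover have "lead_coeff (smult ?c b) = 1" using ab by simp
  ultimately show ?thesis using that by blast
qed

lemma sigma_to_fract [simp]: "sigma i (to_fract p) = to_fract (poly_translate i p)"
  by (simp add: to_fract_def sigma_Fract)

lemma sigma_uminus [simp]: "sigma i (- f) = - sigma i f"
  by (metis add.inverse_inverse add_eq_0_iff sigma_simps(1) sigma_simps(3))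

lemma sigma_diff [simp]: "sigma i (f - g) = sigma i f - sigma i g"
  by (metis diff_conv_add_uminus sigma_simps(3) sigma_uminus)

lemma sigma_eq_0_iff [simp]: "sigma i f = 0 \<longleftrightarrow> f = 0"
  by (metis add.right_inverse sigma_simps(1,5,6))

lemma sigma_inverse [simp]: "sigma i (inverse f) = inverse (sigma i f)"
proof (cases "f = 0")
  case False
  then have "sigma i (inverse f) * sigma i f = 1"
    by (simp del: sigma_simps(4) add: sigma_simps(4) [symmetric])
  then show ?thesis by (metis inverse_unique mult.commute)
qed simp

lemma sigma_divide [simp]: "sigma i (f / g) = sigma i f / sigma i g"
  by (simp add: divide_inverse)

lemma sigma_prod: "sigma i (prod f A) = (\<Prod>x\<in>A. sigma i (f x))"
  by (induction A rule: infinite_finite_induct) auto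

text \<open>For a representation \<open>p / q\<close> with \<open>q\<close> of minimal degree, \<open>(p' - p) / (q' - q)\<close> with
  \<open>p'\<close>, \<open>q'\<close> the translates would be a smaller one, so \<open>q\<close> is translation invariant.\<close>

lemma sigma_fixed:
  fixes f :: "'k::field_char_0 poly fract"
  assumes i: "i \<noteq> 0" and fixed: "sigma i f = f"
  obtains c where "f = to_fract [:c:]"
proof -
  define P where "P = (\<lambda>q. lead_coeff q = 1 \<and> (\<exists>p. f = to_fract p / to_fract q))"
  have "\<exists>q. P q" using fract_cases_nz [of f] unfolding P_def by metis
  then obtain q where q: "P q" and min: "\<And>r. P r \<Longrightarrow> degree q \<le> degree r"
    using ex_has_least_nat [of P _ degree] by blast
  from q obtain p where p: "f = to_fract p / to_fract q" and lq: "lead_coeff q = 1"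
    unfolding P_def by blast
  then have "q \<noteq> 0" by auto
  define p' q' where "p' = poly_translate i p" and "q' = poly_translate i q"
  have f': "f = to_fract p' / to_fract q'"
    using fixed p by (simp add: p'_def q'_def)
  have "q' \<noteq> 0" "lead_coeff q' = 1" "degree q' = degree q"
    using \<open>q \<noteq> 0\<close> lq by (simp_all add: q'_def)
  have "q' = q"
  proof (rule ccontr)
    assume ne: "q' \<noteq> q"
    have deg: "degree (q' - q) < degree q"
    proof -
      have "degree q \<noteq> 0"
      proof
        assume "degree q = 0"
        then obtain c where "q = [:c:]" by (rule degree_eq_zeroE)
        with ne show False by (simp add: q'_def)
      qed
      moreover have "degree (q' - q) \<le> degree q - 1"
      proof (rule degree_le, intro allI impI)
        fix l assume "degree q - 1 < l"
        then have "degree q \<le> l" by simp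
        then show "coeff (q' - q) l = 0"
          by (simp add: q'_def coeff_poly_translate_degree)
      qed
      ultimately show ?thesis by simp
    qed
    define r where "r = q' - q"
    then have r: "r \<noteq> 0" using ne by simp
    define c where "c = inverse (lead_coeff r)"
    have c: "c \<noteq> 0" using r by (simp add: c_def)
    have "to_fract p' = f * to_fract q'" "to_fract p = f * to_fract q"
      using f' p \<open>q \<noteq> 0\<close> \<open>q' \<noteq> 0\<close> by (metis nonzero_eq_divide_eq to_fract_eq_0_iff)+
    then have "to_fract (p' - p) = f * to_fract (q' - q)" by (simp add: algebra_simps)
    then have "f = to_fract ([:c:] * (p' - p)) / to_fract ([:c:] * r)"
      using c r by (simp add: r_def [symmetric] to_fract_diff [symmetric] del: to_fract_diff mult_pCons_left)
    moreover have "lead_coeff ([:c:] * r) = 1"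
      using r by (simp add: c_def)
    ultimately have "P ([:c:] * r)" unfolding P_def by blast
    then have "degree q \<le> degree ([:c:] * r)" by (rule min)
    also have "\<dots> = degree r" using c by simp
    finally show False using deg by (simp add: r_def)
  qed
  then obtain a where a: "q = [:a:]" using poly_translate_fixed [OF i] q'_def by metis
  with lq have q1: "q = 1" by (simp add: one_pCons)
  then have "f = to_fract p" using p by simp
  then have "poly_translate i p = p" using fixed by simp
  then obtain b where "p = [:b:]" using poly_translate_fixed [OF i] by metis
  with \<open>f = to_fract p\<close> that show ?thesis by blast
qed

text \<open>A polynomial solution with the same right-hand side exists by
  \<open>poly_difference_surj\<close>. It differs from f by a fixed rational function, which is
  constant by \<open>sigma_fixed\<close>, so f is itself a polynomial and the degree bound
  transfers.\<close>

lemma sigma_difference_bound: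
  fixes f :: "'k::field_char_0 poly fract"
  assumes "i \<noteq> 0"
  shows "(\<exists>g. sigma i f - f = to_fract g \<and> (\<forall>l\<ge>k. coeff g l = 0)) \<longleftrightarrow>
         (\<exists>h. f = to_fract h \<and> (\<forall>l\<ge>Suc k. coeff h l = 0))"
proof
  assume "\<exists>g. sigma i f - f = to_fract g \<and> (\<forall>l\<ge>k. coeff g l = 0)"
  then obtain g where g: "sigma i f - f = to_fract g" "\<forall>l\<ge>k. coeff g l = 0" by blast
  obtain h where h: "poly_translate i h - h = g" by (rule poly_difference_surj [OF assms])
  have "sigma i (f - to_fract h) - (f - to_fract h) = to_fract g - to_fract (poly_translate i h - h)"
    using g(1) by (simp add: algebra_simps)
  then have "sigma i (f - to_fract h) = f - to_fract h" using h by simp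
  then obtain c where "f - to_fract h = to_fract [:c:]" by (rule sigma_fixed [OF assms])
  then have f: "f = to_fract (h + [:c:])" by (simp add: algebra_simps)
  have "poly_translate i (h + [:c:]) - (h + [:c:]) = g" using h by simp
  then have "\<forall>l\<ge>Suc k. coeff (h + [:c:]) l = 0"
    using poly_difference_bound [OF assms, of k "h + [:c:]"] g(2) by metis
  with f show "\<exists>h. f = to_fract h \<and> (\<forall>l\<ge>Suc k. coeff h l = 0)" by blast
next
  assume "\<exists>h. f = to_fract h \<and> (\<forall>l\<ge>Suc k. coeff h l = 0)"
  then obtain h where "f = to_fract h" "\<forall>l\<ge>Suc k. coeff h l = 0" by blast
  then show "\<exists>g. sigma i f - f = to_fract g \<and> (\<forall>l\<ge>k. coeff g l = 0)"
    using poly_difference_bound [OF assms, of k h]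
    by (intro exI [of _ "poly_translate i h - h"]) auto
qed

subsection \<open>Monic rational functions and the degree\<close>

lemma monic_fractI: "lead_coeff p = 1 \<Longrightarrow> lead_coeff q = 1 \<Longrightarrow> monic_fract (to_fract p / to_fract q)"
  unfolding monic_fract_def by (metis Fract_conv_to_fract)

lemma monic_fractE:
  assumes "monic_fract f"
  obtains p q where "lead_coeff p = 1" "lead_coeff q = 1" "f = to_fract p / to_fract q"
  using assms unfolding monic_fract_def by (metis Fract_conv_to_fract)

lemma monic_fract_nz: "monic_fract f \<Longrightarrow> f \<noteq> 0"
  by (auto elim!: monic_fractE)

lemma monic_fract_to_fract [simp]: "monic_fract (to_fract p) \<longleftrightarrow> lead_coeff p = 1"
proof
  assume "monic_fract (to_fract p)"
  then obtain a b where ab: "lead_coeff a = 1" "lead_coeff b = 1" "to_fract p = to_fract a / to_fract b"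
    by (rule monic_fractE)
  then have "b \<noteq> 0" by auto
  then have "to_fract (p * b) = to_fract a" using ab(3) by simp
  then have "p * b = a" by (simp only: to_fract_eq_iff)
  with ab show "lead_coeff p = 1" by (metis lead_coeff_mult mult.right_neutral)
qed (use monic_fractI [of p 1] in simp)

lemma monic_fract_1 [simp]: "monic_fract 1"
  using monic_fract_to_fract [of 1] by simp

lemma monic_fract_mult: "monic_fract f \<Longrightarrow> monic_fract g \<Longrightarrow> monic_fract (f * g)"
proof (elim monic_fractE)
  fix p q r s
  assume *: "lead_coeff p = 1" "lead_coeff q = 1" "f = to_fract p / to_fract q"
    "lead_coeff r = 1" "lead_coeff s = 1" "g = to_fract r / to_fract s"
  then have "f * g = to_fract (p * r) / to_fract (q * s)" by simp
  moreover have "lead_coeff (p * r) = 1" "lead_coeff (q * s) = 1"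
    using * by (simp_all add: lead_coeff_mult)
  ultimately show ?thesis using monic_fractI by metis
qed

lemma monic_fract_inverse: "monic_fract f \<Longrightarrow> monic_fract (inverse f)"
  by (elim monic_fractE) (simp add: monic_fractI)

lemma monic_fract_divide: "monic_fract f \<Longrightarrow> monic_fract g \<Longrightarrow> monic_fract (f / g)"
  by (simp add: divide_inverse monic_fract_mult monic_fract_inverse)

lemma monic_fract_sigma: "monic_fract f \<Longrightarrow> monic_fract (sigma i f)"
  by (elim monic_fractE) (simp add: monic_fractI)

lemma monic_fract_prod: "(\<And>x. x \<in> A \<Longrightarrow> monic_fract (f x)) \<Longrightarrow> monic_fract (prod f A)"
  by (induction A rule: infinite_finite_induct) (auto simp: monic_fract_mult)

lemma monic_normalize:
  assumes "f \<noteq> (0 :: 'k::field poly fract)"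
  obtains c g where "c \<noteq> 0" "f = to_fract [:c:] * g" "monic_fract g"
proof -
  obtain p q where pq: "f = to_fract p / to_fract q" "lead_coeff q = 1" by (rule fract_cases_nz)
  with assms have "p \<noteq> 0" by auto
  let ?p = "smult (inverse (lead_coeff p)) p"
  have "lead_coeff ?p = 1" using \<open>p \<noteq> 0\<close> by simp
  then have "monic_fract (to_fract ?p / to_fract q)" using pq(2) by (rule monic_fractI)
  moreover have "p = [:lead_coeff p:] * ?p" using \<open>p \<noteq> 0\<close> by simp
  then have "f = to_fract [:lead_coeff p:] * (to_fract ?p / to_fract q)"
    using pq(1) by (metis times_divide_eq_right to_fract_mult)
  ultimately show ?thesis using that \<open>p \<noteq> 0\<close> by (metis leading_coeff_0_iff)
qed

lemma deg_H_divide: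
  assumes "p \<noteq> 0" "q \<noteq> 0"
  shows "deg_H (to_fract p / to_fract q) = int (degree p) - int (degree q)"
  unfolding deg_H_def
proof (rule the_equality)
  show "\<exists>p' q'. p' \<noteq> 0 \<and> q' \<noteq> 0 \<and> to_fract p / to_fract q = Fract p' q' \<and>
      int (degree p) - int (degree q)
        = int (degree p') - int (degree q')"
    using assms by (metis Fract_conv_to_fract)
next
  fix d assume "\<exists>p' q'. p' \<noteq> 0 \<and> q' \<noteq> 0 \<and> to_fract p / to_fract q = Fract p' q' \<and>
      d = int (degree p') - int (degree q')"
  then obtain p' q' where *: "p' \<noteq> 0" "q' \<noteq> 0" "to_fract p / to_fract q = Fract p' q'"
      "d = int (degree p') - int (degree q')"
    by blast
  then have "p * q' = p' * q"
    using assms by (simp add: Fract_conv_to_fract [symmetric] eq_fract)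
  then have "degree p + degree q' = degree p' + degree q"
    using assms * by (metis degree_mult_eq)
  with * show "d = int (degree p) - int (degree q)" by linarith
qed

lemma fract_cases_nonzero:
  assumes "f \<noteq> (0 :: 'k::field poly fract)"
  obtains p q where "p \<noteq> 0" "q \<noteq> 0" "f = to_fract p / to_fract q"
  using assms fract_cases_nz [of f] by (metis div_0 leading_coeff_0_iff to_fract_0 zero_neq_one)

lemma deg_H_to_fract [simp]: "p \<noteq> 0 \<Longrightarrow> deg_H (to_fract p) = int (degree p)"
  using deg_H_divide [of p 1] by simp

lemma deg_H_mult: "f \<noteq> 0 \<Longrightarrow> g \<noteq> 0 \<Longrightarrow> deg_H (f * g) = deg_H f + deg_H g"
proof -
  assume "f \<noteq> 0" "g \<noteq> 0"
  obtain p q where 1: "p \<noteq> 0" "q \<noteq> 0" "f = to_fract p / to_fract q"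
    using \<open>f \<noteq> 0\<close> by (rule fract_cases_nonzero)
  obtain r s where 2: "r \<noteq> 0" "s \<noteq> 0" "g = to_fract r / to_fract s"
    using \<open>g \<noteq> 0\<close> by (rule fract_cases_nonzero)
  have "f * g = to_fract (p * r) / to_fract (q * s)" using 1(3) 2(3) by simp
  then have fg: "deg_H (f * g) = int (degree (p * r)) - int (degree (q * s))"
    using deg_H_divide [of "p * r" "q * s"] 1(1,2) 2(1,2) by simp
  have "deg_H f = int (degree p) - int (degree q)"
    "deg_H g = int (degree r) - int (degree s)"
    unfolding 1(3) 2(3) by (rule deg_H_divide; fact)+
  moreover have "degree (p * r) = degree p + degree r"
    "degree (q * s) = degree q + degree s"
    using 1(1,2) 2(1,2) by (simp_all add: degree_mult_eq)
  ultimately show ?thesis using fg by linarith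
qed

lemma deg_H_1 [simp]: "deg_H 1 = 0"
  using deg_H_to_fract [of 1] by simp

lemma deg_H_inverse:
  assumes "f \<noteq> 0"
  shows "deg_H (inverse f) = - deg_H f"
proof -
  have "deg_H (f * inverse f) = deg_H f + deg_H (inverse f)"
    using assms by (intro deg_H_mult) auto
  moreover have "f * inverse f = 1" using assms by simp
  ultimately show ?thesis by simp
qed

lemma deg_H_divide': "f \<noteq> 0 \<Longrightarrow> g \<noteq> 0 \<Longrightarrow> deg_H (f / g) = deg_H f - deg_H g"
  by (simp add: divide_inverse deg_H_mult deg_H_inverse)

lemma deg_H_sigma [simp]: "deg_H (sigma i f) = deg_H f"
proof (cases "f = 0")
  case False
  then show ?thesis by (elim fract_cases_nonzero) (simp add: deg_H_divide)
qed simp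

lemma deg_H_prod: "(\<And>x. x \<in> A \<Longrightarrow> f x \<noteq> 0) \<Longrightarrow> deg_H (prod f A) = (\<Sum>x\<in>A. deg_H (f x))"
  by (induction A rule: infinite_finite_induct) (auto simp: deg_H_mult)

subsection \<open>Denominators\<close>

lemma poly_ideal_monic_generator:
  fixes I :: "'k::field poly set"
  assumes nz: "\<exists>p\<in>I. p \<noteq> 0" and diff: "\<And>p q. p \<in> I \<Longrightarrow> q \<in> I \<Longrightarrow> p - q \<in> I"
    and mult: "\<And>p q. q \<in> I \<Longrightarrow> p * q \<in> I"
  obtains d where "lead_coeff d = 1" "\<And>p. p \<in> I \<longleftrightarrow> d dvd p"
proof -
  define P where "P = (\<lambda>p. p \<in> I \<and> p \<noteq> 0)"
  obtain d where d: "P d" "\<And>p. P p \<Longrightarrow> degree d \<le> degree p"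
    using nz ex_has_least_nat [of P _ degree] unfolding P_def by blast
  let ?d = "[:inverse (lead_coeff d):] * d"
  have nz': "d \<noteq> 0" using d(1) by (simp add: P_def)
  have "d dvd p" if "p \<in> I" for p
  proof -
    have "p mod d = p - (p div d) * d" by (simp add: minus_div_mult_eq_mod)
    then have "p mod d \<in> I" using d(1) that diff mult by (auto simp: P_def)
    moreover have "p mod d = 0 \<or> degree (p mod d) < degree d"
      using degree_mod_less nz' by blast
    ultimately have "p mod d = 0" using d(2) [of "p mod d"] unfolding P_def by linarith
    then show ?thesis by auto
  qed
  moreover have "p \<in> I" if "d dvd p" for p
    using that d(1) mult by (auto simp: P_def elim!: dvdE) (metis mult.commute)
  ultimately have "p \<in> I \<longleftrightarrow> d dvd p" for p by blast
  moreover have "?d dvd p \<longleftrightarrow> d dvd p" for p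
    using nz' by (simp add: smult_dvd_iff)
  moreover have "lead_coeff ?d = 1" using nz' by simp
  ultimately show ?thesis using that [of ?d] by blast
qed

lemma monic_dvd_antisym:
  fixes d e :: "'k::field poly"
  assumes "lead_coeff d = 1" "lead_coeff e = 1" "d dvd e" "e dvd d"
  shows "d = e"
proof -
  from assms(3) obtain r where r: "e = d * r" by (elim dvdE)
  have "degree d = degree e"
    using assms by (metis dvd_imp_degree_le le_antisym leading_coeff_0_iff zero_neq_one)
  moreover have "d \<noteq> 0" "e \<noteq> 0" using assms by auto
  then have "r \<noteq> 0" using r by auto
  ultimately have "degree r = 0"
    using r \<open>d \<noteq> 0\<close> by (metis add_cancel_left_right degree_mult_eq)
  then obtain c where "r = [:c:]" by (rule degree_eq_zeroE)
  with r have e: "e = smult c d" by simp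
  then have "c \<noteq> 0" using \<open>e \<noteq> 0\<close> by auto
  then have "c = 1" using e assms by simp
  with e show ?thesis by simp
qed

text \<open>The reduced denominator, characterised as the monic generator of the ideal of all p with
  p f in K[H]. In this form membership in the Weyl algebra becomes divisibility.\<close>

definition den :: "'k::field poly fract \<Rightarrow> 'k poly" where
  "den f = (THE d. lead_coeff d = 1 \<and> (\<forall>p. to_fract p * f \<in> range to_fract \<longleftrightarrow> d dvd p))"

lemma den:
  fixes f :: "'k::field poly fract"
  shows lead_coeff_den: "lead_coeff (den f) = 1"
    and den_dvd_iff: "den f dvd p \<longleftrightarrow> to_fract p * f \<in> range to_fract"
proof -
  let ?I = "{p. to_fract p * f \<in> range to_fract}"
  obtain d where d: "lead_coeff d = 1" "\<And>p. p \<in> ?I \<longleftrightarrow> d dvd p"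
  proof (rule poly_ideal_monic_generator [of ?I])
    obtain p q where "f = to_fract p / to_fract q" "lead_coeff q = 1" by (rule fract_cases_nz)
    then have "to_fract q * f = to_fract p" "q \<noteq> 0" by auto
    then show "\<exists>p\<in>?I. p \<noteq> 0" by auto
  next
    fix p q assume "p \<in> ?I" "q \<in> ?I"
    then obtain r s where "to_fract p * f = to_fract r" "to_fract q * f = to_fract s" by auto
    then have "to_fract (p - q) * f = to_fract (r - s)" by (simp add: algebra_simps)
    then show "p - q \<in> ?I" by (metis mem_Collect_eq rangeI)
  next
    fix p q assume "q \<in> ?I"
    then obtain r where "to_fract q * f = to_fract r" by auto
    then have "to_fract (p * q) * f = to_fract (p * r)" by (simp add: mult.assoc)
    then show "p * q \<in> ?I" by (metis mem_Collect_eq rangeI)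
  next
    fix d assume "lead_coeff d = 1" "\<And>p. p \<in> ?I \<longleftrightarrow> d dvd p"
    then show thesis by (rule that)
  qed
  have "lead_coeff (den f) = 1 \<and> (\<forall>p. to_fract p * f \<in> range to_fract \<longleftrightarrow> den f dvd p)"
    unfolding den_def
  proof (rule theI [of _ d])
    fix e assume "lead_coeff e = 1 \<and> (\<forall>p. to_fract p * f \<in> range to_fract \<longleftrightarrow> e dvd p)"
    then have "lead_coeff e = 1" and dvd: "\<And>p. e dvd p \<longleftrightarrow> d dvd p" using d(2) by auto
    then show "e = d" using d(1) dvd [of d] dvd [of e] by (intro monic_dvd_antisym) simp_all
  qed (use d(1) d(2) in simp)
  then show "lead_coeff (den f) = 1" "den f dvd p \<longleftrightarrow> to_fract p * f \<in> range to_fract" by auto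
qed

lemma den_nz [simp]: "den f \<noteq> 0"
  using lead_coeff_den [of f] by auto

lemma den_times: "to_fract (den f) * f \<in> range to_fract"
  using den_dvd_iff [of f "den f"] by simp

lemma den_eqI:
  assumes "lead_coeff d = 1" "\<And>p. to_fract p * f \<in> range to_fract \<longleftrightarrow> d dvd p"
  shows "den f = d"
  using assms den_dvd_iff [of f d] den_dvd_iff [of f "den f"] lead_coeff_den [of f]
  by (intro monic_dvd_antisym) simp_all

lemma den_inverse_to_fract:
  assumes "lead_coeff p = 1"
  shows "den (inverse (to_fract p)) = p"
proof (rule den_eqI [OF assms])
  fix q
  have "p \<noteq> 0" using assms by auto
  then have "to_fract q * inverse (to_fract p) = to_fract r \<longleftrightarrow> q = r * p" for r
    by (simp add: field_simps to_fract_mult [symmetric] del: to_fract_mult)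
  then show "to_fract q * inverse (to_fract p) \<in> range to_fract \<longleftrightarrow> p dvd q"
    by (auto simp: dvd_def mult.commute)
qed

section \<open>Coordinates in the skew Laurent ring and in the Weyl algebra\<close>

lemma coord_sum: "coord (sum f A) i = (\<Sum>x\<in>A. coord (f x) i)"
  by (induction A rule: infinite_finite_induct) auto

lemma skew_monom_0 [simp]: "skew_monom 0 i = 0"
  by (rule skew_eqI) (simp add: coord_monom)

lemma skew_monom_add: "skew_monom (f + g) i = skew_monom f i + skew_monom g i"
  by (rule skew_eqI) (simp add: coord_monom)

lemma skew_monom_minus: "skew_monom (f - g) i = skew_monom f i - skew_monom g i"
  by (rule skew_eqI) (simp add: coord_monom)

lemma one_eq_skew_monom: "1 = skew_monom 1 0"
  by (rule one_skew_def)

lemma skew_eq_sum: "a = (\<Sum>i | coord a i \<noteq> 0. skew_monom (coord a i) i)"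
proof (rule skew_eqI)
  fix n
  have "coord (\<Sum>i | coord a i \<noteq> 0. skew_monom (coord a i) i) n
      = (\<Sum>i | coord a i \<noteq> 0. if n = i then coord a i else 0)"
    by (simp add: coord_sum coord_monom)
  also have "\<dots> = coord a n"
    by (subst sum.delta') auto
  finally show "coord a n = coord (\<Sum>i | coord a i \<noteq> 0. skew_monom (coord a i) i) n" by simp
qed

lemma coord_monom_times: "coord (skew_monom f i * b) n = f * sigma i (coord b (n - i))"
  by (subst coord_mult [of "{i}"]) (auto simp: coord_monom)

lemma coord_times_monom: "coord (a * skew_monom f i) n = coord a (n - i) * sigma (n - i) f"
proof -
  have "coord (a * skew_monom f i) n
      = (\<Sum>j\<in>insert (n - i) {j. coord a j \<noteq> 0}. coord a j * sigma j (coord (skew_monom f i) (n - j)))"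
    by (rule coord_mult) auto
  also have "\<dots> = (\<Sum>j\<in>insert (n - i) {j. coord a j \<noteq> 0}. if j = n - i then coord a j * sigma j f else 0)"
    by (rule sum.cong) (auto simp: coord_monom)
  also have "\<dots> = coord a (n - i) * sigma (n - i) f"
    by (subst sum.delta) auto
  finally show ?thesis .
qed

lemma of_poly_eq: "of_poly p = skew_monom (to_fract p) 0"
  by (simp add: of_poly_def of_fract_def)

lemma coord_of_poly_times: "coord (of_poly p * a) i = to_fract p * coord a i"
  by (simp add: of_poly_eq coord_monom_times)

lemma coord_scal: "coord (scal c a) i = to_fract [:c:] * coord a i"
  by (simp add: scal_def coord_of_poly_times)

lemma of_poly_simps [simp]:
  "of_poly 0 = 0" "of_poly 1 = 1"
  "of_poly (p + q) = of_poly p + of_poly q"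
  "of_poly (p - q) = of_poly p - of_poly q"
  "of_poly (p * q) = of_poly p * of_poly q"
  by (simp_all add: of_poly_eq one_eq_skew_monom skew_monom_add skew_monom_minus)

lemma of_poly_eq_iff [simp]: "of_poly p = of_poly q \<longleftrightarrow> p = q"
  by (metis coord_monom of_poly_eq to_fract_eq_iff)

lemma of_poly_power: "of_poly (p ^ k) = of_poly p ^ k"
  by (induction k) simp_all

lemma of_poly_sum: "of_poly (sum f A) = (\<Sum>x\<in>A. of_poly (f x))"
  by (induction A rule: infinite_finite_induct) auto

lemma scal_simps:
  "scal c (a + b) = scal c a + scal c b" "scal (c + d) a = scal c a + scal d a"
  "scal (c * d) a = scal c (scal d a)" "scal 1 a = a" "scal 0 a = 0" "scal c 0 = 0"
  "scal c a * b = scal c (a * b)" "a * scal c b = scal c (a * b)"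
  "scal c (a - b) = scal c a - scal c b"
proof -
  show "scal (c + d) a = scal c a + scal d a"
    using to_fract_add [of "[:c:]" "[:d:]"]
    by (intro skew_eqI) (simp add: coord_scal distrib_right)
  show "scal (c * d) a = scal c (scal d a)"
  proof (rule skew_eqI)
    have "[:c * d:] = [:c:] * [:d:]" by simp
    then show "coord (scal (c * d) a) i = coord (scal c (scal d a)) i" for i
      by (simp only: coord_scal to_fract_mult mult.assoc)
  qed
  show "scal 1 a = a"
    by (simp only: scal_def one_pCons [symmetric] of_poly_simps mult_1_left)
  show "scal 0 a = 0" by (simp add: scal_def)
  have "a * of_poly [:c:] = of_poly [:c:] * a"
  proof (rule skew_eqI)
    fix i
    show "coord (a * of_poly [:c:]) i = coord (of_poly [:c:] * a) i"
      unfolding of_poly_eq coord_times_monom coord_monom_times by simp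
  qed
  then show "a * scal c b = scal c (a * b)"
    unfolding scal_def by (metis mult.assoc)
  show "scal c a * b = scal c (a * b)" by (simp add: scal_def mult.assoc)
qed (simp_all add: scal_def distrib_left right_diff_distrib)

lemma skew_monom_power:
  "skew_monom f i ^ k = skew_monom (\<Prod>j<k. sigma (int j * i) f) (int k * i)"
proof (induction k)
  case 0
  then show ?case by (simp add: one_eq_skew_monom)
next
  case (Suc k)
  have "skew_monom f i ^ Suc k = skew_monom f i ^ k * skew_monom f i"
    by (rule power_Suc2)
  with Suc show ?case by (simp add: algebra_simps)
qed

text \<open>\<open>skew\<close> is not a division ring, so additivity of integer exponents requires
  an invertible base. The two directions of the integer induction are multiplication by
  \<open>a\<close> and by its inverse \<open>b\<close>.\<close>

lemma powi_unit_add: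
  fixes a b :: "'k::field_char_0 skew"
  assumes ab: "a * b = 1" "b * a = 1"
  shows "a powi (i + j) = a powi i * a powi j"
proof -
  have inv: "inverse a = b" using ab by (rule skew_inverse_unique)
  have step: "a powi (j + 1) = a * a powi j" for j
  proof (cases "j \<ge> 0")
    case True
    then show ?thesis by (simp add: power_int_def nat_add_distrib)
  next
    case False
    then have "nat (- j) = Suc (nat (- (j + 1)))" by simp
    then have "a * inverse a ^ nat (- j) = inverse a ^ nat (- (j + 1))"
      using ab inv by (metis mult.assoc mult_1_left power_Suc)
    with False show ?thesis
      by (cases "j = - 1") (auto simp: power_int_def)
  qed
  have step': "a powi (j - 1) = b * a powi j" for j
    using step [of "j - 1"] ab by (simp flip: mult.assoc)
  show ?thesis
  proof (induction i rule: int_induct [where k = 0])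
    case base
    then show ?case by (simp add: power_int_def)
  next
    case (step1 i)
    then show ?case using step [of "i + j"] step [of i] by (simp add: algebra_simps)
  next
    case (step2 i)
    then show ?case using step' [of "i + j"] step' [of i] by (simp add: algebra_simps)
  qed
qed

lemma genX_powi: "genX powi i = (skew_monom 1 i :: 'k::field_char_0 skew)"
proof (cases "i \<ge> 0")
  case True
  then show ?thesis by (simp add: power_int_def genX_def skew_monom_power)
next
  case False
  have "inverse genX = (skew_monom 1 (- 1) :: 'k skew)"
    by (simp add: genX_def inverse_skew_monom)
  with False show ?thesis by (simp add: power_int_def skew_monom_power)
qed

text \<open>The element \<open>v\<^sub>i\<close> is \<open>w\<^sub>i X\<^sup>i\<close>, where \<open>w\<^sub>i = 1\<close> for \<open>i \<ge> 0\<close> and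
  \<open>w\<^sub>i = H (H + 1) \<cdots> (H - i - 1)\<close> for \<open>i < 0\<close>.\<close>

definition wpoly :: "int \<Rightarrow> 'k::field_char_0 poly" where
  "wpoly i = (\<Prod>k<nat (- i). [:of_nat k, 1:])"

lemma wpoly_nonneg [simp]: "i \<ge> 0 \<Longrightarrow> wpoly i = 1"
  by (simp add: wpoly_def)

lemma lead_coeff_wpoly [simp]: "lead_coeff (wpoly i) = 1"
  by (simp add: wpoly_def lead_coeff_prod)

lemma wpoly_nz [simp]: "wpoly i \<noteq> 0"
  using lead_coeff_wpoly [of i] by (metis leading_coeff_0_iff zero_neq_one)

lemma degree_wpoly: "degree (wpoly i :: 'k::field_char_0 poly) = nat (- i)"
proof -
  have "degree (\<Prod>k<n. [:of_nat k, 1 :: 'k:]) = n" for n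
    by (subst degree_prod_eq_sum_degree) simp_all
  then show ?thesis by (simp add: wpoly_def)
qed

text \<open>This is Y v_i = v_{i-1} for i \<le> 0 read off in coefficients: Y = H X^-1 translates
  w_i by \<sigma>^-1 and multiplies it by H.\<close>

lemma wpoly_pred:
  assumes "i \<le> 0"
  shows "wpoly (i - 1) = [:0, 1:] * poly_translate (- 1) (wpoly i :: 'k::field_char_0 poly)"
proof -
  have pt: "poly_translate (- 1) (\<Prod>k<n. [:of_nat k, 1 :: 'k:]) = (\<Prod>k<n. [:of_nat (Suc k), 1:])" for n
  proof (induction n)
    case (Suc n)
    have "poly_translate (- 1) [:of_nat n, 1 :: 'k:] = [:of_nat (Suc n), 1:]"
      by (simp add: poly_translate_def pcompose_pCons algebra_simps)
    with Suc show ?case by (simp only: prod.lessThan_Suc poly_translate_simps)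
  qed simp
  have "nat (- (i - 1)) = Suc (nat (- i))" using assms by simp
  then show ?thesis
    unfolding wpoly_def by (simp only: prod.lessThan_Suc_shift pt) simp
qed

text \<open>This is X v_i = (H - 1) v_{i+1} for i < 0 in coefficients, a consequence of X Y = H -
  1.\<close>

lemma wpoly_succ:
  assumes "i < 0"
  shows "poly_translate 1 (wpoly i) = [:- 1, 1:] * (wpoly (i + 1) :: 'k::field_char_0 poly)"
  using wpoly_pred [of "i + 1", where 'k = 'k] assms
  by (simp add: poly_translate_def pcompose_pCons flip: poly_translate_shift del: mult_pCons_left)
     (simp add: poly_translate_def pcompose_mult pcompose_pCons pcompose_assoc [symmetric] del: mult_pCons_left)

lemma vgen_eq: "vgen i = skew_monom (to_fract (wpoly i)) i"
proof (cases "i \<ge> 0")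
  case True
  then show ?thesis by (simp add: vgen_def genX_def skew_monom_power)
next
  case False
  have "genY ^ k = (skew_monom (to_fract (wpoly (- int k))) (- int k) :: 'k::field_char_0 skew)" for k
  proof (induction k)
    case 0
    then show ?case by (simp add: one_eq_skew_monom)
  next
    case (Suc k)
    have "genY ^ Suc k = (skew_monom (to_fract ([:0, 1:] * poly_translate (- 1) (wpoly (- int k)))) (- int k - 1) :: 'k skew)"
      unfolding power_Suc Suc unfolding genY_eq
      by (simp only: skew_monom_mult sigma_to_fract to_fract_mult uminus_add_conv_diff minus_diff_commute add_uminus_conv_diff)
    also have "[:0, 1:] * poly_translate (- 1) (wpoly (- int k)) = (wpoly (- int k - 1) :: 'k poly)"
      by (rule wpoly_pred [symmetric]) simp
    also have "- int k - 1 = - int (Suc k)" by simp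
    finally show ?case .
  qed
  from this [of "nat (- i)"] False show ?thesis by (simp add: vgen_def)
qed

lemma vgen_0 [simp]: "vgen 0 = 1"
  by (simp add: vgen_def)

lemma vgen_add:
  assumes "i \<ge> 0 \<and> j \<ge> 0 \<or> i \<le> 0 \<and> j \<le> 0"
  shows "vgen (i + j) = vgen i * vgen j"
proof (cases "i \<ge> 0 \<and> j \<ge> 0")
  case True
  then show ?thesis by (simp add: vgen_def nat_add_distrib power_add)
next
  case False
  show ?thesis
  proof (cases "i = 0 \<or> j = 0")
    case False
    with assms \<open>\<not> (i \<ge> 0 \<and> j \<ge> 0)\<close> have "i < 0" "j < 0" by auto
    then have "nat (- (i + j)) = nat (- i) + nat (- j)" by simp
    with \<open>i < 0\<close> \<open>j < 0\<close> show ?thesis by (simp add: vgen_def power_add)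
  qed auto
qed

lemma of_poly_in_weyl: "of_poly p \<in> weyl"
proof -
  have H: "genH \<in> weyl"
    unfolding genY_genX [symmetric] by (intro weyl.intros)
  show ?thesis
  proof (induction p)
    case 0
    show ?case using weyl.const [of 0] by (simp add: scal_simps)
  next
    case (pCons a p)
    have "pCons a p = [:a:] + [:0, 1:] * p" by simp
    then have "of_poly (pCons a p) = scal a 1 + genH * of_poly p"
      by (simp add: scal_def genH_def del: mult_pCons_left flip: of_poly_simps(3,5))
    then show ?case using pCons.IH H by (metis weyl.const weyl.add weyl.mult)
  qed
qed

lemma one_in_weyl: "1 \<in> weyl"
  using of_poly_in_weyl [of 1] by simp

lemma power_in_weyl: "a \<in> weyl \<Longrightarrow> a ^ k \<in> weyl"
  by (induction k) (auto intro: one_in_weyl weyl.mult)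

lemma vgen_in_weyl: "vgen i \<in> weyl"
  by (auto simp: vgen_def intro: power_in_weyl weyl.intros)

lemma sum_in_weyl: "(\<And>x. x \<in> A \<Longrightarrow> f x \<in> weyl) \<Longrightarrow> sum f A \<in> weyl"
  using of_poly_in_weyl [of 0]
  by (induction A rule: infinite_finite_induct) (auto intro: weyl.add)

text \<open>The right-hand side is a left \<open>weyl\<close>-module containing \<open>1\<close>, since it is stable under left
  multiplication by the generators.\<close>

lemma weyl_iff:
  "a \<in> weyl \<longleftrightarrow> (\<forall>i. \<exists>p. coord a i = to_fract p * to_fract (wpoly i))"
proof
  define W where "W = {a :: 'a skew. \<forall>i. \<exists>p. coord a i = to_fract p * to_fract (wpoly i)}"
  have Wadd: "a + b \<in> W" if "a \<in> W" "b \<in> W" for a b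
    unfolding W_def
  proof (clarify)
    fix i
    from that obtain p q where "coord a i = to_fract p * to_fract (wpoly i)"
      "coord b i = to_fract q * to_fract (wpoly i)" unfolding W_def by blast
    then have "coord (a + b) i = to_fract (p + q) * to_fract (wpoly i)" by (simp add: algebra_simps)
    then show "\<exists>p. coord (a + b) i = to_fract p * to_fract (wpoly i)" by blast
  qed
  assume "a \<in> weyl"
  then have "\<forall>b\<in>W. a * b \<in> W"
  proof induction
    case (const c)
    show ?case
    proof (clarsimp simp: W_def scal_simps coord_scal)
      fix b i assume "\<forall>i. \<exists>p. coord b i = to_fract p * to_fract (wpoly i :: 'a poly)"
      then obtain p where "coord b i = to_fract p * to_fract (wpoly i)" by blast
      then have "to_fract [:c:] * coord b i = to_fract ([:c:] * p) * to_fract (wpoly i)"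
        by (simp only: to_fract_mult mult.assoc)
      then show "\<exists>p. to_fract [:c:] * coord b i = to_fract p * to_fract (wpoly i)" by blast
    qed
  next
    case X
    show ?case
    proof (clarsimp simp: W_def genX_def coord_monom_times)
      fix b i assume "\<forall>i. \<exists>p. coord b i = to_fract p * to_fract (wpoly i :: 'a poly)"
      then obtain p where p: "coord b (i - 1) = to_fract p * to_fract (wpoly (i - 1))" by blast
      show "\<exists>p. sigma 1 (coord b (i - 1)) = to_fract p * to_fract (wpoly i)"
      proof (cases "i \<ge> 1")
        case True
        with p show ?thesis by auto
      next
        case False
        then have "poly_translate 1 (wpoly (i - 1)) = [:- 1, 1:] * (wpoly i :: 'a poly)"
          using wpoly_succ [of "i - 1"] by simp
        with p have "sigma 1 (coord b (i - 1)) = to_fract (poly_translate 1 p * [:- 1, 1:]) * to_fract (wpoly i)"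
          by (simp only: sigma_simps sigma_to_fract to_fract_mult mult.assoc)
        then show ?thesis by blast
      qed
    qed
  next
    case Y
    show ?case
    proof (clarsimp simp: W_def genY_eq coord_monom_times)
      fix b i assume "\<forall>i. \<exists>p. coord b i = to_fract p * to_fract (wpoly i :: 'a poly)"
      then obtain p where p: "coord b (i + 1) = to_fract p * to_fract (wpoly (i + 1))" by blast
      show "\<exists>p. to_fract [:0, 1:] * sigma (- 1) (coord b (i + 1)) = to_fract p * to_fract (wpoly i)"
      proof (cases "i \<ge> 0")
        case True
        with p have "to_fract [:0, 1:] * sigma (- 1) (coord b (i + 1))
            = to_fract ([:0, 1:] * poly_translate (- 1) p) * to_fract (wpoly i)"
          by (simp del: mult_pCons_left)
        then show ?thesis by blast
      next
        case False
        then have "(wpoly i :: 'a poly) = [:0, 1:] * poly_translate (- 1) (wpoly (i + 1))"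
          using wpoly_pred [of "i + 1"] by simp
        with p have "to_fract [:0, 1:] * sigma (- 1) (coord b (i + 1))
            = to_fract (poly_translate (- 1) p) * to_fract (wpoly i)"
          by (simp add: mult_ac del: mult_pCons_left)
        then show ?thesis by blast
      qed
    qed
  next
    case (add a b)
    then show ?case using Wadd by (simp add: distrib_right)
  next
    case (mult a b)
    then show ?case by (simp add: mult.assoc)
  qed
  moreover have "1 \<in> W"
  proof -
    have "\<exists>p. coord (1 :: 'a skew) i = to_fract p * to_fract (wpoly i)" for i
      by (cases "i = 0")
         (auto simp: one_eq_skew_monom coord_monom intro: exI [of _ 1] exI [of _ 0])
    then show ?thesis by (simp add: W_def)
  qed
  ultimately have "a \<in> W" by fastforce
  then show "\<forall>i. \<exists>p. coord a i = to_fract p * to_fract (wpoly i)" by (simp add: W_def)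
next
  assume *: "\<forall>i. \<exists>p. coord a i = to_fract p * to_fract (wpoly i)"
  have "skew_monom (coord a i) i \<in> weyl" for i
  proof -
    from * obtain p where "coord a i = to_fract p * to_fract (wpoly i)" by blast
    then have "skew_monom (coord a i) i = of_poly p * vgen i"
      by (simp add: vgen_eq of_poly_eq)
    then show ?thesis using of_poly_in_weyl vgen_in_weyl weyl.mult by metis
  qed
  then have "(\<Sum>i | coord a i \<noteq> 0. skew_monom (coord a i) i) \<in> weyl"
    by (intro sum_in_weyl) auto
  then show "a \<in> weyl" using skew_eq_sum [of a] by simp
qed

lemma skew_monom_in_weyl_iff:
  "skew_monom f i \<in> weyl \<longleftrightarrow> f / to_fract (wpoly i) \<in> range to_fract"
proof -
  have eq: "f / to_fract (wpoly i) = to_fract p \<longleftrightarrow> f = to_fract p * to_fract (wpoly i)" for p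
    by (simp add: divide_eq_eq)
  have "\<exists>p. 0 = to_fract p * to_fract (wpoly j)" for j
    by (rule exI [of _ 0]) simp
  then show ?thesis
    by (auto simp: weyl_iff coord_monom image_iff eq)
qed

section \<open>The filtration of a polynomial in $H$\<close>

lemma nil_filt_nat: "nil_filt u (int k) = {a \<in> weyl. (ad u ^^ Suc k) a = 0}"
  by (simp add: nil_filt_def nat_add_distrib)

text \<open>On the coefficient of X^i, ad p is multiplication by p - \<sigma>^i(p). For i \<noteq> 0
  this factor is nonzero because p is not constant, hence all positive powers of ad p have the same
  kernel: what is concentrated in degree 0.\<close>

lemma nil_filt_of_poly:
  fixes p :: "'k::field_char_0 poly"
  assumes "p \<notin> range (\<lambda>c. [:c:])"
  shows "nil_filt (of_poly p) (int k) = range of_poly"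
proof -
  have ad_coord: "coord (ad (of_poly p) a) i = to_fract (p - poly_translate i p) * coord a i" for a i
    by (simp add: ad_def coord_of_poly_times) (simp add: of_poly_eq coord_times_monom algebra_simps)
  have pow_coord: "coord ((ad (of_poly p) ^^ l) a) i = to_fract ((p - poly_translate i p) ^ l) * coord a i" for l a i
  proof (induction l)
    case (Suc l)
    then show ?case by (simp add: ad_coord del: to_fract_diff)
  qed simp
  have "p - poly_translate i p \<noteq> 0" if "i \<noteq> 0" for i
  proof
    assume "p - poly_translate i p = 0"
    then have "poly_translate i p = p" by simp
    with that obtain c where "p = [:c:]" by (rule poly_translate_fixed)
    with assms show False by blast
  qed
  then have zero: "(ad (of_poly p) ^^ Suc k) a = 0 \<longleftrightarrow> (\<forall>i. i \<noteq> 0 \<longrightarrow> coord a i = 0)" for a :: "'k skew"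
  proof -
    have "(ad (of_poly p) ^^ Suc k) a = 0 \<longleftrightarrow> (\<forall>i. coord ((ad (of_poly p) ^^ Suc k) a) i = 0)"
      using skew_eqI [of "(ad (of_poly p) ^^ Suc k) a" 0] by auto
    also have "\<dots> \<longleftrightarrow> (\<forall>i. i \<noteq> 0 \<longrightarrow> coord a i = 0)"
      unfolding pow_coord
      using \<open>\<And>i. i \<noteq> 0 \<Longrightarrow> p - poly_translate i p \<noteq> 0\<close>
      by (auto simp del: to_fract_diff to_fract_mult power_Suc) (metis poly_translate_simps(5) power_0_Suc diff_self)
    finally show ?thesis .
  qed
  show ?thesis
  proof (intro equalityI subsetI)
    fix a assume "a \<in> nil_filt (of_poly p) (int k)"
    then have a: "a \<in> weyl" "\<forall>i. i \<noteq> 0 \<longrightarrow> coord a i = 0"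
      unfolding nil_filt_nat zero by auto
    from a(1) obtain q where "coord a 0 = to_fract q * to_fract (wpoly 0)"
      unfolding weyl_iff by blast
    then have "a = of_poly q"
      using a(2) by (intro skew_eqI) (auto simp: of_poly_eq coord_monom)
    then show "a \<in> range of_poly" by blast
  next
    fix a :: "'k skew" assume "a \<in> range of_poly"
    then obtain q where "a = of_poly q" by blast
    then show "a \<in> nil_filt (of_poly p) (int k)"
      unfolding nil_filt_nat zero by (auto simp: of_poly_in_weyl) (simp add: of_poly_eq coord_monom)
  qed
qed

lemma nil_set_of_poly:
  assumes "p \<notin> range (\<lambda>c. [:c:])"
  shows "nil_set (of_poly p) = range of_poly" "centralizer (of_poly p) = range of_poly"
  using nil_filt_of_poly [OF assms, of 0]
  by (simp_all add: nil_set_def centralizer_def nil_filt_of_poly [OF assms])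

section \<open>The nilpotent elements of a homogeneous element of nonzero degree\<close>

lemma skew_monom_unit:
  assumes "f \<noteq> 0"
  shows "skew_monom f i * inverse (skew_monom f i) = 1" "inverse (skew_monom f i) * skew_monom f i = 1"
proof -
  have "sigma (- i) (inverse f) * sigma (- i) f = sigma (- i) (inverse f * f)"
    by (simp only: sigma_simps)
  with assms show "inverse (skew_monom f i) * skew_monom f i = 1"
    "skew_monom f i * inverse (skew_monom f i) = 1"
    by (simp_all add: inverse_skew_monom one_eq_skew_monom)
qed

section \<open>Roots of u in B and the canonical generator of its centralizer\<close>

locale homogeneous =
  fixes \<alpha> :: "'k::field_char_0 poly" and n :: int
  assumes monic: "lead_coeff \<alpha> = 1" and n_nz: "n \<noteq> 0"
begin

definition u where "u = of_poly \<alpha> * vgen n"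
definition s where "s = canon_s u n"
definition t where "t = canon_t u n"
definition m where "m = canon_m u n"
definition \<beta> where "\<beta> = canon_beta u n"
definition v where "v = canon_v u n"
text \<open>This is \<alpha>', the coefficient of u with respect to X^n; it differs from \<alpha> by
  the factor w_n.\<close>

definition a0 where "a0 = coord u n"

lemma alpha_nz: "\<alpha> \<noteq> 0"
  using monic by auto

lemma a0_eq: "a0 = to_fract \<alpha> * to_fract (wpoly n)"
  by (simp add: a0_def u_def coord_of_poly_times vgen_eq coord_monom)

lemma u_eq: "u = skew_monom a0 n"
  by (simp add: a0_eq u_def of_poly_eq vgen_eq)

lemma a0_monic: "monic_fract a0"
  unfolding a0_eq using monic by (simp add: monic_fract_mult)

lemma a0_nz: "a0 \<noteq> 0"
  using a0_monic by (rule monic_fract_nz)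

lemma root_coeff_iff:
  "root_coeff u n r b \<longleftrightarrow> monic_fract b \<and> (\<Prod>k<nat (n div r). sigma (int k * r) b) = a0"
  by (simp add: root_coeff_def a0_def)

text \<open>The minimum is taken over a nonempty set: \<bar>n\<bar> belongs to it, as u is the first
  power of itself.\<close>

lemma canon_s: "0 < s \<and> int s dvd n \<and> (\<exists>\<beta>. root_coeff u n (sgn n * int s) \<beta>)"
  unfolding s_def canon_s_def
proof (rule LeastI)
  have "sgn n * int (nat \<bar>n\<bar>) = n" by (simp add: sgn_mult_abs)
  moreover have "root_coeff u n n a0"
    using n_nz a0_monic by (simp add: root_coeff_iff lessThan_Suc)
  ultimately show "0 < nat \<bar>n\<bar> \<and> int (nat \<bar>n\<bar>) dvd n \<and> (\<exists>\<beta>. root_coeff u n (sgn n * int (nat \<bar>n\<bar>)) \<beta>)"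
    using n_nz by auto
qed

lemma canon_s_le:
  "0 < r \<Longrightarrow> int r dvd n \<Longrightarrow> root_coeff u n (sgn n * int r) b \<Longrightarrow> s \<le> r"
  unfolding s_def canon_s_def by (rule Least_le) blast

lemma t_eq: "t = sgn n * int s"
  by (simp add: t_def canon_t_def s_def)

lemma t_nz: "t \<noteq> 0"
  using canon_s n_nz by (simp add: t_eq sgn_eq_0_iff)

lemma t_m: "int m * t = n" and m_pos: "m > 0"
proof -
  have dvd: "t dvd n" using canon_s n_nz by (auto simp: t_eq sgn_if)
  then have *: "n div t * t = n" by simp
  have "n div t > 0"
  proof (rule ccontr)
    assume "\<not> ?thesis"
    then have "n div t * (t * t) \<le> 0" by (intro mult_nonpos_nonneg) auto
    then have "n * t \<le> 0" using * by (metis mult.assoc)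
    moreover have "n * t > 0"
      using canon_s n_nz by (simp add: t_eq sgn_if zero_less_mult_iff)
    ultimately show False by simp
  qed
  with * show "int m * t = n" "m > 0" by (simp_all add: m_def canon_m_def t_def)
qed

lemma t_dvd_n: "t dvd n"
  by (metis t_m dvd_triv_right)

lemma t_dvdE:
  assumes "t dvd l"
  obtains j where "l = j * t"
proof -
  from assms obtain j where "l = t * j" by (rule dvdE)
  then have "l = j * t" by simp
  then show ?thesis by (rule that)
qed

lemma m_eq: "m = nat (n div t)"
  by (simp add: m_def canon_m_def t_def)

lemma root_coeff_t: "root_coeff u n t b \<longleftrightarrow> monic_fract b \<and> (\<Prod>k<m. sigma (int k * t) b) = a0"
  by (simp add: root_coeff_iff m_eq)

lemma monic_invariant:
  fixes f :: "'k poly fract"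
  assumes "sigma n f = f" "monic_fract f"
  shows "f = 1"
proof -
  from n_nz assms(1) obtain c where "f = to_fract [:c:]" by (rule sigma_fixed)
  with assms(2) show ?thesis by (simp add: one_pCons [symmetric])
qed

text \<open>For the quotient e of two monic roots the twisted product is 1. Applying \<sigma>^t to
  this product and multiplying by e shifts the range of its factors by one, which gives
  \<sigma>^n(e) = e; a monic fixed element is 1.\<close>

lemma root_coeff_unique:
  assumes "root_coeff u n t b" "root_coeff u n t c"
  shows "b = c"
proof -
  define e where "e = b / c"
  have nz: "b \<noteq> 0" "c \<noteq> 0" and mon: "monic_fract b" "monic_fract c"
    using assms monic_fract_nz by (auto simp: root_coeff_t)
  have P: "(\<Prod>k<m. sigma (int k * t) e) = 1"
    using assms a0_nz by (simp add: e_def root_coeff_t prod_dividef)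
  have "e * sigma t (\<Prod>k<m. sigma (int k * t) e) = (\<Prod>k<Suc m. sigma (int k * t) e)"
    unfolding prod.lessThan_Suc_shift by (simp add: sigma_prod algebra_simps)
  also have "\<dots> = (\<Prod>k<m. sigma (int k * t) e) * sigma n e"
    by (simp add: t_m)
  finally have "sigma n e = e" using P by simp
  then have "e = 1" using mon by (intro monic_invariant) (simp_all add: e_def monic_fract_divide)
  with nz show ?thesis by (simp add: e_def)
qed

lemma root_coeff_beta: "root_coeff u n t \<beta>"
  unfolding \<beta>_def canon_beta_def t_def [symmetric]
proof (rule theI')
  show "\<exists>!b. root_coeff u n t b"
    using canon_s root_coeff_unique unfolding t_eq by blast
qed

lemma beta_monic: "monic_fract \<beta>" and beta_prod: "(\<Prod>k<m. sigma (int k * t) \<beta>) = a0"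
  using root_coeff_beta by (simp_all add: root_coeff_t)

lemma beta_nz: "\<beta> \<noteq> 0"
  using beta_monic by (rule monic_fract_nz)

lemma v_eq: "v = skew_monom \<beta> t"
  by (simp add: v_def canon_v_def \<beta>_def t_def of_fract_def genX_powi)

lemma v_m: "v ^ m = u"
  by (simp add: v_eq skew_monom_power beta_prod t_m u_eq)

text \<open>The coefficient of v^j with respect to X^{jt}, for negative j as well. By
  \<open>nu_add\<close> it is a cocycle for the translations by multiples of t, and it serves as the
  unit in which components of degree jt are measured.\<close>

definition \<nu> where "\<nu> j = coord (v powi j) (j * t)"

lemma v_powi_add: "v powi (i + j) = v powi i * v powi j"
  unfolding v_eq using skew_monom_unit [OF beta_nz] by (rule powi_unit_add)

lemma v_powi_nat [simp]: "v powi (int j) = v ^ j"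
  by (simp add: power_int_def)

lemma v_powi_eq: "v powi j = skew_monom (\<nu> j) (j * t)"
proof -
  have "\<exists>f. v powi j = skew_monom f (j * t)"
    by (cases "j \<ge> 0") (auto simp: power_int_def v_eq inverse_skew_monom beta_nz skew_monom_power)
  then show ?thesis by (auto simp: \<nu>_def coord_monom)
qed

lemma nu_0 [simp]: "\<nu> 0 = 1"
  by (simp add: \<nu>_def one_eq_skew_monom coord_monom)

lemma nu_add: "\<nu> (i + j) = \<nu> i * sigma (i * t) (\<nu> j)"
  using v_powi_add [of i j] unfolding v_powi_eq
  by (metis coord_monom distrib_right skew_monom_mult)

lemma nu_nz [simp]: "\<nu> j \<noteq> 0"
  using nu_add [of j "- j"] by auto

lemma nu_nat: "\<nu> (int j) = (\<Prod>k<j. sigma (int k * t) \<beta>)"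
  by (simp add: \<nu>_def v_eq [symmetric]) (simp add: v_eq skew_monom_power coord_monom)

lemma nu_m [simp]: "\<nu> (int m) = a0"
  by (simp add: nu_nat beta_prod)

section \<open>The kernels of the powers of ad u in B\<close>

lemma coord_ad:
  "coord (ad u x) (l + n) = a0 * sigma n (coord x l) - coord x l * sigma l a0"
  by (simp add: ad_def u_eq coord_monom_times coord_times_monom)

text \<open>The degrees of the homogeneous elements commuting with \<open>u\<close> form a subgroup of the integers
  containing \<open>t\<close> and \<open>n\<close>. Its generator \<open>d\<close> yields a root of \<open>u\<close> of degree \<open>\<plusminus>d\<close>, so \<open>d = \<bar>t\<bar>\<close> by
  the choice of \<open>t\<close>.\<close>

lemma commuting_degree:
  assumes f: "f \<noteq> 0" "a0 * sigma n f = f * sigma l a0"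
  shows "t dvd l"
proof -
  define Z where "Z = {l. \<exists>f. f \<noteq> 0 \<and> skew_monom f l * u = u * skew_monom f l}"
  have Z_add: "i + j \<in> Z" if Z: "i \<in> Z" "j \<in> Z" for i j
  proof -
    obtain f g where fg: "f \<noteq> 0" "skew_monom f i * u = u * skew_monom f i"
      "g \<noteq> 0" "skew_monom g j * u = u * skew_monom g j" using Z by (auto simp: Z_def)
    then have "skew_monom f i * skew_monom g j * u = u * (skew_monom f i * skew_monom g j)"
      by (metis mult.assoc)
    moreover have "f * sigma i g \<noteq> 0" using fg by simp
    ultimately show ?thesis unfolding Z_def skew_monom_mult by blast
  qed
  have Z_minus: "- i \<in> Z" if Z: "i \<in> Z" for i
  proof -
    obtain f where f: "f \<noteq> 0" "skew_monom f i * u = u * skew_monom f i"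
      using Z by (auto simp: Z_def)
    let ?b = "inverse (skew_monom f i)"
    have "?b * u = ?b * u * (skew_monom f i * ?b)" using skew_monom_unit [OF f(1)] by simp
    also have "\<dots> = ?b * (skew_monom f i * u) * ?b" unfolding f(2) by (simp add: mult.assoc)
    also have "\<dots> = u * ?b" using skew_monom_unit [OF f(1)] by (simp flip: mult.assoc)
    finally show ?thesis
      unfolding inverse_skew_monom [OF f(1)] Z_def using f(1)
      by (intro CollectI exI [of _ "sigma (- i) (inverse f)"]) simp
  qed
  have Z_mult: "k * i \<in> Z" if Z: "i \<in> Z" for k i
  proof (induction k rule: int_induct [where k = 0])
    case base
    show ?case unfolding Z_def
      by (intro CollectI exI [of _ 1]) (simp flip: one_eq_skew_monom)
  next
    case (step1 k)
    then show ?case using Z_add [OF _ Z] by (simp add: distrib_right)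
  next
    case (step2 k)
    then show ?case using Z_add [OF _ Z_minus [OF Z]] by (fastforce simp: left_diff_distrib)
  qed
  have "skew_monom f l * u = u * skew_monom f l"
    using f(2) by (simp add: u_eq algebra_simps)
  then have "l \<in> Z" using f(1) by (auto simp: Z_def)
  moreover have "t \<in> Z"
  proof -
    have "v * u = u * v" unfolding v_m [symmetric] by (metis power_Suc power_Suc2)
    then show ?thesis using beta_nz by (auto simp: Z_def v_eq)
  qed
  moreover obtain x y where xy: "x * l + y * t = gcd l t" using bezout_int by blast
  ultimately have "gcd l t \<in> Z" using Z_add Z_mult by metis
  define d where "d = nat (gcd l t)"
  have d: "int d = gcd l t" "d > 0" using t_nz by (simp_all add: d_def)
  have "int d dvd n"
    unfolding d using t_dvd_n by (rule dvd_trans [OF gcd_dvd2])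
  define q where "q = nat (n div (sgn n * int d))"
  have qn: "int q * (sgn n * int d) = n"
  proof -
    from \<open>int d dvd n\<close> have "int d dvd \<bar>n\<bar>" by simp
    then obtain c where c: "\<bar>n\<bar> = int d * c" by (rule dvdE)
    with d n_nz have "c \<ge> 0" by (metis abs_ge_zero of_nat_0_less_iff zero_le_mult_iff not_le)
    have "n = sgn n * \<bar>n\<bar>" by (simp add: sgn_mult_abs)
    then have n: "n = sgn n * int d * c" using c by (simp add: mult.assoc)
    have "sgn n * int d \<noteq> 0" using d(2) n_nz by (simp add: sgn_eq_0_iff)
    then have "n div (sgn n * int d) = c" using n by (metis nonzero_mult_div_cancel_left)
    with n \<open>c \<ge> 0\<close> show ?thesis by (simp add: q_def mult.commute)
  qed
  have "sgn n * int d \<in> Z" using Z_mult [OF \<open>gcd l t \<in> Z\<close>, of "sgn n"] d by simp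
  then obtain f where f: "f \<noteq> 0" "skew_monom f (sgn n * int d) * u = u * skew_monom f (sgn n * int d)"
    unfolding Z_def by blast
  \<comment> \<open>Scalars commute with u, so the coefficient may be taken monic, as a root
    requires.\<close>
  from f(1) obtain c g where cg: "c \<noteq> 0" "f = to_fract [:c:] * g" "monic_fract g"
    by (rule monic_normalize)
  have "f * sigma (sgn n * int d) a0 = a0 * sigma n f"
    using f(2) unfolding u_eq by (metis coord_monom skew_monom_mult add.commute)
  then have "to_fract [:c:] * (g * sigma (sgn n * int d) a0) = to_fract [:c:] * (a0 * sigma n g)"
    using cg(2) by (simp add: algebra_simps)
  then have "g * sigma (sgn n * int d) a0 = a0 * sigma n g" using cg(1) by simp
  then have w: "skew_monom g (sgn n * int d) * u = u * skew_monom g (sgn n * int d)"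
    unfolding u_eq by (simp add: add.commute)
  \<comment> \<open>The coefficient of the q-th power, which has the same degree n as u and commutes
    with u. Hence P / a0 is fixed by \<sigma>^n, and being monic it is 1: a root of u has been
    found.\<close>
  define P where "P = (\<Prod>k<q. sigma (int k * (sgn n * int d)) g)"
  have "skew_monom g (sgn n * int d) ^ q * u = u * skew_monom g (sgn n * int d) ^ q"
    using w by (rule power_commuting_commutes)
  then have "P * sigma n a0 = a0 * sigma n P"
    unfolding skew_monom_power qn P_def [symmetric] u_eq by (metis coord_monom skew_monom_mult)
  then have "sigma n (P / a0) = P / a0" using a0_nz by (simp add: field_simps)
  moreover have monP: "monic_fract P" unfolding P_def
    using cg(3) by (intro monic_fract_prod monic_fract_sigma)
  ultimately have "P / a0 = 1" using a0_monic by (intro monic_invariant monic_fract_divide)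
  then have "root_coeff u n (sgn n * int d) g"
    using cg(3) a0_nz by (simp add: root_coeff_iff P_def q_def)
  \<comment> \<open>Minimality of s gives one inequality; d divides s because the gcd divides
    t.\<close>
  then have "s \<le> d" using d \<open>int d dvd n\<close> by (intro canon_s_le)
  moreover have "int d dvd int s"
    unfolding d(1) using n_nz by (simp add: t_eq sgn_if split: if_splits)
  then have "d \<le> s" using canon_s by (auto dest: dvd_imp_le)
  ultimately have "gcd l t = \<bar>t\<bar>" using d n_nz by (simp add: t_eq abs_mult)
  then show ?thesis by (metis abs_dvd_iff gcd_dvd1)
qed

text \<open>Describes the kernel of the k-th power of ad u explicitly: the support lies in the
  multiples of t, and the coefficients with respect to the powers of v are polynomials of degree
  below k. For k = 0 this leaves only 0.\<close>

definition vpart where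
  "vpart k x \<longleftrightarrow> (\<forall>l. \<not> t dvd l \<longrightarrow> coord x l = 0) \<and>
     (\<forall>j. \<exists>h. coord x (j * t) = to_fract h * \<nu> j \<and> (\<forall>l\<ge>k. coeff h l = 0))"

lemma vpart_zero: "vpart k x \<Longrightarrow> \<not> t dvd l \<Longrightarrow> coord x l = 0"
  by (simp add: vpart_def)

lemma vpartE:
  assumes "vpart k x"
  obtains h where "coord x (j * t) = to_fract h * \<nu> j" "\<forall>l\<ge>k. coeff h l = 0"
proof -
  from assms have "\<forall>j. \<exists>h. coord x (j * t) = to_fract h * \<nu> j \<and> (\<forall>l\<ge>k. coeff h l = 0)"
    unfolding vpart_def by (rule conjunct2)
  then have "\<exists>h. coord x (j * t) = to_fract h * \<nu> j \<and> (\<forall>l\<ge>k. coeff h l = 0)"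
    by (rule spec)
  then show ?thesis using that by (elim exE conjE)
qed

lemma vpart_0: "vpart 0 x \<longleftrightarrow> x = 0"
proof
  assume *: "vpart 0 x"
  show "x = 0"
  proof (rule skew_eqI)
    fix l
    show "coord x l = coord 0 l"
    proof (cases "t dvd l")
      case True
      then obtain j where l: "l = j * t" by (rule t_dvdE)
      from * obtain h where h: "coord x (j * t) = to_fract h * \<nu> j" "\<forall>l\<ge>0. coeff h l = 0"
        by (rule vpartE)
      from h(2) have "h = 0" by (simp add: poly_eqI)
      with h(1) l show ?thesis by simp
    next
      case False
      with * have "coord x l = 0" by (rule vpart_zero)
      then show ?thesis by simp
    qed
  qed
next
  have "\<exists>h. 0 = to_fract h * \<nu> j \<and> (\<forall>l\<ge>0. coeff h l = 0)" for j
    by (rule exI [of _ 0]) simp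
  moreover assume "x = 0"
  ultimately show "vpart 0 x" unfolding vpart_def by simp
qed

text \<open>Both u v^j and v^j u are v^{j+m}, so that only moving u past the coefficient h
  contributes.\<close>

lemma ad_homogeneous_component:
  assumes "coord x (j * t) = h * \<nu> j"
  shows "coord (ad u x) ((j + int m) * t) = (sigma n h - h) * \<nu> (j + int m)"
proof -
  have "(j + int m) * t = j * t + n" by (simp add: distrib_right t_m)
  then have "coord (ad u x) ((j + int m) * t) = a0 * sigma n (h * \<nu> j) - h * \<nu> j * sigma (j * t) a0"
    using assms by (simp add: coord_ad)
  also have "\<nu> (j + int m) = a0 * sigma n (\<nu> j)"
    using nu_add [of "int m" j] by (simp only: nu_m t_m add.commute)
  then have "a0 * sigma n (h * \<nu> j) = sigma n h * \<nu> (j + int m)"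
    by (simp add: mult_ac)
  also have "h * \<nu> j * sigma (j * t) a0 = h * \<nu> (j + int m)"
    using nu_add [of j "int m"] by (simp add: mult_ac)
  finally show ?thesis by (simp add: algebra_simps)
qed

text \<open>In degrees divisible by t this is \<open>sigma_difference_bound\<close>, with the index
  shifted by m. In any other degree l, a component annihilated by ad u is zero by
  \<open>commuting_degree\<close>; here t dvd n ensures that l and l + n are of the same
  kind.\<close>

lemma vpart_ad: "vpart k (ad u x) \<longleftrightarrow> vpart (Suc k) x"
proof
  assume *: "vpart k (ad u x)"
  show "vpart (Suc k) x"
    unfolding vpart_def
  proof (intro conjI allI impI)
    fix l assume l: "\<not> t dvd l"
    then have "\<not> t dvd l + n" using t_dvd_n by (simp add: dvd_add_left_iff)
    with * have "coord (ad u x) (l + n) = 0" by (rule vpart_zero)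
    then have "a0 * sigma n (coord x l) = coord x l * sigma l a0"
      by (simp add: coord_ad)
    with l show "coord x l = 0" using commuting_degree by blast
  next
    fix j
    define f where "f = coord x (j * t) / \<nu> j"
    have f: "coord x (j * t) = f * \<nu> j" by (simp add: f_def)
    from * obtain g where g: "coord (ad u x) ((j + int m) * t) = to_fract g * \<nu> (j + int m)"
        "\<forall>l\<ge>k. coeff g l = 0"
      by (rule vpartE)
    have "(sigma n f - f) * \<nu> (j + int m) = to_fract g * \<nu> (j + int m)"
      using ad_homogeneous_component [OF f] g(1) by simp
    then have "sigma n f - f = to_fract g"
      by (simp only: mult_cancel_right nu_nz simp_thms)
    then have "\<exists>h. f = to_fract h \<and> (\<forall>l\<ge>Suc k. coeff h l = 0)"
      using g(2) sigma_difference_bound [OF n_nz, of f k] by blast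
    then show "\<exists>h. coord x (j * t) = to_fract h * \<nu> j \<and> (\<forall>l\<ge>Suc k. coeff h l = 0)"
      using f by metis
  qed
next
  assume *: "vpart (Suc k) x"
  show "vpart k (ad u x)"
    unfolding vpart_def
  proof (intro conjI allI impI)
    fix l assume l: "\<not> t dvd l"
    then have "\<not> t dvd l - n" using t_dvd_n by (simp add: dvd_diff_left_iff)
    with * have "coord x (l - n) = 0" by (rule vpart_zero)
    then show "coord (ad u x) l = 0" using coord_ad [of x "l - n"] by simp
  next
    fix j
    from * obtain h where h: "coord x ((j - int m) * t) = to_fract h * \<nu> (j - int m)"
        "\<forall>l\<ge>Suc k. coeff h l = 0"
      by (rule vpartE)
    have "coord (ad u x) (j * t) = (sigma n (to_fract h) - to_fract h) * \<nu> j"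
      using ad_homogeneous_component [OF h(1)] by simp
    moreover obtain g where "sigma n (to_fract h) - to_fract h = to_fract g" "\<forall>l\<ge>k. coeff g l = 0"
      using h(2) sigma_difference_bound [OF n_nz, of "to_fract h" k] by blast
    ultimately show "\<exists>h. coord (ad u x) (j * t) = to_fract h * \<nu> j \<and> (\<forall>l\<ge>k. coeff h l = 0)"
      by metis
  qed
qed

lemma ad_funpow_eq_0_iff: "(ad u ^^ k) x = 0 \<longleftrightarrow> vpart k x"
proof (induction k arbitrary: x)
  case (Suc k)
  then show ?case by (simp add: funpow_swap1 vpart_ad)
qed (simp add: vpart_0)

text \<open>The coefficient of v^j with respect to \<open>vgen (j * t)\<close>, so that
  \<open>\<rho> 1\<close> is \<gamma>. A multiple p v^j lies in A_1 exactly when p times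
  \<open>\<rho> j\<close> is a polynomial.\<close>

definition \<rho> where "\<rho> j = \<nu> j / to_fract (wpoly (j * t))"
definition d where "d j = den (\<rho> j)"

lemma rho_nz [simp]: "\<rho> j \<noteq> 0"
  by (simp add: \<rho>_def)

lemma d_nz [simp]: "d j \<noteq> 0"
  by (simp add: d_def)

lemma v_powi_rho: "v powi j = of_fract (\<rho> j) * vgen (j * t)"
  by (simp add: v_powi_eq vgen_eq of_fract_def \<rho>_def)

lemma poly_v_in_weyl_iff: "of_poly p * v powi j \<in> weyl \<longleftrightarrow> d j dvd p"
  by (simp add: v_powi_eq of_poly_eq skew_monom_in_weyl_iff d_def den_dvd_iff \<rho>_def)

text \<open>The kernel condition makes the coefficient with respect to v^j a polynomial of degree at
  most k; lying in A_1 then says that this polynomial is a multiple of \<open>d j\<close>.\<close>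

lemma nil_filt_eq:
  "nil_filt u (int k) = {x. (\<forall>l. \<not> t dvd l \<longrightarrow> coord x l = 0) \<and>
     (\<forall>j. \<exists>h. coord x (j * t) = to_fract (h * d j) * \<nu> j \<and> degree (h * d j) \<le> k)}"
  (is "_ = ?R")
proof (intro equalityI subsetI)
  fix x assume "x \<in> nil_filt u (int k)"
  then have x: "x \<in> weyl" "vpart (Suc k) x" unfolding nil_filt_nat ad_funpow_eq_0_iff by auto
  show "x \<in> ?R"
  proof (intro CollectI conjI allI)
    fix l show "\<not> t dvd l \<longrightarrow> coord x l = 0" using x(2) vpart_zero by simp
  next
    fix j
    from x(2) obtain h where h: "coord x (j * t) = to_fract h * \<nu> j" "\<forall>l\<ge>Suc k. coeff h l = 0"
      by (rule vpartE)
    from x(1) obtain p where "coord x (j * t) = to_fract p * to_fract (wpoly (j * t))"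
      unfolding weyl_iff by blast
    with h(1) have "to_fract h * \<rho> j = to_fract p" by (simp add: \<rho>_def divide_eq_eq)
    then have "d j dvd h" by (simp add: d_def den_dvd_iff)
    then obtain g where "h = g * d j" by (auto elim: dvdE simp: mult.commute)
    with h show "\<exists>h. coord x (j * t) = to_fract (h * d j) * \<nu> j \<and> degree (h * d j) \<le> k"
      by (metis degree_le Suc_leI)
  qed
next
  fix x assume x: "x \<in> ?R"
  have "vpart (Suc k) x"
    unfolding vpart_def
  proof (intro conjI allI)
    fix l show "\<not> t dvd l \<longrightarrow> coord x l = 0" using x by blast
  next
    fix j
    from x obtain h where "coord x (j * t) = to_fract (h * d j) * \<nu> j" "degree (h * d j) \<le> k"
      by blast
    then show "\<exists>h. coord x (j * t) = to_fract h * \<nu> j \<and> (\<forall>l\<ge>Suc k. coeff h l = 0)"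
      by (metis coeff_eq_0 le_imp_less_Suc less_le_trans)
  qed
  moreover have "x \<in> weyl"
    unfolding weyl_iff
  proof
    fix l
    show "\<exists>p. coord x l = to_fract p * to_fract (wpoly l)"
    proof (cases "t dvd l")
      case True
      then obtain j where l: "l = j * t" by (rule t_dvdE)
      from x obtain h where h: "coord x (j * t) = to_fract (h * d j) * \<nu> j" by blast
      obtain p where "to_fract (h * d j) * \<rho> j = to_fract p"
        using den_dvd_iff [of "\<rho> j" "h * d j"] by (auto simp: d_def)
      then have "to_fract (h * d j) * \<nu> j = to_fract p * to_fract (wpoly (j * t))"
        by (simp add: \<rho>_def divide_eq_eq del: to_fract_mult)
      with h l show ?thesis by metis
    next
      case False
      with x show ?thesis by (intro exI [of _ 0]) auto
    qed
  qed
  ultimately show "x \<in> nil_filt u (int k)" unfolding nil_filt_nat ad_funpow_eq_0_iff by simp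
qed

end

section \<open>Powers of the canonical generator and their denominators\<close>

lemma monic_dvd_degree_eq:
  fixes d e :: "'k::field poly"
  assumes "lead_coeff d = 1" "lead_coeff e = 1" "d dvd e" "degree e \<le> degree d"
  shows "d = e"
proof -
  from assms(3) obtain r where r: "e = d * r" by (rule dvdE)
  have nz: "d \<noteq> 0" "e \<noteq> 0" using assms(1,2) by auto
  then have "r \<noteq> 0" using r by auto
  then have "degree e = degree d + degree r"
    using r nz by (simp add: degree_mult_eq)
  then have "degree r = 0" using assms(4) by simp
  then obtain c where "r = [:c:]" by (rule degree_eq_zeroE)
  with r have e: "e = smult c d" by simp
  then have "c \<noteq> 0" using nz by auto
  then have "c = 1" using e assms(1,2) by simp
  with e show ?thesis by simp
qed

context homogeneous
begin

section \<open>Monicity and degrees of the coefficients of v^j\<close>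

lemma nu_minus: "\<nu> (- j) = inverse (sigma (- j * t) (\<nu> j))"
proof -
  have "\<nu> (- j) * sigma (- j * t) (\<nu> j) = 1"
    using nu_add [of "- j" j] by simp
  then show ?thesis by (metis inverse_unique inverse_inverse_eq mult.commute)
qed

lemma nu_1: "\<nu> 1 = \<beta>"
  using nu_nat [of 1] by (simp add: lessThan_Suc)

lemma nu_monic: "monic_fract (\<nu> j)"
proof -
  have *: "monic_fract (\<nu> (int k))" for k
    unfolding nu_nat by (intro monic_fract_prod monic_fract_sigma beta_monic)
  show ?thesis
    by (cases j rule: int_cases2) (simp_all only: nu_minus monic_fract_inverse monic_fract_sigma *)
qed

lemma rho_monic: "monic_fract (\<rho> j)"
  unfolding \<rho>_def by (intro monic_fract_divide nu_monic) simp

lemma deg_H_nu: "deg_H (\<nu> j) = j * deg_H \<beta>"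
proof -
  have *: "deg_H (\<nu> (int k)) = int k * deg_H \<beta>" for k
    unfolding nu_nat by (subst deg_H_prod) (simp_all add: beta_nz)
  show ?thesis
    by (cases j rule: int_cases2) (simp_all add: nu_minus deg_H_inverse *)
qed

lemma canon_gamma_eq: "canon_gamma u n = \<rho> 1"
  unfolding canon_gamma_def v_def [symmetric] t_def [symmetric]
proof (rule the_equality)
  show "monic_fract (\<rho> 1) \<and> v = of_fract (\<rho> 1) * vgen t"
    using v_powi_rho [of 1] rho_monic by (simp add: power_int_def)
next
  fix g assume "monic_fract g \<and> v = of_fract g * vgen t"
  then have "skew_monom (g * to_fract (wpoly t)) t = skew_monom \<beta> t"
    by (simp add: of_fract_def vgen_eq v_eq)
  then have "g * to_fract (wpoly t) = \<beta>" by (metis coord_monom)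
  then show "g = \<rho> 1" by (simp add: \<rho>_def nu_1 eq_divide_eq)
qed

text \<open>The slope of ndeg along v_{-it} for large i.\<close>

definition e :: int where "e = \<bar>t\<bar> + deg_H (\<rho> 1)"

lemma deg_H_rho: "deg_H (\<rho> j) = j * deg_H \<beta> - int (nat (- (j * t)))"
  by (simp add: \<rho>_def deg_H_divide' deg_H_nu degree_wpoly)

lemma e_eq: "e = deg_H \<beta> + max t 0"
  by (simp add: e_def deg_H_rho)

text \<open>At negative indices v_{-jt} is a power of Y exactly when t > 0, and then w_{-jt} has
  degree jt; this accounts for the summand max t 0 of \<open>e\<close> in
  \<open>e_eq\<close>.\<close>

lemma deg_H_rho_minus: "deg_H (\<rho> (- int j)) = - int j * e"
proof -
  have "int (nat (int j * t)) = int j * max t 0"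
    by (cases "t \<ge> 0") (simp_all add: mult_nonneg_nonpos)
  then show ?thesis by (simp add: deg_H_rho e_eq algebra_simps)
qed

lemma rho_m: "\<rho> (int m) = to_fract \<alpha>"
  by (simp add: \<rho>_def a0_eq t_m)

text \<open>The degree of \<open>\<rho>\<close> is linear on nonnegative indices and
  \<open>\<rho>\<close> takes the polynomial value \<alpha> at m, so deg \<gamma> \<ge> 0; the
  remaining 1 comes from t \<noteq> 0.\<close>

lemma e_pos: "e \<ge> 1"
proof -
  have "deg_H (\<rho> (int m)) = int m * deg_H (\<rho> 1)"
  proof -
    have "int (nat (- (int m * t))) = int m * int (nat (- t))"
      by (cases "t \<ge> 0") (simp_all add: mult_nonneg_nonpos)
    then show ?thesis by (simp add: deg_H_rho algebra_simps)
  qed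
  then have "int m * deg_H (\<rho> 1) \<ge> 0" using alpha_nz by (simp add: rho_m)
  then have "deg_H (\<rho> 1) \<ge> 0" using m_pos by (simp add: zero_le_mult_iff)
  with t_nz show ?thesis by (simp add: e_def)
qed

lemma lead_coeff_d: "lead_coeff (d j) = 1"
  by (simp add: d_def lead_coeff_den)

lemma d_1_iff: "d j = 1 \<longleftrightarrow> v powi j \<in> weyl"
proof -
  have "v powi j \<in> weyl \<longleftrightarrow> d j dvd 1" using poly_v_in_weyl_iff [of 1 j] by simp
  also have "\<dots> \<longleftrightarrow> d j = 1"
    using monic_dvd_antisym [OF lead_coeff_d, of 1 j] by auto
  finally show ?thesis by simp
qed

text \<open>Generator of K[H] v^j \<inter> A_1 over K[H]. It is a uniform name for the elements
  v_{-it}, f_i v_{-it}, 1, g_i v^i and v^i of the statement.\<close>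

definition b where "b j = of_poly (d j) * v powi j"

lemma b_in_weyl: "b j \<in> weyl"
  by (simp add: b_def poly_v_in_weyl_iff)

lemma v_commute_of_poly: "v powi j * of_poly p = of_poly (poly_translate (j * t) p) * v powi j"
  by (simp add: v_powi_eq of_poly_eq mult.commute)

text \<open>Multiplying by \<open>u\<close> from either side shows that the denominator of \<open>v\<^bsup>i+(k+1)m\<^esup>\<close> divides that
  of \<open>v\<^bsup>i+km\<^esup>\<close> as well as its \<open>n\<close>-translate. Once the degree is stable, the denominator is hence
  translation invariant, that is, constant.\<close>

lemma ex_power_in_weyl: "\<exists>k. v ^ (i + k * m) \<in> weyl"
proof -
  define D where "D k = d (int (i + k * m))" for k
  have um: "v powi int m \<in> weyl"
    by (simp add: v_m u_def weyl.mult of_poly_in_weyl vgen_in_weyl)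
  have dvd1: "D (Suc k) dvd D k" for k
  proof -
    have "of_poly (D k) * v powi int (i + k * m) \<in> weyl" by (simp only: poly_v_in_weyl_iff D_def dvd_refl)
    then have "of_poly (D k) * v powi int (i + k * m) * v powi int m \<in> weyl"
      using um by (rule weyl.mult)
    then have "of_poly (D k) * v powi (int (i + k * m) + int m) \<in> weyl"
      by (simp only: v_powi_add mult.assoc)
    then show ?thesis by (simp add: poly_v_in_weyl_iff D_def algebra_simps)
  qed
  have dvd2: "D (Suc k) dvd poly_translate n (D k)" for k
  proof -
    have "of_poly (D k) * v powi int (i + k * m) \<in> weyl" by (simp only: poly_v_in_weyl_iff D_def dvd_refl)
    then have "v powi int m * (of_poly (D k) * v powi int (i + k * m)) \<in> weyl"
      by (rule weyl.mult [OF um])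
    then have "of_poly (poly_translate n (D k)) * v powi (int m + int (i + k * m)) \<in> weyl"
      by (simp only: mult.assoc [symmetric] v_commute_of_poly t_m) (simp only: mult.assoc v_powi_add)
    then show ?thesis by (simp add: poly_v_in_weyl_iff D_def algebra_simps)
  qed
  obtain k where k: "\<And>l. degree (D k) \<le> degree (D l)"
    using ex_has_least_nat [of "\<lambda>_. True" 0 "\<lambda>k. degree (D k)"] by auto
  have lc: "lead_coeff (D l) = 1" for l by (simp add: D_def lead_coeff_d)
  have "D (Suc k) = D k"
    using lc lc dvd1 k by (rule monic_dvd_degree_eq)
  moreover have "D (Suc k) = poly_translate n (D k)"
    using lc _ dvd2 by (rule monic_dvd_degree_eq) (simp_all add: lc k)
  ultimately have "poly_translate n (D k) = D k" by simp
  with n_nz obtain c where c: "D k = [:c:]" by (rule poly_translate_fixed)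
  with lc [of k] have "D k = 1" by (simp add: one_pCons)
  then have "v powi int (i + k * m) \<in> weyl" unfolding D_def d_1_iff .
  then show ?thesis unfolding v_powi_nat by blast
qed

section \<open>The constants \<mu>, f_i and g_i in terms of reduced fractions\<close>

definition \<mu> where "\<mu> = canon_mu u n"

lemma canon_mu_i:
  "v ^ canon_mu_i u n i \<in> weyl" "canon_mu_i u n i mod m = i mod m"
proof -
  obtain k where "v ^ (i + k * m) \<in> weyl" using ex_power_in_weyl by blast
  then have "v ^ (i + k * m) \<in> weyl \<and> (i + k * m) mod m = i mod m" by simp
  then have "v ^ canon_mu_i u n i \<in> weyl \<and> canon_mu_i u n i mod m = i mod m"
    unfolding canon_mu_i_def v_def [symmetric] m_def [symmetric] by (rule LeastI)
  then show "v ^ canon_mu_i u n i \<in> weyl" "canon_mu_i u n i mod m = i mod m" by auto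
qed

lemma mu_pos: "\<mu> \<ge> 1"
  by (simp add: \<mu>_def canon_mu_def)

text \<open>The residue class of j modulo m contains some exponent \<mu>_i \<le> j whose power of v
  lies in A_1; the rest of the exponent is a multiple of m, which contributes a power of u.\<close>

lemma power_in_weyl_mu:
  assumes "j \<ge> \<mu>"
  shows "v ^ j \<in> weyl"
proof -
  let ?l = "canon_mu_i u n (j mod m)"
  have "j mod m < m" using m_pos by simp
  then have "?l \<le> \<mu>"
    unfolding \<mu>_def canon_mu_def m_def [symmetric] by (intro Max_ge) auto
  then have le: "?l \<le> j" using assms by simp
  have "?l mod m = j mod m" using canon_mu_i(2) [of "j mod m"] by simp
  then have "m dvd j - ?l" using le by (metis mod_eq_dvd_iff_nat)
  then obtain q where "j - ?l = m * q" by (rule dvdE)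
  with le have "j = ?l + m * q" by simp
  then have "v ^ j = v ^ ?l * u ^ q" by (metis power_add power_mult v_m)
  moreover have "u \<in> weyl" unfolding u_def by (intro weyl.mult of_poly_in_weyl vgen_in_weyl)
  ultimately show ?thesis using canon_mu_i(1) power_in_weyl by (metis weyl.mult)
qed

lemma d_ge_mu: "j \<ge> \<mu> \<Longrightarrow> d (int j) = 1"
  by (simp add: d_1_iff power_in_weyl_mu)

lemma d_0 [simp]: "d 0 = 1"
  by (simp add: d_1_iff one_in_weyl)

lemma b_ge_mu: "j \<ge> \<mu> \<Longrightarrow> b (int j) = v ^ j"
  by (simp add: b_def d_ge_mu)

lemma b_0 [simp]: "b 0 = 1"
  by (simp add: b_def)

text \<open>The reduced numerator of \<open>\<rho> j\<close>. It expresses \<open>b j\<close>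
  through \<open>vgen (j * t)\<close>, and at negative indices it turns out to be the polynomial
  f.\<close>

definition F where "F j = (THE p. to_fract p = to_fract (d j) * \<rho> j)"

lemma F: "to_fract (F j) = to_fract (d j) * \<rho> j"
proof -
  obtain p where "to_fract p = to_fract (d j) * \<rho> j"
    using den_times [of "\<rho> j"] by (auto simp: d_def)
  then show ?thesis unfolding F_def by (metis (mono_tags, lifting) theI to_fract_eq_iff)
qed

lemma lead_coeff_F: "lead_coeff (F j) = 1"
  using monic_fract_to_fract [of "F j"] rho_monic [of j] lead_coeff_d [of j]
  by (simp add: F monic_fract_mult)

lemma F_nz: "F j \<noteq> 0"
  using lead_coeff_F [of j] by auto

lemma b_eq_F: "b j = of_poly (F j) * vgen (j * t)"
  by (simp add: b_def of_poly_eq v_powi_eq vgen_eq F \<rho>_def)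

text \<open>Degrees in F = d \<rho>. As ndeg of \<open>b j\<close> will be the degree of
  \<open>d j\<close>, this is the source of the formulas for f_j v_{-jt} and v_{-it}.\<close>

lemma degree_d_minus: "int (degree (d (- int j))) = int (degree (F (- int j))) + int j * e"
proof -
  have "deg_H (to_fract (F (- int j))) = deg_H (to_fract (d (- int j))) + deg_H (\<rho> (- int j))"
    unfolding F by (simp add: deg_H_mult)
  then show ?thesis by (simp add: F_nz deg_H_rho_minus)
qed

text \<open>For j \<ge> \<mu> the power v^j lies in A_1, so its coefficient is a polynomial multiple
  of w_{jt}. Inverting v^j makes \<open>\<rho> (- int j)\<close> the inverse of a monic polynomial
  \<open>c\<close>; its reduced numerator is 1.\<close>

lemma F_le_minus_mu:
  assumes "j \<ge> \<mu>"
  shows "F (- int j) = 1"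
proof -
  have "\<exists>p. v ^ j = skew_monom (to_fract p * to_fract (wpoly (int j * t))) (int j * t)"
  proof -
    have "v ^ j = skew_monom (\<nu> (int j)) (int j * t)" using v_powi_eq [of "int j"] by simp
    moreover from this power_in_weyl_mu [OF assms] have "\<rho> (int j) \<in> range to_fract"
      by (simp add: skew_monom_in_weyl_iff \<rho>_def)
    then obtain p where "\<nu> (int j) = to_fract p * to_fract (wpoly (int j * t))"
      by (auto simp: \<rho>_def divide_eq_eq)
    ultimately show ?thesis by metis
  qed
  then obtain p where "skew_monom (\<nu> (int j)) (int j * t) = skew_monom (to_fract p * to_fract (wpoly (int j * t))) (int j * t)"
    using v_powi_eq [of "int j"] by auto
  then have p: "\<nu> (int j) = to_fract (p * wpoly (int j * t))"
    by (metis coord_monom to_fract_mult)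
  define c where "c = wpoly (- int j * t) * poly_translate (- int j * t) (p * wpoly (int j * t))"
  have c: "\<rho> (- int j) = inverse (to_fract c)"
    by (simp only: \<rho>_def nu_minus p c_def to_fract_mult sigma_to_fract sigma_simps poly_translate_simps divide_inverse inverse_mult_distrib mult.commute)
  have "monic_fract (inverse (inverse (to_fract c)))"
    unfolding c [symmetric] by (intro monic_fract_inverse rho_monic)
  then have lc: "lead_coeff c = 1" by simp
  then have "d (- int j) = c" by (simp add: d_def c den_inverse_to_fract)
  then have "to_fract (F (- int j)) = to_fract 1"
    using lc by (auto simp: F c)
  then show ?thesis by (simp only: to_fract_eq_iff)
qed

lemma b_le_minus_mu: "j \<ge> \<mu> \<Longrightarrow> b (- int j) = vgen (- int j * t)"
  by (simp add: b_eq_F F_le_minus_mu)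

lemma canon_g_eq: "canon_g u n i = d (int i)"
  unfolding canon_g_def v_def [symmetric]
proof (rule the_equality)
  have iff: "of_poly h * v ^ i \<in> weyl \<longleftrightarrow> d (int i) dvd h" for h
    using poly_v_in_weyl_iff [of h "int i"] by simp
  have le: "degree (d (int i)) \<le> degree h" if "lead_coeff h = 1" "d (int i) dvd h" for h
    using that by (intro dvd_imp_degree_le) auto
  show min: "is_arg_min degree (\<lambda>h. lead_coeff h = 1 \<and> of_poly h * v ^ i \<in> weyl) (d (int i))"
    unfolding is_arg_min_def iff using le by (auto simp: lead_coeff_d not_less)
  fix g assume "is_arg_min degree (\<lambda>h. lead_coeff h = 1 \<and> of_poly h * v ^ i \<in> weyl) g"
  then have "lead_coeff g = 1" "d (int i) dvd g" "degree g \<le> degree (d (int i))"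
    using min unfolding is_arg_min_def iff by (auto simp: not_less)
  then show "g = d (int i)" using monic_dvd_degree_eq [OF lead_coeff_d] by metis
qed

lemma KH_span_monic_unique:
  assumes "KH_span (of_poly f * vgen i) = KH_span (of_poly g * vgen i :: 'k skew)"
    "lead_coeff f = 1" "lead_coeff g = 1"
  shows "f = g"
proof -
  have dvd: "g dvd f" if "KH_span (of_poly f * vgen i) \<subseteq> KH_span (of_poly g * vgen i :: 'k skew)" for f g
  proof -
    have "of_poly f * vgen i \<in> KH_span (of_poly f * vgen i :: 'k skew)"
      unfolding KH_span_def by (rule range_eqI [of _ _ 1]) simp
    with that obtain p where "of_poly f * vgen i = of_poly p * (of_poly g * vgen i)"
      by (auto simp: KH_span_def)
    then have "skew_monom (to_fract f * to_fract (wpoly i)) i = skew_monom (to_fract (p * g) * to_fract (wpoly i)) i"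
      by (simp add: of_poly_eq vgen_eq mult.assoc)
    then have "to_fract f * to_fract (wpoly i) = to_fract (p * g) * to_fract (wpoly i)"
      by (metis coord_monom)
    then have "to_fract f = to_fract (p * g)"
      by (simp del: to_fract_mult)
    then show ?thesis by (simp only: to_fract_eq_iff dvd_triv_right)
  qed
  show ?thesis using assms dvd [of f g] dvd [of g f] by (intro monic_dvd_antisym) simp_all
qed

text \<open>Elements of K[H] v_{-it} lie in A_1, so the intersection consists of multiples of
  \<open>b (- int i)\<close>; conversely \<open>b\<close> has both descriptions, by \<open>d\<close>
  and by \<open>F\<close>.\<close>

lemma canon_f_eq: "canon_f u n i = F (- int i)"
  unfolding canon_f_def v_def [symmetric] t_def [symmetric]
proof (rule the_equality)
  have *: "KH_span (v powi (- int i)) \<inter> KH_span (vgen (- int i * t)) = KH_span (of_poly (F (- int i)) * vgen (- int i * t))"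
    unfolding b_eq_F [symmetric]
  proof (intro equalityI subsetI)
    fix x assume "x \<in> KH_span (v powi (- int i)) \<inter> KH_span (vgen (- int i * t))"
    then have "x \<in> KH_span (v powi (- int i))" "x \<in> KH_span (vgen (- int i * t))" by simp_all
    then obtain p q where x: "x = of_poly p * v powi (- int i)" "x = of_poly q * vgen (- int i * t)"
      unfolding KH_span_def by blast
    from x(2) have "x \<in> weyl" by (simp add: weyl.mult of_poly_in_weyl vgen_in_weyl)
    then have "d (- int i) dvd p" unfolding x(1) poly_v_in_weyl_iff .
    then obtain r where "p = r * d (- int i)" by (auto elim: dvdE simp: mult.commute)
    with x(1) have "x = of_poly r * b (- int i)" by (simp add: b_def mult.assoc)
    then show "x \<in> KH_span (b (- int i))" by (simp add: KH_span_def)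
  next
    fix x assume "x \<in> KH_span (b (- int i))"
    then obtain p where x: "x = of_poly p * b (- int i)" by (auto simp: KH_span_def)
    have "x = of_poly (p * d (- int i)) * v powi (- int i)" by (simp add: x b_def mult.assoc)
    moreover have "x = of_poly (p * F (- int i)) * vgen (- int i * t)"
      unfolding x b_eq_F by (simp add: mult.assoc)
    ultimately show "x \<in> KH_span (v powi (- int i)) \<inter> KH_span (vgen (- int i * t))"
      unfolding KH_span_def by blast
  qed
  then show "lead_coeff (F (- int i)) = 1 \<and> KH_span (v powi (- int i)) \<inter> KH_span (vgen (- int i * t)) = KH_span (of_poly (F (- int i)) * vgen (- int i * t))"
    by (simp add: lead_coeff_F)
  fix f assume "lead_coeff f = 1 \<and> KH_span (v powi - int i) \<inter> KH_span (vgen (- int i * t)) = KH_span (of_poly f * vgen (- int i * t))"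
  then show "f = F (- int i)"
    using * lead_coeff_F [of "- int i"] KH_span_monic_unique [of f "- int i * t" "F (- int i)"] by simp
qed

text \<open>The lowest level of the filtration at which the index j occurs.\<close>

definition a where "a j = degree (d j)"

lemma a_0: "a 0 = 0"
  by (simp add: a_def)

lemma a_ge_mu: "j \<ge> \<mu> \<Longrightarrow> a (int j) = 0"
  by (simp add: a_def d_ge_mu)

lemma a_minus: "a (- int j) \<ge> j * nat e"
proof -
  have "int (a (- int j)) \<ge> int (j * nat e)"
    using degree_d_minus [of j] e_pos by (simp add: a_def)
  then show ?thesis by (simp only: of_nat_le_iff)
qed

lemma a_le_minus_mu: "j \<ge> \<mu> \<Longrightarrow> a (- int j) = j * nat e"
proof -
  assume "j \<ge> \<mu>"
  then have "int (a (- int j)) = int (j * nat e)"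
    using degree_d_minus [of j] e_pos by (simp add: a_def F_le_minus_mu)
  then show ?thesis by (simp only: of_nat_eq_iff)
qed

end

section \<open>Noetherianity via leading exponents\<close>

text \<open>Fix x0 in A. An element that does not dominate x0 has a smaller f-value or a smaller
  g-value than x0. There are finitely many such values, and for each of them one element with
  minimal other coordinate suffices.\<close>

lemma dickson_pair:
  fixes f g :: "'x \<Rightarrow> nat"
  obtains B where "finite B" "B \<subseteq> A" "\<forall>x\<in>A. \<exists>y\<in>B. f y \<le> f x \<and> g y \<le> g x"
proof (cases "A = {}")
  case True
  then show ?thesis using that [of "{}"] by simp
next
  case False
  then obtain x0 where x0: "x0 \<in> A" by blast
  define p where "p i = arg_min g (\<lambda>y. y \<in> A \<and> f y = i)" for i
  define q where "q i = arg_min f (\<lambda>y. y \<in> A \<and> g y = i)" for i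
  have p: "p (f x) \<in> A \<and> f (p (f x)) = f x \<and> g (p (f x)) \<le> g x" if "x \<in> A" for x
    using arg_min_nat_lemma [of "\<lambda>y. y \<in> A \<and> f y = f x" x g] that by (auto simp: p_def)
  have q: "q (g x) \<in> A \<and> g (q (g x)) = g x \<and> f (q (g x)) \<le> f x" if "x \<in> A" for x
    using arg_min_nat_lemma [of "\<lambda>y. y \<in> A \<and> g y = g x" x f] that by (auto simp: q_def)
  define B where "B = insert x0 (p ` (f ` A \<inter> {..<f x0}) \<union> q ` (g ` A \<inter> {..<g x0}))"
  have "finite B" by (simp add: B_def)
  moreover have "B \<subseteq> A" using x0 p q by (auto simp: B_def)
  moreover have "\<exists>y\<in>B. f y \<le> f x \<and> g y \<le> g x" if x: "x \<in> A" for x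
  proof (cases "f x < f x0 \<or> g x < g x0")
    case True
    then show ?thesis
    proof
      assume "f x < f x0"
      then have "p (f x) \<in> B" using x by (auto simp: B_def)
      then show ?thesis using p [OF x] by (intro bexI [of _ "p (f x)"]) auto
    next
      assume "g x < g x0"
      then have "q (g x) \<in> B" using x by (auto simp: B_def)
      then show ?thesis using q [OF x] by (intro bexI [of _ "q (g x)"]) auto
    qed
  next
    case False
    then show ?thesis by (intro bexI [of _ x0]) (auto simp: B_def)
  qed
  ultimately show ?thesis using that by blast
qed

lemma dickson_classes:
  fixes f g :: "'x \<Rightarrow> nat"
  assumes "finite (c ` A)"
  obtains B where "finite B" "B \<subseteq> A" "\<forall>x\<in>A. \<exists>y\<in>B. c y = c x \<and> f y \<le> f x \<and> g y \<le> g x"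
proof -
  have "\<exists>B. finite B \<and> B \<subseteq> {x\<in>A. c x = i} \<and> (\<forall>x\<in>{x\<in>A. c x = i}. \<exists>y\<in>B. f y \<le> f x \<and> g y \<le> g x)" for i
    by (rule dickson_pair [of "{x\<in>A. c x = i}" f g]) blast
  then obtain B where B: "\<And>i. finite (B i)" "\<And>i. B i \<subseteq> {x\<in>A. c x = i}"
      "\<And>i. \<forall>x\<in>{x\<in>A. c x = i}. \<exists>y\<in>B i. f y \<le> f x \<and> g y \<le> g x"
    by metis
  have "finite (\<Union>i\<in>c ` A. B i)" using assms B(1) by blast
  moreover have "(\<Union>i\<in>c ` A. B i) \<subseteq> A" using B(2) by blast
  moreover have "\<forall>x\<in>A. \<exists>y\<in>\<Union>i\<in>c ` A. B i. c y = c x \<and> f y \<le> f x \<and> g y \<le> g x"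
  proof
    fix x assume x: "x \<in> A"
    then obtain y where y: "y \<in> B (c x)" "f y \<le> f x" "g y \<le> g x" using B(3) by blast
    then show "\<exists>y\<in>\<Union>i\<in>c ` A. B i. c y = c x \<and> f y \<le> f x \<and> g y \<le> g x"
      using x B(2) by blast
  qed
  ultimately show ?thesis using that by blast
qed

text \<open>The level function \<open>a\<close> is known exactly outside the window from -\<mu> to
  \<mu>: zero to the right, linear with slope e to the left. At negative indices inside the window
  the linear function is a lower bound.\<close>

locale leading_exponents =
  fixes a :: "int \<Rightarrow> nat" and \<mu> e :: nat
  assumes mu_pos: "\<mu> \<ge> 1" and e_pos: "e \<ge> 1" and a_0: "a 0 = 0"
    and a_ge_mu: "j \<ge> \<mu> \<Longrightarrow> a (int j) = 0"
    and a_minus: "j * e \<le> a (- int j)"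
    and a_le_minus_mu: "j \<ge> \<mu> \<Longrightarrow> a (- int j) = j * e"
begin

text \<open>The exponents form the monoid of all \<open>(k, j)\<close> with \<open>a j \<le> k\<close>. The elements whose second
  components have the same sign and the same residue modulo \<open>\<mu>\<close> are compared like elements of
  \<open>\<nat>\<^sup>2\<close>, with coordinates \<open>(k, j)\<close> for \<open>j \<ge> 0\<close> and \<open>(k - e \<bar>j\<bar>, \<bar>j\<bar>)\<close> for \<open>j < 0\<close>.\<close>

lemma dickson:
  assumes A: "A \<subseteq> {(k, j). a j \<le> k}"
  obtains B where "finite B" "B \<subseteq> A"
    "\<And>k j. (k, j) \<in> A \<Longrightarrow> \<exists>(k', j')\<in>B. k' \<le> k \<and> a (j - j') \<le> k - k'"
proof -
  define c where "c = (\<lambda>(k :: nat, j). (j < 0, j mod int \<mu>))"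
  define f where "f = (\<lambda>(k :: nat, j). nat \<bar>j\<bar>)"
  define g where "g = (\<lambda>(k, j). if j < 0 then k - nat \<bar>j\<bar> * e else k)"
  have "c ` A \<subseteq> UNIV \<times> {0..<int \<mu>}"
    using mu_pos by (auto simp: c_def)
  then have "finite (c ` A)" by (rule finite_subset) auto
  then obtain B where B: "finite B" "B \<subseteq> A"
      "\<forall>x\<in>A. \<exists>y\<in>B. c y = c x \<and> f y \<le> f x \<and> g y \<le> g x"
    by (rule dickson_classes)
  have "\<exists>(k', j')\<in>B. k' \<le> k \<and> a (j - j') \<le> k - k'" if kj: "(k, j) \<in> A" for k j
  proof -
    from B(3) kj obtain k' j' where y: "(k', j') \<in> B" "c (k', j') = c (k, j)"
        "f (k', j') \<le> f (k, j)" "g (k', j') \<le> g (k, j)"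
      by (metis surj_pair)
    have sgn: "j' < 0 \<longleftrightarrow> j < 0" and "j' mod int \<mu> = j mod int \<mu>"
      using y(2) by (auto simp: c_def)
    then have "int \<mu> dvd j - j'" by (metis mod_eq_dvd_iff)
    \<comment> \<open>This is the purpose of comparing within residue classes: the difference is
      zero or lies outside the window, where \<open>a\<close> is given by a formula.\<close>
    then have big: "j = j' \<or> \<bar>j - j'\<bar> \<ge> int \<mu>"
      using dvd_imp_le_int [of "j - j'" "int \<mu>"] by auto
    have "k' \<le> k \<and> a (j - j') \<le> k - k'"
    proof (cases "j < 0")
      case False
      then have le: "j' \<le> j" "k' \<le> k" using sgn y by (auto simp: f_def g_def)
      have "a (j - j') = 0"
        using big le a_0 a_ge_mu [of "nat (j - j')"] by auto
      with le show ?thesis by simp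
    next
      case True
      define l l' where "l = nat (- j)" and "l' = nat (- j')"
      have l: "j = - int l" "j' = - int l'" using True sgn by (auto simp: l_def l'_def)
      have le: "l' \<le> l" "k' - l' * e \<le> k - l * e"
        using y True sgn by (auto simp: f_def g_def l)
      have "a j \<le> k" "a j' \<le> k'" using A kj y(1) B(2) by auto
      \<comment> \<open>The lower bound for \<open>a\<close> shows that the natural subtractions in
        \<open>g\<close> are not truncated, so that inequalities between \<open>g\<close>-values can
        be rearranged.\<close>
      then have kl: "l * e \<le> k" "l' * e \<le> k'"
        using a_minus [of l] a_minus [of l'] by (auto simp: l)
      have j: "j - j' = - int (l - l')" using le by (simp add: l)
      have "a (j - j') = (l - l') * e"
        using big a_0 a_le_minus_mu [of "l - l'"] unfolding j by (auto simp: l)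
      also have "\<dots> = l * e - l' * e" by (rule diff_mult_distrib)
      also have "\<dots> \<le> k - k'" using le kl mult_le_mono1 [OF le(1), of e] by linarith
      finally show ?thesis using le kl mult_le_mono1 [OF le(1), of e] by linarith
    qed
    with y(1) show ?thesis by auto
  qed
  with B(1,2) show ?thesis using that by blast
qed

text \<open>An index beyond 2 \<mu> splits off \<mu> and leaves at least \<mu>, so both summands are
  in the range where \<open>a\<close> is additive; likewise on the left. The additivity is what the
  graded algebra uses, the range of the indices what N(u) uses.\<close>

lemma generation:
  assumes small: "\<And>j. \<bar>j\<bar> \<le> 2 * int \<mu> \<Longrightarrow> P j"
    and step: "\<And>i j. P i \<Longrightarrow> P j \<Longrightarrow> a i + a j = a (i + j) \<Longrightarrow>
      (i \<ge> int \<mu> \<and> j \<ge> int \<mu> \<or> i \<le> - int \<mu> \<and> j \<le> - int \<mu>) \<Longrightarrow> P (i + j)"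
  shows "P j"
proof (induction "nat \<bar>j\<bar>" arbitrary: j rule: less_induct)
  case less
  show ?case
  proof (cases "\<bar>j\<bar> \<le> 2 * int \<mu>")
    case False
    show ?thesis
    proof (cases "j > 0")
      case True
      define l where "l = nat (j - int \<mu>)"
      have l: "j = int \<mu> + int l" "l \<ge> \<mu>" using True False by (auto simp: l_def)
      have "P (int \<mu>)" "P (int l)" using less [of "int l"] l small mu_pos by auto
      moreover have "a (int \<mu>) + a (int l) = a (int \<mu> + int l)"
        using a_ge_mu [of \<mu>] a_ge_mu [of l] a_ge_mu [of "\<mu> + l"] l by simp
      ultimately show ?thesis unfolding l(1) using l(2) by (intro step) auto
    next
      case neg: False
      define l where "l = nat (- j - int \<mu>)"
      have l: "j = - int \<mu> + - int l" "l \<ge> \<mu>" using neg False by (auto simp: l_def)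
      have "P (- int \<mu>)" "P (- int l)" using less [of "- int l"] l small mu_pos by auto
      moreover have "a (- int \<mu>) + a (- int l) = a (- int (\<mu> + l))"
        using a_le_minus_mu [of \<mu>] a_le_minus_mu [of l] a_le_minus_mu [of "\<mu> + l"] l
        by (simp only: le_add1 order_refl add_mult_distrib)
      ultimately show ?thesis unfolding l(1) using l(2) by (intro step) auto
    qed
  qed (rule small)
qed

end

lemma lookup_times_int:
  fixes f g :: "int \<Rightarrow>\<^sub>0 'k::comm_ring_1"
  assumes "finite A" "Poly_Mapping.keys f \<subseteq> A"
  shows "Poly_Mapping.lookup (f * g) j = (\<Sum>i\<in>A. Poly_Mapping.lookup f i * Poly_Mapping.lookup g (j - i))"
proof -
  have "(\<Sum>q. Poly_Mapping.lookup g q when j = l + q) = Poly_Mapping.lookup g (j - l)" for l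
  proof -
    have "(\<lambda>q. Poly_Mapping.lookup g q when j = l + q) = (\<lambda>q. Poly_Mapping.lookup g q when q = j - l)"
      by (auto simp: fun_eq_iff when_def)
    then show ?thesis by (simp only: Sum_any_when_equal)
  qed
  then have "Poly_Mapping.lookup (f * g) j = (\<Sum>l. Poly_Mapping.lookup f l * Poly_Mapping.lookup g (j - l))"
    by (simp add: lookup_mult)
  also have "\<dots> = (\<Sum>i\<in>A. Poly_Mapping.lookup f i * Poly_Mapping.lookup g (j - i))"
  proof (rule Sum_any.expand_superset [OF assms(1)])
    show "{i. Poly_Mapping.lookup f i * Poly_Mapping.lookup g (j - i) \<noteq> 0} \<subseteq> A"
    proof
      fix i assume "i \<in> {i. Poly_Mapping.lookup f i * Poly_Mapping.lookup g (j - i) \<noteq> 0}"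
      then have "Poly_Mapping.lookup f i \<noteq> 0" by auto
      then show "i \<in> A" using assms(2) by (auto simp: in_keys_iff)
    qed
  qed
  finally show ?thesis .
qed

lemma lookup_single_times_int:
  fixes g :: "int \<Rightarrow>\<^sub>0 'k::comm_ring_1"
  shows "Poly_Mapping.lookup (Poly_Mapping.single i c * g) j = c * Poly_Mapping.lookup g (j - i)"
  by (subst lookup_times_int [of "{i}"]) auto

text \<open>Common abstraction of N(u) and of the model of its graded algebra: a filtration by
  additive groups whose k-th symbol map has the previous level as kernel and takes values in Laurent
  polynomials. No product is fixed, since both left and right multiplication have to fit.\<close>

locale symbol_algebra = leading_exponents a \<mu> e
  for a \<mu> e +
  fixes Fl :: "nat \<Rightarrow> 'a::ab_group_add set" and sym :: "nat \<Rightarrow> 'a \<Rightarrow> (int \<Rightarrow>\<^sub>0 'k::field)"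
  assumes Fl_diff: "x \<in> Fl k \<Longrightarrow> y \<in> Fl k \<Longrightarrow> x - y \<in> Fl k"
    and sym_diff: "x \<in> Fl k \<Longrightarrow> y \<in> Fl k \<Longrightarrow> sym k (x - y) = sym k x - sym k y"
    and sym_ker_0: "x \<in> Fl 0 \<Longrightarrow> sym 0 x = 0 \<Longrightarrow> x = 0"
    and sym_ker_Suc: "x \<in> Fl (Suc k) \<Longrightarrow> sym (Suc k) x = 0 \<Longrightarrow> x \<in> Fl k"
    and keys_sym: "x \<in> Fl k \<Longrightarrow> j \<in> Poly_Mapping.keys (sym k x) \<Longrightarrow> a j \<le> k"
    and sym_single: "a j \<le> k \<Longrightarrow> \<exists>x\<in>Fl k. sym k x = Poly_Mapping.single j c"
begin

text \<open>The pair of \<open>dg\<close> and \<open>lj\<close> is the leading exponent: the exact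
  level, and the largest index in the symbol at that level.\<close>

definition dg where "dg x = (LEAST k. x \<in> Fl k)"
definition lj where "lj x = Max (Poly_Mapping.keys (sym (dg x) x))"

lemma leading:
  assumes "x \<in> Fl k" "x \<noteq> 0"
  shows "x \<in> Fl (dg x)" "dg x \<le> k" "sym (dg x) x \<noteq> 0" "lj x \<in> Poly_Mapping.keys (sym (dg x) x)"
    "a (lj x) \<le> dg x"
proof -
  show 1: "x \<in> Fl (dg x)" unfolding dg_def using assms(1) by (rule LeastI)
  show "dg x \<le> k" unfolding dg_def using assms(1) by (rule Least_le)
  show 2: "sym (dg x) x \<noteq> 0"
  proof
    assume 0: "sym (dg x) x = 0"
    show False
    proof (cases "dg x")
      case 0
      with 1 \<open>sym (dg x) x = 0\<close> show False using sym_ker_0 assms(2) by simp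
    next
      case (Suc l)
      with 1 0 have "x \<in> Fl l" using sym_ker_Suc by simp
      then have "dg x \<le> l" unfolding dg_def by (rule Least_le)
      with Suc show False by simp
    qed
  qed
  then have "Poly_Mapping.keys (sym (dg x) x) \<noteq> {}" by simp
  then show 3: "lj x \<in> Poly_Mapping.keys (sym (dg x) x)"
    unfolding lj_def by (intro Max_in) auto
  show "a (lj x) \<le> dg x" using 1 3 by (rule keys_sym)
qed

text \<open>The index \<open>lj\<close> may be negative, but at level k it is at least -k because e
  \<ge> 1. So \<open>lj x + dg x\<close> is a natural number, and for a fixed level a decrease of
  \<open>lj\<close> is well-founded.\<close>

lemma lj_bound: "a j \<le> k \<Longrightarrow> j + int k \<ge> 0"
proof (cases "j \<ge> 0")
  case False
  define l where "l = nat (- j)"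
  have j: "j = - int l" using False by (simp add: l_def)
  have "l * 1 \<le> l * e" using e_pos by (rule mult_le_mono2)
  moreover assume "a j \<le> k"
  ultimately have "l \<le> k" using a_minus [of l] unfolding j by linarith
  then show ?thesis by (simp add: j)
qed simp

text \<open>Buchberger-style reduction: \<open>B\<close> is chosen such that the leading exponents of its elements
  generate those of \<open>I\<close>, and the leading exponents are well ordered lexicographically.\<close>

theorem finite_generation:
  assumes act: "\<And>k l x y. x \<in> Fl k \<Longrightarrow> y \<in> Fl l \<Longrightarrow>
      act x y \<in> Fl (k + l) \<and> sym (k + l) (act x y) = sym k x * sym l y"
    and sub: "I \<subseteq> (\<Union>k. Fl k)"
    and diff: "\<And>x y. x \<in> I \<Longrightarrow> y \<in> I \<Longrightarrow> x - y \<in> I"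
    and mult: "\<And>z y k. z \<in> Fl k \<Longrightarrow> y \<in> I \<Longrightarrow> act z y \<in> I"
  obtains B where "finite B" "B \<subseteq> I"
    "\<And>J. B \<subseteq> J \<Longrightarrow> 0 \<in> J \<Longrightarrow> (\<And>x y. x \<in> J \<Longrightarrow> y \<in> J \<Longrightarrow> x + y \<in> J) \<Longrightarrow>
      (\<And>z y k. z \<in> Fl k \<Longrightarrow> y \<in> J \<Longrightarrow> act z y \<in> J) \<Longrightarrow> I \<subseteq> J"
proof -
  have "(\<lambda>x. (dg x, lj x)) ` (I - {0}) \<subseteq> {(k, j). a j \<le> k}"
    using sub leading(5) by fastforce
  then obtain E where E: "finite E" "E \<subseteq> (\<lambda>x. (dg x, lj x)) ` (I - {0})"
      "\<And>k j. (k, j) \<in> (\<lambda>x. (dg x, lj x)) ` (I - {0}) \<Longrightarrow> \<exists>(k', j')\<in>E. k' \<le> k \<and> a (j - j') \<le> k - k'"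
    by (rule dickson) blast
  from E(1,2) obtain B where B: "B \<subseteq> I - {0}" "finite B" "E = (\<lambda>x. (dg x, lj x)) ` B"
    by (meson finite_subset_image)
  have "x \<in> J" if J: "B \<subseteq> J" "0 \<in> J" "\<And>x y. x \<in> J \<Longrightarrow> y \<in> J \<Longrightarrow> x + y \<in> J"
      "\<And>z y k. z \<in> Fl k \<Longrightarrow> y \<in> J \<Longrightarrow> act z y \<in> J" and x: "x \<in> I" for x J
    using x
  proof (induction "(dg x, nat (lj x + int (dg x)))" arbitrary: x
      rule: wf_induct_rule [OF wf_lex_prod [OF wf_less_than wf_less_than]])
    case (1 x)
    show ?case
    proof (cases "x = 0")
      case True
      then show ?thesis using J(2) by simp
    next
      case False
      obtain k0 where "x \<in> Fl k0" using sub \<open>x \<in> I\<close> by blast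
      note lx = leading [OF this False]
      have "(dg x, lj x) \<in> (\<lambda>x. (dg x, lj x)) ` (I - {0})" using \<open>x \<in> I\<close> False by blast
      then obtain y where y: "y \<in> B" and le: "dg y \<le> dg x" "a (lj x - lj y) \<le> dg x - dg y"
        using E(3) [of "dg x" "lj x"] B(3) by auto
      have yI: "y \<in> I" "y \<noteq> 0" using y B(1) by auto
      obtain k1 where "y \<in> Fl k1" using sub yI by blast
      note ly = leading [OF this yI(2)]
      \<comment> \<open>The quotient of the leading coefficients. An element z with the single
        symbol coefficient c at \<open>lj x - lj y\<close> shifts the leading term of y onto that of
        x; the choice of y makes this index available at level \<open>dg x - dg y\<close>.\<close>
      define c where "c = Poly_Mapping.lookup (sym (dg x) x) (lj x) / Poly_Mapping.lookup (sym (dg y) y) (lj y)"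
      obtain z where z: "z \<in> Fl (dg x - dg y)" "sym (dg x - dg y) z = Poly_Mapping.single (lj x - lj y) c"
        using sym_single [OF le(2), of c] by blast
      have zy: "act z y \<in> Fl (dg x)" "sym (dg x) (act z y) = Poly_Mapping.single (lj x - lj y) c * sym (dg y) y"
        using act [OF z(1) ly(1)] z(2) le(1) by auto
      define w where "w = x - act z y"
      have wI: "w \<in> I" unfolding w_def using \<open>x \<in> I\<close> yI(1) z(1) diff mult by blast
      have wF: "w \<in> Fl (dg x)" unfolding w_def using lx(1) zy(1) by (rule Fl_diff)
      have look: "Poly_Mapping.lookup (sym (dg x) w) i
          = Poly_Mapping.lookup (sym (dg x) x) i - c * Poly_Mapping.lookup (sym (dg y) y) (i - (lj x - lj y))" for i
        unfolding w_def using lx(1) zy by (simp add: sym_diff lookup_minus lookup_single_times_int)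
      have top: "Poly_Mapping.lookup (sym (dg x) x) i = 0" if "i > lj x" for i
        using that unfolding lj_def by (metis Max_ge finite_keys in_keys_iff not_le)
      have top': "Poly_Mapping.lookup (sym (dg y) y) i = 0" if "i > lj y" for i
        using that unfolding lj_def by (metis Max_ge finite_keys in_keys_iff not_le)
      have "w \<in> J"
      proof (cases "w = 0")
        case True
        then show ?thesis using J(2) by simp
      next
        case wnz: False
        note lw = leading [OF wF wnz]
        have "dg w < dg x \<or> dg w = dg x \<and> lj w < lj x"
        proof (rule ccontr)
          assume "\<not> ?thesis"
          then have eq: "dg w = dg x" "lj w \<ge> lj x" using lw(2) by auto
          have "Poly_Mapping.lookup (sym (dg x) w) (lj w) = 0"
          proof (cases "lj w = lj x")
            case True
            then show ?thesis using ly(4) by (simp add: look c_def in_keys_iff)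
          next
            case False
            then have "lj w > lj x" using eq by simp
            then show ?thesis by (simp add: look top top')
          qed
          with lw(4) eq(1) show False by (simp add: in_keys_iff)
        qed
        then have "((dg w, nat (lj w + int (dg w))), (dg x, nat (lj x + int (dg x)))) \<in> less_than <*lex*> less_than"
          using lj_bound [OF lw(5)] by auto
        then show ?thesis using "1.hyps" wI by blast
      qed
      moreover have "act z y \<in> J" using J(1,4) z(1) y by blast
      ultimately have "w + act z y \<in> J" by (rule J(3))
      then show ?thesis by (simp add: w_def)
    qed
  qed
  with B(1,2) show ?thesis using that [of B] by blast
qed

end

section \<open>Algebras represented by subrings of a type\<close>

text \<open>Transfers computations in a subring S of a type to the record M along a bijection h from
  S onto the carrier. For N(u) the map h is the identity, for the graded algebra it sends a model
  element to a family of cosets.\<close>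

locale represented_algebra =
  fixes S :: "'a::ring_1 set" and sm :: "'k::field \<Rightarrow> 'a \<Rightarrow> 'a" and h :: "'a \<Rightarrow> 'b"
    and M :: "('k, 'b) module" (structure)
  assumes S_1: "1 \<in> S" and S_add: "x \<in> S \<Longrightarrow> y \<in> S \<Longrightarrow> x + y \<in> S"
    and S_uminus: "x \<in> S \<Longrightarrow> - x \<in> S" and S_mult: "x \<in> S \<Longrightarrow> y \<in> S \<Longrightarrow> x * y \<in> S"
    and S_sm: "x \<in> S \<Longrightarrow> sm c x \<in> S"
    and sm_add: "sm c (x + y) = sm c x + sm c y" and sm_add': "sm (c + d) x = sm c x + sm d x"
    and sm_mult: "sm (c * d) x = sm c (sm d x)" and sm_1: "sm 1 x = x"
    and sm_mult_left: "sm c x * y = sm c (x * y)" and sm_mult_right: "x * sm c y = sm c (x * y)"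
    and inj: "inj_on h S" and carrier: "carrier M = h ` S"
    and h_mult: "x \<in> S \<Longrightarrow> y \<in> S \<Longrightarrow> h x \<otimes> h y = h (x * y)"
    and h_add: "x \<in> S \<Longrightarrow> y \<in> S \<Longrightarrow> h x \<oplus> h y = h (x + y)"
    and h_1: "\<one> = h 1" and h_0: "\<zero> = h 0"
    and h_sm: "x \<in> S \<Longrightarrow> c \<odot> h x = h (sm c x)"
begin

lemma S_0: "0 \<in> S"
  using S_add [OF S_1 S_uminus [OF S_1]] by simp

lemma S_diff: "x \<in> S \<Longrightarrow> y \<in> S \<Longrightarrow> x - y \<in> S"
  using S_add [OF _ S_uminus, of x y] by simp

lemma S_sum: "(\<And>i. i \<in> A \<Longrightarrow> f i \<in> S) \<Longrightarrow> sum f A \<in> S"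
  by (induction A rule: infinite_finite_induct) (auto simp: S_0 S_add)

lemmas S_closed = S_0 S_1 S_add S_uminus S_mult S_sm S_diff
lemmas h_simps = h_mult h_add h_1 h_0 h_sm

lemma abelian_group: "abelian_group M"
proof (rule abelian_groupI)
  fix x assume "x \<in> carrier M"
  then obtain y where "x = h y" "y \<in> S" by (auto simp: carrier)
  then have "h (- y) \<in> carrier M \<and> h (- y) \<oplus> x = \<zero>"
    by (auto simp: carrier h_simps S_closed)
  then show "\<exists>y\<in>carrier M. y \<oplus> x = \<zero>" by blast
qed (auto simp: carrier h_simps S_closed add_ac)

lemma ring: "ring M"
proof (rule ringI)
  show "Group.monoid M"
    by (rule monoidI) (auto simp: carrier h_simps S_closed mult.assoc)
qed (auto simp: abelian_group carrier h_simps S_closed distrib_left distrib_right)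

lemma cring:
  assumes "\<And>x y. x \<in> S \<Longrightarrow> y \<in> S \<Longrightarrow> x * y = y * x"
  shows "cring M"
proof (rule cringI)
  have "Group.monoid M" using ring by (simp add: ring_def)
  then show "comm_monoid M"
    by (rule monoid.monoid_comm_monoidI) (auto simp: carrier h_simps S_closed assms)
qed (auto simp: abelian_group carrier h_simps S_closed distrib_right)

lemma module: "module (ring_of_type_algebra :: 'k ring) M"
proof (rule moduleI)
  show "cring (ring_of_type_algebra :: 'k ring)" by (rule cring_from_type_algebra)
qed (auto simp: abelian_group carrier h_simps S_closed ring_of_type_algebra_def sm_add sm_add' sm_mult sm_1)

lemma assoc_algebra: "assoc_algebra (ring_of_type_algebra :: 'k ring) M"
  unfolding assoc_algebra_def
  by (auto simp: module ring carrier h_simps S_closed sm_mult_left sm_mult_right)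

lemma algebra:
  assumes "\<And>x y. x \<in> S \<Longrightarrow> y \<in> S \<Longrightarrow> x * y = y * x"
  shows "algebra (ring_of_type_algebra :: 'k ring) M"
proof (rule algebraI)
  show "cring (ring_of_type_algebra :: 'k ring)" by (rule cring_from_type_algebra)
  show "cring M" using assms by (rule cring)
qed (auto simp: carrier h_simps S_closed ring_of_type_algebra_def sm_add sm_add' sm_mult sm_1 sm_mult_left)

lemma h_uminus: "x \<in> S \<Longrightarrow> \<ominus> h x = h (- x)"
  using abelian_group.minus_equality [OF abelian_group, of "h (- x)" "h x"]
  by (simp add: carrier h_simps S_closed)

lemma affine_algebra:
  assumes "finite E" "E \<subseteq> S"
    and gen: "\<And>T. E \<subseteq> T \<Longrightarrow> 1 \<in> T \<Longrightarrow> (\<And>x y. x \<in> T \<Longrightarrow> y \<in> T \<Longrightarrow> x + y \<in> T) \<Longrightarrow>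
      (\<And>x y. x \<in> T \<Longrightarrow> y \<in> T \<Longrightarrow> x * y \<in> T) \<Longrightarrow> (\<And>c x. x \<in> T \<Longrightarrow> sm c x \<in> T) \<Longrightarrow> S \<subseteq> T"
  shows "affine_algebra M"
proof -
  let ?H = "range (\<lambda>c. c \<odot> \<one>) \<union> h ` E"
  define G where "G = generate_ring M ?H"
  have H: "?H \<subseteq> carrier M"
    using assms(2) by (auto simp: carrier h_1 h_sm S_1 S_sm)
  have sub: "G \<subseteq> carrier M"
    unfolding G_def using ring.generate_ring_in_carrier [OF ring H] by blast
  define T where "T = {x \<in> S. h x \<in> G}"
  have "S \<subseteq> T"
  proof (rule gen)
    show "E \<subseteq> T" using assms(2) by (auto simp: T_def G_def intro: generate_ring.incl)
    show "1 \<in> T" using generate_ring.one [of M ?H] by (simp add: T_def G_def S_1 h_1)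
    show "x + y \<in> T" if "x \<in> T" "y \<in> T" for x y
      using that generate_ring.eng_add [of "h x" M ?H "h y"] by (simp add: T_def G_def S_add h_add)
    show *: "x * y \<in> T" if "x \<in> T" "y \<in> T" for x y
      using that generate_ring.eng_mult [of "h x" M ?H "h y"] by (simp add: T_def G_def S_mult h_mult)
    show "sm c x \<in> T" if x: "x \<in> T" for c x
    proof -
      have "c \<odot> \<one> \<in> G" unfolding G_def by (intro generate_ring.incl) blast
      then have "sm c 1 \<in> T" by (simp add: T_def h_1 h_sm S_1 S_sm)
      from * [OF this x] show ?thesis by (simp add: sm_mult_left)
    qed
  qed
  then have "G = carrier M" using sub by (auto simp: T_def carrier)
  moreover have "finite (h ` E)" "h ` E \<subseteq> carrier M" using assms(1,2) by (auto simp: carrier)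
  ultimately show ?thesis unfolding affine_algebra_def G_def by blast
qed

lemma finsum_eq:
  assumes "finite A" "e ` A \<subseteq> S" "\<And>j. j \<in> A \<Longrightarrow> f j = h (e j)"
  shows "finsum M (\<lambda>j. c j \<odot> f j) A = h (\<Sum>j\<in>A. sm (c j) (e j))"
  using assms
proof (induction A)
  case empty
  then show ?case by (simp add: abelian_monoid.finsum_empty abelian_group.axioms(1) abelian_group h_0)
next
  case (insert x A)
  interpret abelian_group M by (rule abelian_group)
  have "(\<Sum>j\<in>A. sm (c j) (e j)) \<in> S" using insert by (intro S_sum S_sm) auto
  then show ?case using insert
    by (subst finsum_insert) (auto simp: carrier h_sm h_add S_sm Pi_def image_subset_iff)
qed

text \<open>The theorem indexes its basis by the elements themselves, whereas computations use pairs
  of exponents; \<open>g\<close> is the injection from exponents to elements that mediates.\<close>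

lemma family_basisI:
  assumes J: "e ` J \<subseteq> S" "inj_on g J" "\<And>j. j \<in> J \<Longrightarrow> f (g j) = h (e j)"
    and indep: "\<And>A c. finite A \<Longrightarrow> A \<subseteq> J \<Longrightarrow> (\<Sum>j\<in>A. sm (c j) (e j)) = 0 \<Longrightarrow> \<forall>j\<in>A. c j = 0"
    and span: "\<And>x. x \<in> S \<Longrightarrow> \<exists>A c. finite A \<and> A \<subseteq> J \<and> x = (\<Sum>j\<in>A. sm (c j) (e j))"
  shows "family_basis M (g ` J) f"
proof -
  define e' where "e' x = e (inv_into J g x)" for x
  have e': "e' (g j) = e j" if "j \<in> J" for j
    using that J(2) by (simp add: e'_def inv_into_f_f)
  have S': "e' ` A \<subseteq> S" if "A \<subseteq> g ` J" for A
    using that J(1) e' by fastforce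
  have f: "f x = h (e' x)" if "x \<in> g ` J" for x
    using that J(3) e' by auto
  have sum: "(\<Sum>x\<in>g ` A. sm (c x) (e' x)) = (\<Sum>j\<in>A. sm (c (g j)) (e j))" if "A \<subseteq> J" for A c
    using that J(2) e' by (subst sum.reindex) (auto intro: inj_on_subset intro!: sum.cong)
  have finsum: "finsum M (\<lambda>x. c x \<odot> f x) (g ` A) = h (\<Sum>j\<in>A. sm (c (g j)) (e j))"
    if "finite A" "A \<subseteq> J" for A c
    using that S' [of "g ` A"] f by (subst finsum_eq [where e = e']) (auto simp: sum)
  show ?thesis
    unfolding family_basis_def
  proof (intro conjI allI impI ballI)
    show "f ` (g ` J) \<subseteq> carrier M" using J(1,3) by (auto simp: carrier)
  next
    fix B c x assume *: "finite B \<and> B \<subseteq> g ` J \<and> finsum M (\<lambda>x. c x \<odot> f x) B = \<zero>" and x: "x \<in> B"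
    then obtain A where A: "A \<subseteq> J" "finite A" "B = g ` A" by (meson finite_subset_image)
    then have "h (\<Sum>j\<in>A. sm (c (g j)) (e j)) = h 0" using * finsum [of A c] by (simp add: h_0)
    moreover have "(\<Sum>j\<in>A. sm (c (g j)) (e j)) \<in> S" using A J(1) by (intro S_sum S_sm) auto
    ultimately have "(\<Sum>j\<in>A. sm (c (g j)) (e j)) = 0" using inj S_0 by (auto dest: inj_onD)
    then have "\<forall>j\<in>A. c (g j) = 0" by (rule indep [OF A(2,1)])
    then show "c x = 0" using x A(3) by auto
  next
    fix y assume "y \<in> carrier M"
    then obtain x where x: "x \<in> S" "y = h x" by (auto simp: carrier)
    then obtain A c where A: "finite A" "A \<subseteq> J" "x = (\<Sum>j\<in>A. sm (c j) (e j))" using span by blast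
    define c' where "c' x = c (inv_into J g x)" for x
    have "x = (\<Sum>j\<in>A. sm (c' (g j)) (e j))"
      unfolding A(3) using A(2) J(2) by (intro sum.cong) (auto simp: c'_def inv_into_f_f subset_iff)
    then have "y = finsum M (\<lambda>x. c' x \<odot> f x) (g ` A)"
      using x(2) finsum [OF A(1,2)] by simp
    moreover have "finite (g ` A)" "g ` A \<subseteq> g ` J" using A(1,2) by auto
    ultimately show "\<exists>B c. finite B \<and> B \<subseteq> g ` J \<and> y = finsum M (\<lambda>j. c j \<odot> f j) B" by blast
  qed
qed

definition preim where "preim I = {x \<in> S. h x \<in> I}"

lemma h_preim: "I \<subseteq> carrier M \<Longrightarrow> h ` preim I = I"
  by (auto simp: preim_def carrier)

lemma additive_subgroup_preim:
  assumes "additive_subgroup I M"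
  shows "I \<subseteq> carrier M" "0 \<in> preim I" "x \<in> preim I \<Longrightarrow> y \<in> preim I \<Longrightarrow> x + y \<in> preim I"
    "x \<in> preim I \<Longrightarrow> y \<in> preim I \<Longrightarrow> x - y \<in> preim I"
proof -
  interpret additive_subgroup I M by fact
  show "I \<subseteq> carrier M" by (rule a_subset)
  show "0 \<in> preim I" using zero_closed by (simp add: preim_def S_0 h_0)
  show add: "x + y \<in> preim I" if "x \<in> preim I" "y \<in> preim I" for x y
    using that a_closed [of "h x" "h y"] by (simp add: preim_def S_add h_add)
  have "- y \<in> preim I" if "y \<in> preim I" for y
    using that a_inv_closed [of "h y"] by (simp add: preim_def S_uminus h_uminus)
  then show "x - y \<in> preim I" if "x \<in> preim I" "y \<in> preim I" for x y
    using add [of x "- y"] that by simp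
qed

text \<open>Here \<open>act z y\<close> is z times y or y times z, which covers left and right
  ideals at once. Generation by B is expressed through all sets J containing B that are closed under
  addition and under \<open>act\<close>.\<close>

definition fin_gen where
  "fin_gen act \<longleftrightarrow> (\<forall>I\<subseteq>S. 0 \<in> I \<longrightarrow> (\<forall>x\<in>I. \<forall>y\<in>I. x - y \<in> I) \<longrightarrow> (\<forall>z\<in>S. \<forall>y\<in>I. act z y \<in> I) \<longrightarrow>
    (\<exists>B\<subseteq>I. finite B \<and> (\<forall>J. B \<subseteq> J \<longrightarrow> 0 \<in> J \<longrightarrow> (\<forall>x\<in>J. \<forall>y\<in>J. x + y \<in> J) \<longrightarrow>
      (\<forall>z\<in>S. \<forall>y\<in>J. act z y \<in> J) \<longrightarrow> I \<subseteq> J)))"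

text \<open>\<open>P\<close> is the kind of ideal considered. Each ideal of that kind pulls back to
  a set closed under \<open>act\<close>, so the generators of the preimage of I already force I into
  every ideal of kind \<open>P\<close> that contains their images.\<close>

lemma fin_gen_ideals:
  assumes "fin_gen act" "P I"
    and ideal: "\<And>I. P I \<Longrightarrow> additive_subgroup I M"
      "\<And>I z y. P I \<Longrightarrow> z \<in> S \<Longrightarrow> y \<in> preim I \<Longrightarrow> act z y \<in> preim I"
  shows "\<exists>A\<subseteq>carrier M. finite A \<and> I = \<Inter>{J. P J \<and> A \<subseteq> J}"
proof -
  note I = additive_subgroup_preim [OF ideal(1) [OF assms(2)]]
  have "preim I \<subseteq> S" by (auto simp: preim_def)
  then obtain B where B: "B \<subseteq> preim I" "finite B"
      "\<forall>J. B \<subseteq> J \<longrightarrow> 0 \<in> J \<longrightarrow> (\<forall>x\<in>J. \<forall>y\<in>J. x + y \<in> J) \<longrightarrow>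
        (\<forall>z\<in>S. \<forall>y\<in>J. act z y \<in> J) \<longrightarrow> preim I \<subseteq> J"
    using assms(1) [unfolded fin_gen_def, rule_format, OF _ I(2) I(4) ideal(2) [OF assms(2)]] by blast
  have "I \<subseteq> J" if J: "P J" "h ` B \<subseteq> J" for J
  proof -
    note pJ = additive_subgroup_preim [OF ideal(1) [OF J(1)]]
    have "B \<subseteq> preim J" using J(2) B(1) by (auto simp: preim_def)
    then have "preim I \<subseteq> preim J"
      by (rule B(3) [rule_format, OF _ pJ(2) pJ(3) ideal(2) [OF J(1)]])
    then have "h ` preim I \<subseteq> h ` preim J" by blast
    then show ?thesis using h_preim I(1) pJ(1) by simp
  qed
  moreover have hB: "h ` B \<subseteq> I" using B(1) by (auto simp: preim_def)
  ultimately have "I = \<Inter>{J. P J \<and> h ` B \<subseteq> J}" using assms(2) by blast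
  moreover have "h ` B \<subseteq> carrier M" "finite (h ` B)" using hB I(1) B(2) by auto
  ultimately show ?thesis by blast
qed

lemma left_noetherian:
  assumes "fin_gen (*)"
  shows "left_noetherian M"
  unfolding left_noetherian_def
proof (intro conjI allI impI)
  fix I assume I: "left_ideal I M"
  show "\<exists>A\<subseteq>carrier M. finite A \<and> I = \<Inter>{J. left_ideal J M \<and> A \<subseteq> J}"
  proof (rule fin_gen_ideals [where P = "\<lambda>I. left_ideal I M", OF assms I])
    fix I z y assume "left_ideal I M" "z \<in> S" "y \<in> preim I"
    then have "h z \<otimes> h y \<in> I" by (auto simp: left_ideal_def preim_def carrier)
    with \<open>z \<in> S\<close> \<open>y \<in> preim I\<close> show "z * y \<in> preim I" by (simp add: preim_def S_mult h_mult)
  qed (simp add: left_ideal_def)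
qed (rule ring)

lemma right_noetherian:
  assumes "fin_gen (\<lambda>z y. y * z)"
  shows "right_noetherian M"
  unfolding right_noetherian_def
proof (intro conjI allI impI)
  fix I assume I: "right_ideal I M"
  show "\<exists>A\<subseteq>carrier M. finite A \<and> I = \<Inter>{J. right_ideal J M \<and> A \<subseteq> J}"
  proof (rule fin_gen_ideals [where P = "\<lambda>I. right_ideal I M", OF assms I])
    fix I z y assume "right_ideal I M" "z \<in> S" "y \<in> preim I"
    then have "h y \<otimes> h z \<in> I" by (auto simp: right_ideal_def preim_def carrier)
    with \<open>z \<in> S\<close> \<open>y \<in> preim I\<close> show "y * z \<in> preim I" by (simp add: preim_def S_mult h_mult)
  qed (simp add: right_ideal_def)
qed (rule ring)

lemma noetherian_ring:
  assumes "fin_gen (*)"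
  shows "noetherian_ring M"
proof (rule ring.noetherian_ringI [OF ring])
  fix I assume I: "ideal I M"
  show "\<exists>A\<subseteq>carrier M. finite A \<and> I = genideal M A"
    unfolding genideal_def
  proof (rule fin_gen_ideals [where P = "\<lambda>I. ideal I M", OF assms I])
    fix I z y assume "ideal I M" "z \<in> S" "y \<in> preim I"
    then have "h z \<otimes> h y \<in> I" by (auto simp: ideal.I_l_closed preim_def carrier)
    with \<open>z \<in> S\<close> \<open>y \<in> preim I\<close> show "z * y \<in> preim I" by (simp add: preim_def S_mult h_mult)
  qed (simp add: ideal.axioms)
qed

end

lemma coeff_mult_top:
  fixes p q :: "'r::comm_semiring_0 poly"
  assumes "degree p \<le> k" "degree q \<le> l"
  shows "coeff (p * q) (k + l) = coeff p k * coeff q l"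
proof -
  have "coeff (p * q) (k + l)
      = (\<Sum>i\<le>k + l. coeff p i * coeff q (k + l - i))"
    by (rule coeff_mult)
  also have "\<dots> = (\<Sum>i\<in>{k}. coeff p i * coeff q (k + l - i))"
  proof (rule sum.mono_neutral_right)
    show "\<forall>i\<in>{..k + l} - {k}. coeff p i * coeff q (k + l - i) = 0"
    proof
      fix i assume i: "i \<in> {..k + l} - {k}"
      show "coeff p i * coeff q (k + l - i) = 0"
      proof (cases "i < k")
        case True
        then have "coeff q (k + l - i) = 0" using assms(2) by (intro coeff_eq_0) auto
        then show ?thesis by simp
      next
        case False
        then have "coeff p i = 0" using assms(1) i by (intro coeff_eq_0) auto
        then show ?thesis by simp
      qed
    qed
  qed auto
  finally show ?thesis by simp
qed

lemma poly_mapping_sum_single: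
  fixes f :: "'i \<Rightarrow>\<^sub>0 'k::comm_monoid_add"
  shows "f = (\<Sum>j\<in>Poly_Mapping.keys f. Poly_Mapping.single j (Poly_Mapping.lookup f j))"
proof (rule poly_mapping_eqI)
  fix i
  have "(\<Sum>j\<in>Poly_Mapping.keys f. Poly_Mapping.lookup (Poly_Mapping.single j (Poly_Mapping.lookup f j)) i)
      = (\<Sum>j\<in>Poly_Mapping.keys f. if i = j then Poly_Mapping.lookup f j else 0)"
    by (intro sum.cong) (auto simp: lookup_single when_def)
  also have "\<dots> = Poly_Mapping.lookup f i"
    by (subst sum.delta') (auto simp: in_keys_iff)
  finally show "Poly_Mapping.lookup f i
      = Poly_Mapping.lookup (\<Sum>j\<in>Poly_Mapping.keys f. Poly_Mapping.single j (Poly_Mapping.lookup f j)) i"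
    by (simp add: lookup_sum)
qed

context homogeneous
begin

section \<open>Symbols of nilpotent elements\<close>

abbreviation N where "N k \<equiv> nil_filt u (int k)"

text \<open>The left coefficient p_j in x = \<Sum> p_j v^j; for elements of the filtration it exists
  as a polynomial.\<close>

definition pc where "pc x j = (THE p. coord x (j * t) = to_fract p * \<nu> j)"

lemma pc_eqI: "coord x (j * t) = to_fract p * \<nu> j \<Longrightarrow> pc x j = p"
  unfolding pc_def by (rule the_equality) simp_all

lemma N_iff:
  "x \<in> N k \<longleftrightarrow> (\<forall>l. \<not> t dvd l \<longrightarrow> coord x l = 0) \<and>
     (\<forall>j. coord x (j * t) = to_fract (pc x j) * \<nu> j \<and> d j dvd pc x j \<and> degree (pc x j) \<le> k)"
proof
  assume x: "x \<in> N k"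
  have "coord x (j * t) = to_fract (pc x j) * \<nu> j \<and> d j dvd pc x j \<and> degree (pc x j) \<le> k" for j
  proof -
    have "\<forall>j. \<exists>h. coord x (j * t) = to_fract (h * d j) * \<nu> j \<and> degree (h * d j) \<le> k"
      using x unfolding nil_filt_eq by simp
    then obtain h where h: "coord x (j * t) = to_fract (h * d j) * \<nu> j" "degree (h * d j) \<le> k"
      by metis
    from pc_eqI [OF h(1)] h show ?thesis by simp
  qed
  moreover have "\<forall>l. \<not> t dvd l \<longrightarrow> coord x l = 0" using x unfolding nil_filt_eq by simp
  ultimately show "(\<forall>l. \<not> t dvd l \<longrightarrow> coord x l = 0) \<and>
     (\<forall>j. coord x (j * t) = to_fract (pc x j) * \<nu> j \<and> d j dvd pc x j \<and> degree (pc x j) \<le> k)"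
    by simp
next
  assume x: "(\<forall>l. \<not> t dvd l \<longrightarrow> coord x l = 0) \<and>
     (\<forall>j. coord x (j * t) = to_fract (pc x j) * \<nu> j \<and> d j dvd pc x j \<and> degree (pc x j) \<le> k)"
  have "\<exists>h. coord x (j * t) = to_fract (h * d j) * \<nu> j \<and> degree (h * d j) \<le> k" for j
  proof -
    have "d j dvd pc x j" using x by simp
    then obtain h where "pc x j = h * d j" by (auto elim: dvdE simp: mult.commute)
    with x show ?thesis by metis
  qed
  with x show "x \<in> N k" unfolding nil_filt_eq by simp
qed

lemma N_coord: "x \<in> N k \<Longrightarrow> coord x (j * t) = to_fract (pc x j) * \<nu> j"
  and N_dvd: "x \<in> N k \<Longrightarrow> d j dvd pc x j"
  and N_degree: "x \<in> N k \<Longrightarrow> degree (pc x j) \<le> k"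
  and N_zero: "x \<in> N k \<Longrightarrow> \<not> t dvd l \<Longrightarrow> coord x l = 0"
  by (simp_all add: N_iff)

lemma N_I:
  assumes "\<And>l. \<not> t dvd l \<Longrightarrow> coord x l = 0"
    and "\<And>j. coord x (j * t) = to_fract (p j) * \<nu> j" "\<And>j. d j dvd p j"
    "\<And>j. degree (p j) \<le> k"
  shows "x \<in> N k" "pc x j = p j"
proof -
  show pc: "pc x j = p j" for j using assms(2) by (rule pc_eqI)
  show "x \<in> N k" unfolding N_iff pc using assms by simp
qed

lemma N_mono: "x \<in> N k \<Longrightarrow> k \<le> l \<Longrightarrow> x \<in> N l"
  unfolding N_iff by (meson order_trans)

lemma N_diff: "x \<in> N k \<Longrightarrow> y \<in> N k \<Longrightarrow> x - y \<in> N k"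
  and pc_diff: "x \<in> N k \<Longrightarrow> y \<in> N k \<Longrightarrow> pc (x - y) j = pc x j - pc y j"
proof -
  assume "x \<in> N k" "y \<in> N k"
  note * = N_I [where x = "x - y" and p = "\<lambda>j. pc x j - pc y j" and k = k]
    N_coord [OF \<open>x \<in> N k\<close>] N_coord [OF \<open>y \<in> N k\<close>] N_dvd [OF \<open>x \<in> N k\<close>] N_dvd [OF \<open>y \<in> N k\<close>]
    N_degree [OF \<open>x \<in> N k\<close>] N_degree [OF \<open>y \<in> N k\<close>] N_zero [OF \<open>x \<in> N k\<close>] N_zero [OF \<open>y \<in> N k\<close>]
  show "x - y \<in> N k" "pc (x - y) j = pc x j - pc y j"
    by (rule *(1,2); simp add: *(3-) left_diff_distrib dvd_diff degree_diff_le)+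
qed

lemma N_add: "x \<in> N k \<Longrightarrow> y \<in> N k \<Longrightarrow> x + y \<in> N k"
  and pc_add: "x \<in> N k \<Longrightarrow> y \<in> N k \<Longrightarrow> pc (x + y) j = pc x j + pc y j"
proof -
  assume "x \<in> N k" "y \<in> N k"
  note * = N_I [where x = "x + y" and p = "\<lambda>j. pc x j + pc y j" and k = k]
    N_coord [OF \<open>x \<in> N k\<close>] N_coord [OF \<open>y \<in> N k\<close>] N_dvd [OF \<open>x \<in> N k\<close>] N_dvd [OF \<open>y \<in> N k\<close>]
    N_degree [OF \<open>x \<in> N k\<close>] N_degree [OF \<open>y \<in> N k\<close>] N_zero [OF \<open>x \<in> N k\<close>] N_zero [OF \<open>y \<in> N k\<close>]
  show "x + y \<in> N k" "pc (x + y) j = pc x j + pc y j"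
    by (rule *(1,2); simp add: *(3-) distrib_right dvd_add degree_add_le)+
qed

lemma N_scal: "x \<in> N k \<Longrightarrow> scal c x \<in> N k"
  and pc_scal: "x \<in> N k \<Longrightarrow> pc (scal c x) j = smult c (pc x j)"
proof -
  assume "x \<in> N k"
  have "to_fract [:c:] * f = to_fract (smult c p) * g" if "f = to_fract p * g" for f p and g :: "'k poly fract"
    using that to_fract_mult [of "[:c:]" p] by (simp add: mult.assoc)
  note * = N_I [where x = "scal c x" and p = "\<lambda>j. smult c (pc x j)" and k = k]
    this N_coord [OF \<open>x \<in> N k\<close>] N_dvd [OF \<open>x \<in> N k\<close>] N_degree [OF \<open>x \<in> N k\<close>] N_zero [OF \<open>x \<in> N k\<close>]
  show "scal c x \<in> N k" "pc (scal c x) j = smult c (pc x j)"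
    by (rule *(1,2); simp add: *(3-) coord_scal dvd_smult degree_smult_le [THEN order_trans])+
qed

lemma N_poly_v:
  assumes "d i dvd p" "degree p \<le> k"
  shows "of_poly p * v powi i \<in> N k" "pc (of_poly p * v powi i) j = (if j = i then p else 0)"
proof -
  note * = N_I [where x = "of_poly p * v powi i" and p = "\<lambda>j. if j = i then p else 0" and k = k]
  show "of_poly p * v powi i \<in> N k" "pc (of_poly p * v powi i) j = (if j = i then p else 0)"
    by (rule *(1,2); use assms t_nz in \<open>auto simp: v_powi_eq of_poly_eq coord_monom\<close>)+
qed

lemma zero_in_N [simp]: "0 \<in> N k"
  and pc_0 [simp]: "pc 0 j = 0"
  using N_poly_v(1) [of 0 0 k] N_poly_v(2) [of 0 0 k j] by (auto split: if_splits)

lemma one_in_N: "1 \<in> N k" and pc_1: "pc 1 j = (if j = 0 then 1 else 0)"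
  using N_poly_v(1) [of 0 1 k] N_poly_v(2) [of 0 1 k j] by simp_all

lemma N_sum: "(\<And>i. i \<in> A \<Longrightarrow> f i \<in> N k) \<Longrightarrow> sum f A \<in> N k"
  and pc_sum: "(\<And>i. i \<in> A \<Longrightarrow> f i \<in> N k) \<Longrightarrow> pc (sum f A) j = (\<Sum>i\<in>A. pc (f i) j)"
proof -
  have "(\<forall>i\<in>A. f i \<in> N k) \<longrightarrow> sum f A \<in> N k \<and> pc (sum f A) j = (\<Sum>i\<in>A. pc (f i) j)"
  proof (induction A rule: infinite_finite_induct)
    case (insert x A)
    then show ?case using N_add [of "f x" k "sum f A"] pc_add [of "f x" k "sum f A"] by simp
  qed simp_all
  then show "(\<And>i. i \<in> A \<Longrightarrow> f i \<in> N k) \<Longrightarrow> sum f A \<in> N k"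
    "(\<And>i. i \<in> A \<Longrightarrow> f i \<in> N k) \<Longrightarrow> pc (sum f A) j = (\<Sum>i\<in>A. pc (f i) j)" by simp_all
qed

lemma N_eqI:
  assumes "x \<in> N k" "y \<in> N l" "\<And>j. pc x j = pc y j"
  shows "x = y"
proof (rule skew_eqI)
  fix i
  show "coord x i = coord y i"
  proof (cases "t dvd i")
    case True
    then obtain j where "i = j * t" by (rule t_dvdE)
    then show ?thesis using N_coord [OF assms(1)] N_coord [OF assms(2)] assms(3) by simp
  next
    case False
    then show ?thesis using N_zero [OF assms(1)] N_zero [OF assms(2)] by simp
  qed
qed

lemma finite_pc: "x \<in> N k \<Longrightarrow> finite {j. pc x j \<noteq> 0}"
proof -
  assume x: "x \<in> N k"
  have "finite ((\<lambda>j. j * t) -` {l. coord x l \<noteq> 0})"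
    by (rule finite_vimageI) (use t_nz in \<open>auto simp: inj_def\<close>)
  moreover have "{j. pc x j \<noteq> 0} \<subseteq> (\<lambda>j. j * t) -` {l. coord x l \<noteq> 0}"
    using N_coord [OF x] by auto
  ultimately show ?thesis by (rule finite_subset [rotated])
qed

lemma N_decompose:
  assumes "x \<in> N k"
  shows "x = (\<Sum>j | pc x j \<noteq> 0. of_poly (pc x j) * v powi j)"
proof (rule N_eqI [OF assms])
  have *: "of_poly (pc x j) * v powi j \<in> N k" for j
    using assms by (intro N_poly_v N_dvd N_degree)
  then show "(\<Sum>j | pc x j \<noteq> 0. of_poly (pc x j) * v powi j) \<in> N k" by (intro N_sum)
  fix i
  have "pc (\<Sum>j | pc x j \<noteq> 0. of_poly (pc x j) * v powi j) i
      = (\<Sum>j | pc x j \<noteq> 0. if i = j then pc x j else 0)"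
    using * N_poly_v(2) [OF N_dvd [OF assms] N_degree [OF assms]] by (subst pc_sum) simp_all
  also have "\<dots> = pc x i"
    using finite_pc [OF assms] by (subst sum.delta') auto
  finally show "pc x i = pc (\<Sum>j | pc x j \<noteq> 0. of_poly (pc x j) * v powi j) i" by simp
qed

text \<open>Translations preserve degrees, so degrees at most add up. Divisibility by the
  denominators is not computed: it follows from closure of A_1 under products.\<close>

lemma N_mult:
  assumes x: "x \<in> N k" and y: "y \<in> N l"
  shows "x * y \<in> N (k + l)"
    "pc (x * y) j = (\<Sum>i | pc x i \<noteq> 0. pc x i * poly_translate (i * t) (pc y (j - i)))"
proof -
  let ?A = "{i. pc x i \<noteq> 0}"
  let ?p = "\<lambda>j. \<Sum>i\<in>?A. pc x i * poly_translate (i * t) (pc y (j - i))"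
  have inj: "inj_on (\<lambda>i. i * t) ?A" using t_nz by (auto simp: inj_on_def)
  have sub: "{l. coord x l \<noteq> 0} \<subseteq> (\<lambda>i. i * t) ` ?A"
  proof
    fix l assume l: "l \<in> {l. coord x l \<noteq> 0}"
    then have "t dvd l" using N_zero [OF x] by auto
    then obtain i where i: "l = i * t" by (rule t_dvdE)
    with l N_coord [OF x] show "l \<in> (\<lambda>i. i * t) ` ?A" by auto
  qed
  have coord: "coord (x * y) r = (\<Sum>i\<in>?A. coord x (i * t) * sigma (i * t) (coord y (r - i * t)))" for r
    by (subst coord_mult [OF _ sub]) (use finite_pc [OF x] inj in \<open>simp_all add: sum.reindex\<close>)
  have 1: "coord (x * y) r = 0" if "\<not> t dvd r" for r
  proof -
    have "\<not> t dvd r - i * t" for i using that by (metis dvd_add_right_iff dvd_triv_right diff_add_cancel add.commute)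
    then show ?thesis unfolding coord by (simp add: N_zero [OF y])
  qed
  have 2: "coord (x * y) (j * t) = to_fract (?p j) * \<nu> j" for j
  proof -
    have "coord x (i * t) * sigma (i * t) (coord y (j * t - i * t))
        = to_fract (pc x i * poly_translate (i * t) (pc y (j - i))) * \<nu> j" for i
      using N_coord [OF x, of i] N_coord [OF y, of "j - i"] nu_add [of i "j - i"]
      by (simp add: left_diff_distrib)
    then show ?thesis unfolding coord by (simp add: sum_distrib_right)
  qed
  show "pc (x * y) j = ?p j" using 2 by (rule pc_eqI)
  have "degree (pc x i * poly_translate (i * t) (pc y (j - i))) \<le> k + l" for i j
    using N_degree [OF x, of i] N_degree [OF y, of "j - i"]
    by (intro degree_mult_le [THEN order_trans] add_mono) simp_all
  then have deg: "degree (?p j) \<le> k + l" for j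
    by (intro degree_sum_le finite_pc [OF x]) auto
  have "vpart (Suc (k + l)) (x * y)"
    unfolding vpart_def
  proof (intro conjI allI impI)
    fix j
    have "\<forall>i\<ge>Suc (k + l). coeff (?p j) i = 0"
      using deg [of j] by (auto intro: coeff_eq_0)
    with 2 show "\<exists>h. coord (x * y) (j * t) = to_fract h * \<nu> j \<and> (\<forall>i\<ge>Suc (k + l). coeff h i = 0)"
      by blast
  qed (rule 1)
  moreover have "x \<in> weyl" "y \<in> weyl" using x y by (simp_all add: nil_filt_nat)
  ultimately show "x * y \<in> N (k + l)"
    unfolding nil_filt_nat ad_funpow_eq_0_iff by (simp add: weyl.mult)
qed

lemma a_le_iff: "x \<in> N k \<Longrightarrow> pc x j \<noteq> 0 \<Longrightarrow> a j \<le> k"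
  unfolding a_def using N_dvd N_degree dvd_imp_degree_le order_trans by blast

text \<open>The coefficients of H^k, collected into a Laurent polynomial whose exponent j records
  v^j. On level k it represents the class modulo the previous level.\<close>

definition sym where "sym k x = Abs_poly_mapping (\<lambda>j. coeff (pc x j) k)"

lemma lookup_sym:
  assumes "x \<in> N l"
  shows "Poly_Mapping.lookup (sym k x) j = coeff (pc x j) k"
proof -
  have "finite {j. coeff (pc x j) k \<noteq> 0}"
    using finite_subset [OF _ finite_pc [OF assms]] by (metis (mono_tags, lifting) coeff_0 mem_Collect_eq subsetI)
  then show ?thesis by (simp add: sym_def)
qed

lemma sym_diff: "x \<in> N k \<Longrightarrow> y \<in> N k \<Longrightarrow> sym l (x - y) = sym l x - sym l y"
  by (rule poly_mapping_eqI) (simp add: lookup_minus lookup_sym [of _ k] N_diff pc_diff)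

lemma sym_add: "x \<in> N k \<Longrightarrow> y \<in> N k \<Longrightarrow> sym l (x + y) = sym l x + sym l y"
  by (rule poly_mapping_eqI) (simp add: lookup_add lookup_sym [of _ k] N_add pc_add)

lemma sym_0 [simp]: "sym l 0 = 0"
  by (rule poly_mapping_eqI) (simp add: lookup_sym [OF zero_in_N])

lemma sym_sum: "(\<And>i. i \<in> A \<Longrightarrow> f i \<in> N k) \<Longrightarrow> sym l (sum f A) = (\<Sum>i\<in>A. sym l (f i))"
  by (rule poly_mapping_eqI)
     (simp add: lookup_sum lookup_sym [of _ k] N_sum pc_sum [of A f k] coeff_sum)

lemma sym_scal: "x \<in> N k \<Longrightarrow> sym l (scal c x) = Poly_Mapping.single 0 c * sym l x"
  by (rule poly_mapping_eqI)
     (simp add: lookup_single_times_int lookup_sym [of _ k] N_scal pc_scal)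

text \<open>A translation does not change the coefficient of H^l in a polynomial of degree at most
  l. So the twist disappears from the top coefficients, and the graded algebra becomes
  commutative.\<close>

lemma sym_mult:
  assumes x: "x \<in> N k" and y: "y \<in> N l"
  shows "sym (k + l) (x * y) = sym k x * sym l y"
proof (rule poly_mapping_eqI)
  fix j
  have "Poly_Mapping.keys (sym k x) \<subseteq> {i. pc x i \<noteq> 0}"
    by (auto simp: in_keys_iff lookup_sym [OF x])
  then have "Poly_Mapping.lookup (sym k x * sym l y) j
      = (\<Sum>i | pc x i \<noteq> 0. coeff (pc x i) k * coeff (pc y (j - i)) l)"
    using finite_pc [OF x] by (subst lookup_times_int) (simp_all add: lookup_sym [OF x] lookup_sym [OF y])
  also have "\<dots> = (\<Sum>i | pc x i \<noteq> 0. coeff (pc x i * poly_translate (i * t) (pc y (j - i))) (k + l))"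
    using N_degree [OF x] N_degree [OF y]
    by (intro sum.cong) (simp_all add: coeff_mult_top coeff_poly_translate_degree)
  also have "\<dots> = Poly_Mapping.lookup (sym (k + l) (x * y)) j"
    unfolding lookup_sym [OF N_mult(1) [OF x y]] N_mult(2) [OF x y] by (simp add: coeff_sum)
  finally show "Poly_Mapping.lookup (sym (k + l) (x * y)) j = Poly_Mapping.lookup (sym k x * sym l y) j" by simp
qed

lemma sym_ker:
  assumes "x \<in> N (Suc k)" "sym (Suc k) x = 0"
  shows "x \<in> N k"
proof -
  have "coeff (pc x j) (Suc k) = 0" for j
    using assms(2) lookup_sym [OF assms(1), of "Suc k" j] by simp
  moreover have "degree (pc x j) \<le> Suc k" for j using assms(1) by (rule N_degree)
  ultimately have "degree (pc x j) \<le> k" for j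
    by (metis le_Suc_eq leading_coeff_0_iff degree_0 le0)
  then show ?thesis using assms(1) unfolding N_iff by simp
qed

lemma sym_ker_0:
  assumes "x \<in> N 0" "sym 0 x = 0"
  shows "x = 0"
proof (rule N_eqI [OF assms(1) zero_in_N])
  fix j
  have "coeff (pc x j) 0 = 0" "degree (pc x j) \<le> 0"
    using assms(2) lookup_sym [OF assms(1), of 0 j] N_degree [OF assms(1)] by simp_all
  then show "pc x j = pc 0 j" by (simp add: leading_coeff_0_iff [symmetric] del: leading_coeff_0_iff)
qed

text \<open>Stated with an integer index so as to include k = 0, where the previous level is the
  zero group by convention.\<close>

lemma N_pred_iff: "x \<in> nil_filt u (int k - 1) \<longleftrightarrow> x \<in> N k \<and> sym k x = 0"
proof (cases k)
  case 0
  have "nil_filt u (- 1) = {0}" by (simp add: nil_filt_def)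
  then have "x \<in> nil_filt u (- 1) \<longleftrightarrow> x \<in> N 0 \<and> sym 0 x = 0"
    using sym_ker_0 zero_in_N [of 0] by auto
  with 0 show ?thesis by simp
next
  case (Suc l)
  have "sym (Suc l) x = 0" if "x \<in> N l"
    using that N_degree [OF that]
    by (intro poly_mapping_eqI) (simp add: lookup_sym coeff_eq_0 le_imp_less_Suc)
  then have "x \<in> N l \<longleftrightarrow> x \<in> N (Suc l) \<and> sym (Suc l) x = 0"
    using sym_ker N_mono [of x l "Suc l"] by auto
  then show ?thesis by (simp add: Suc)
qed

lemma keys_sym: "x \<in> N k \<Longrightarrow> j \<in> Poly_Mapping.keys (sym k x) \<Longrightarrow> a j \<le> k"
  by (rule a_le_iff) (auto simp: in_keys_iff lookup_sym)

text \<open>The elements H^i b_j of the principal basis. The level of \<open>be (i, j)\<close> is i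
  + a_j, not i.\<close>

definition be where "be = (\<lambda>(i, j). of_poly (monom 1 i * d j) * v powi j)"

lemma degree_monom_d: "degree (monom 1 i * d j) = i + a j"
  by (simp add: degree_mult_eq degree_monom_eq a_def monom_eq_0_iff)

lemma be_eq: "be (i, j) = genH ^ i * b j"
proof -
  have "monom 1 i = [:0, 1 :: 'k:] ^ i" by (simp add: monom_altdef)
  then have "of_poly (monom 1 i) = (genH ^ i :: 'k skew)"
    by (simp add: genH_def of_poly_power)
  then show ?thesis by (simp add: be_def b_def mult.assoc)
qed

lemma be_N: "be (i, j) \<in> N (i + a j)"
  and pc_be: "pc (be (i, j)) l = (if l = j then monom 1 i * d j else 0)"
  unfolding be_def prod.case
  by (rule N_poly_v [where k = "i + a j"]; simp add: degree_monom_d)+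

lemma sym_be: "sym (i + a j) (be (i, j)) = Poly_Mapping.single j 1"
proof (rule poly_mapping_eqI)
  fix l
  have "coeff (monom 1 i * d j) (i + a j) = 1"
    using lead_coeff_d [of j] coeff_mult_top [of "monom 1 i" i "d j" "a j"]
    by (simp add: a_def degree_monom_le)
  then show "Poly_Mapping.lookup (sym (i + a j) (be (i, j))) l = Poly_Mapping.lookup (Poly_Mapping.single j 1) l"
    by (auto simp: lookup_sym [OF be_N] pc_be lookup_single when_def)
qed

text \<open>If a_j \<le> k, then \<open>be (k - a j, j)\<close> sits at level k exactly and its
  symbol is the monomial of exponent j.\<close>

lemma sym_surj:
  assumes "\<And>j. j \<in> Poly_Mapping.keys f \<Longrightarrow> a j \<le> k"
  obtains x where "x \<in> N k" "sym k x = f"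
proof -
  define x where "x = (\<Sum>j\<in>Poly_Mapping.keys f. scal (Poly_Mapping.lookup f j) (be (k - a j, j)))"
  have *: "be (k - a j, j) \<in> N k" "sym k (be (k - a j, j)) = Poly_Mapping.single j 1"
    if "j \<in> Poly_Mapping.keys f" for j
    using be_N [of "k - a j" j] sym_be [of "k - a j" j] assms [OF that] by simp_all
  have xN: "x \<in> N k" unfolding x_def by (intro N_sum N_scal *)
  have "sym k x = (\<Sum>j\<in>Poly_Mapping.keys f. Poly_Mapping.single j (Poly_Mapping.lookup f j))"
    unfolding x_def
    by (subst sym_sum [of _ _ k]) (auto intro!: N_scal * sum.cong simp: sym_scal [OF *(1)] *(2) mult_single)
  also have "\<dots> = f"
    by (rule poly_mapping_sum_single [symmetric])
  finally show ?thesis by (rule that [OF xN])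
qed

text \<open>The product b_i b_j lies in A_1 and equals v^{i+j} with a coefficient of degree a_i +
  a_j, which \<open>d (i + j)\<close> must divide. This makes the exponents closed under
  addition.\<close>

lemma a_subadd: "a (i + j) \<le> a i + a j"
proof -
  have "b i * b j \<in> weyl" by (intro weyl.mult b_in_weyl)
  also have "b i * b j = of_poly (d i) * (v powi i * of_poly (d j)) * v powi j"
    by (simp add: b_def mult.assoc)
  also have "\<dots> = of_poly (d i * poly_translate (i * t) (d j)) * v powi (i + j)"
    by (simp add: v_commute_of_poly v_powi_add mult.assoc)
  finally have "d (i + j) dvd d i * poly_translate (i * t) (d j)"
    by (simp only: poly_v_in_weyl_iff)
  then have "a (i + j) \<le> degree (d i * poly_translate (i * t) (d j))"
    unfolding a_def by (intro dvd_imp_degree_le) simp_all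
  then show ?thesis by (simp add: degree_mult_eq a_def)
qed

lemma nil_set_eq: "nil_set u = (\<Union>k. N k)"
  by (simp add: nil_set_def)

sublocale exponents: leading_exponents a \<mu> "nat e"
  using mu_pos e_pos a_0 a_ge_mu a_minus a_le_minus_mu by unfold_locales auto

sublocale nil: symbol_algebra a \<mu> "nat e" N sym
proof
  fix x y k
  show "x \<in> N k \<Longrightarrow> y \<in> N k \<Longrightarrow> x - y \<in> N k" by (rule N_diff)
  show "x \<in> N k \<Longrightarrow> y \<in> N k \<Longrightarrow> sym k (x - y) = sym k x - sym k y" by (rule sym_diff)
next
  fix j k c assume "a j \<le> k"
  then show "\<exists>x\<in>N k. sym k x = Poly_Mapping.single j c"
    using sym_surj [of "Poly_Mapping.single j c" k] by (metis keys_single singletonD empty_iff)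
qed (rule sym_ker_0 sym_ker keys_sym; assumption)+

lemma nil_set_closed:
  assumes "x \<in> nil_set u" "y \<in> nil_set u"
  shows "x + y \<in> nil_set u" "x - y \<in> nil_set u" "x * y \<in> nil_set u" "scal c x \<in> nil_set u"
proof -
  obtain k l where *: "x \<in> N k" "y \<in> N l" using assms by (auto simp: nil_set_eq)
  have "x \<in> N (max k l)" "y \<in> N (max k l)"
    using N_mono [OF *(1), of "max k l"] N_mono [OF *(2), of "max k l"] by auto
  note ** = N_add [OF this] N_diff [OF this] N_mult(1) [OF *] N_scal [OF *(1), of c]
  show "x + y \<in> nil_set u" "x - y \<in> nil_set u" "x * y \<in> nil_set u" "scal c x \<in> nil_set u"
    unfolding nil_set_eq by (rule UN_I [OF UNIV_I], rule **)+
qed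

end

lemma sum_in_closed:
  assumes "0 \<in> T" "\<And>x y. x \<in> T \<Longrightarrow> y \<in> T \<Longrightarrow> x + y \<in> T" "\<And>i. i \<in> A \<Longrightarrow> f i \<in> T"
  shows "sum f A \<in> T"
  using assms by (induction A rule: infinite_finite_induct) auto

lemma monom_sum: "monom (sum f A) k = (\<Sum>i\<in>A. monom (f i) k)"
  by (induction A rule: infinite_finite_induct) (simp_all add: add_monom [symmetric])

lemma monom_sum_single:
  "monom f k
    = (\<Sum>j\<in>Poly_Mapping.keys f. monom (Poly_Mapping.single j (Poly_Mapping.lookup f j)) k)"
proof -
  have "monom f k
      = monom (\<Sum>j\<in>Poly_Mapping.keys f. Poly_Mapping.single j (Poly_Mapping.lookup f j)) k"
    by (rule arg_cong [OF poly_mapping_sum_single])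
  then show ?thesis by (simp only: monom_sum)
qed

context homogeneous
begin

section \<open>The graded algebra\<close>

text \<open>The associated graded algebra is modelled by the monoid algebra of \<open>{(k, j). a j \<le> k}\<close>, realized
  inside the polynomials (graded by \<open>k\<close>) over the Laurent polynomials (graded by \<open>j\<close>).\<close>

definition gr_model :: "(int \<Rightarrow>\<^sub>0 'k) poly set" where
  "gr_model = {P. \<forall>k. \<forall>j\<in>Poly_Mapping.keys (coeff P k). a j \<le> k}"

definition gr_scal :: "'k \<Rightarrow> (int \<Rightarrow>\<^sub>0 'k) poly \<Rightarrow> (int \<Rightarrow>\<^sub>0 'k) poly" where
  "gr_scal c P = smult (Poly_Mapping.single 0 c) P"

text \<open>A coset of the previous level is described as a fibre of the symbol map, which avoids
  choosing representatives.\<close>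

definition gr_iso :: "(int \<Rightarrow>\<^sub>0 'k) poly \<Rightarrow> nat \<Rightarrow> 'k skew set" where
  "gr_iso P k = {x \<in> N k. sym k x = coeff P k}"

lemma gr_modelD: "P \<in> gr_model \<Longrightarrow> j \<in> Poly_Mapping.keys (coeff P k) \<Longrightarrow> a j \<le> k"
  by (simp add: gr_model_def)

lemma gr_modelI: "(\<And>k j. j \<in> Poly_Mapping.keys (coeff P k) \<Longrightarrow> a j \<le> k) \<Longrightarrow> P \<in> gr_model"
  by (simp add: gr_model_def)

lemma gr_model_add: "P \<in> gr_model \<Longrightarrow> Q \<in> gr_model \<Longrightarrow> P + Q \<in> gr_model"
  by (rule gr_modelI) (use Poly_Mapping.keys_add in \<open>fastforce dest: gr_modelD\<close>)

lemma gr_model_uminus: "P \<in> gr_model \<Longrightarrow> - P \<in> gr_model"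
  by (rule gr_modelI) (auto simp: in_keys_iff dest: gr_modelD)

lemma gr_model_diff: "P \<in> gr_model \<Longrightarrow> Q \<in> gr_model \<Longrightarrow> P - Q \<in> gr_model"
  using gr_model_add [OF _ gr_model_uminus, of P Q] by simp

lemma gr_model_mult:
  assumes "P \<in> gr_model" "Q \<in> gr_model"
  shows "P * Q \<in> gr_model"
proof (rule gr_modelI)
  fix k j assume "j \<in> Poly_Mapping.keys (coeff (P * Q) k)"
  then have "j \<in> Poly_Mapping.keys (\<Sum>i\<le>k. coeff P i * coeff Q (k - i))"
    by (simp add: coeff_mult)
  then obtain i where i: "i \<le> k" "j \<in> Poly_Mapping.keys (coeff P i * coeff Q (k - i))"
    using Poly_Mapping.keys_sum [of "\<lambda>i. coeff P i * coeff Q (k - i)" "{..k}"] by auto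
  then obtain j1 j2 where j: "j = j1 + j2" "j1 \<in> Poly_Mapping.keys (coeff P i)"
      "j2 \<in> Poly_Mapping.keys (coeff Q (k - i))"
    using Poly_Mapping.keys_mult [of "coeff P i" "coeff Q (k - i)"] by auto
  then have "a j1 \<le> i" "a j2 \<le> k - i" using assms gr_modelD by auto
  then show "a j \<le> k" using a_subadd [of j1 j2] i(1) by (simp add: j(1))
qed

lemma gr_model_monom: "(\<And>j. j \<in> Poly_Mapping.keys f \<Longrightarrow> a j \<le> k) \<Longrightarrow> monom f k \<in> gr_model"
  by (rule gr_modelI) (auto split: if_splits)

lemma gr_model_single: "a j \<le> k \<Longrightarrow> monom (Poly_Mapping.single j c) k \<in> gr_model"
  by (rule gr_model_monom) (auto split: if_splits)

lemma gr_model_1: "1 \<in> gr_model"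
  using gr_model_monom [of 1 0] by (simp add: monom_0 one_pCons a_0)

lemma gr_scal_monom: "gr_scal c (monom (Poly_Mapping.single j c') k) = monom (Poly_Mapping.single j (c * c')) k"
  by (simp add: gr_scal_def smult_monom mult_single)

lemma gr_scal_eq: "gr_scal c P = monom (Poly_Mapping.single 0 c) 0 * P"
  by (simp add: gr_scal_def monom_0)

lemma gr_model_scal: "P \<in> gr_model \<Longrightarrow> gr_scal c P \<in> gr_model"
  unfolding gr_scal_eq by (intro gr_model_mult gr_model_single) (simp_all add: a_0)

lemma filt_coset_eq:
  assumes "x \<in> N k"
  shows "filt_coset u k x = {y \<in> N k. sym k y = sym k x}"
proof (intro equalityI subsetI)
  fix y assume "y \<in> filt_coset u k x"
  then obtain c where "y = x + c" "c \<in> N k" "sym k c = 0"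
    by (auto simp: filt_coset_def N_pred_iff)
  then show "y \<in> {y \<in> N k. sym k y = sym k x}"
    using assms by (simp add: N_add sym_add)
next
  fix y assume y: "y \<in> {y \<in> N k. sym k y = sym k x}"
  then have "y - x \<in> nil_filt u (int k - 1)"
    using assms by (simp add: N_pred_iff N_diff sym_diff [of _ k])
  then have "x + (y - x) \<in> filt_coset u k x" unfolding filt_coset_def by (rule imageI)
  then show "y \<in> filt_coset u k x" by simp
qed

lemma gr_iso_rep:
  assumes "P \<in> gr_model"
  obtains x where "x \<in> N k" "sym k x = coeff P k" "gr_iso P k = filt_coset u k x"
proof -
  obtain x where x: "x \<in> N k" "sym k x = coeff P k"
    using sym_surj gr_modelD [OF assms] by metis
  then have "gr_iso P k = filt_coset u k x"
    by (simp add: gr_iso_def filt_coset_eq)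
  with x that show ?thesis by blast
qed

lemma graded_elem_eq:
  assumes "x \<in> N k"
  shows "graded_elem u k x = gr_iso (monom (sym k x) k)"
  unfolding graded_elem_def gr_iso_def using assms
  by (auto simp: fun_eq_iff filt_coset_eq)

lemma gr_iso_carrier: "carrier (graded_alg u) = gr_iso ` gr_model"
proof (intro equalityI subsetI)
  fix G assume "G \<in> carrier (graded_alg u)"
  then have "\<forall>k. \<exists>x\<in>N k. G k = filt_coset u k x" and fin: "finite {k. G k \<noteq> filt_coset u k 0}"
    by (auto simp: graded_alg_def)
  then obtain x where x: "\<And>k. x k \<in> N k" "\<And>k. G k = filt_coset u k (x k)" by metis
  define P where "P = (\<Sum>i | G i \<noteq> filt_coset u i 0. monom (sym i (x i)) i)"
  have coeff: "coeff P k = sym k (x k)" for k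
  proof -
    have "coeff P k = (\<Sum>i | G i \<noteq> filt_coset u i 0. if k = i then sym i (x i) else 0)"
      unfolding P_def coeff_sum by (intro sum.cong) auto
    also have "\<dots> = (if G k \<noteq> filt_coset u k 0 then sym k (x k) else 0)"
      using fin by (subst sum.delta') auto
    also have "\<dots> = sym k (x k)"
    proof (cases "G k = filt_coset u k 0")
      case True
      have "x k \<in> G k" using x(1) [of k] by (simp add: x(2) filt_coset_eq)
      with True have "x k \<in> filt_coset u k 0" by simp
      then have "sym k (x k) = 0" by (simp add: filt_coset_eq)
      then show ?thesis by simp
    qed simp
    finally show ?thesis .
  qed
  have "P \<in> gr_model"
    by (rule gr_modelI) (use coeff x(1) keys_sym in metis)
  moreover have "G = gr_iso P"
    by (simp add: fun_eq_iff gr_iso_def coeff x(2) filt_coset_eq [OF x(1)])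
  ultimately show "G \<in> gr_iso ` gr_model" by blast
next
  fix G assume "G \<in> gr_iso ` gr_model"
  then obtain P where P: "P \<in> gr_model" "G = gr_iso P" by blast
  have "gr_iso P k \<in> filt_coset u k ` N k" for k
    using gr_iso_rep [OF P(1), of k] by blast
  moreover have "{k. gr_iso P k \<noteq> filt_coset u k 0} \<subseteq> {..degree P}"
    using coeff_eq_0 [of P] by (auto simp: gr_iso_def filt_coset_eq not_le [symmetric])
  then have "finite {k. gr_iso P k \<noteq> filt_coset u k 0}" by (rule finite_subset) simp
  ultimately show "G \<in> carrier (graded_alg u)" by (simp add: graded_alg_def P(2))
qed

lemma gr_iso_inj: "inj_on gr_iso gr_model"
proof (rule inj_onI)
  fix P Q assume P: "P \<in> gr_model" and Q: "Q \<in> gr_model" and eq: "gr_iso P = gr_iso Q"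
  have "coeff P k = coeff Q k" for k
  proof -
    obtain x where x: "x \<in> N k" "sym k x = coeff P k"
      using gr_iso_rep [OF P, of k] by blast
    then have "x \<in> gr_iso Q k" unfolding eq [symmetric] by (simp add: gr_iso_def)
    then show ?thesis using x(2) by (simp add: gr_iso_def)
  qed
  then show "P = Q" by (rule poly_eqI)
qed

lemma gr_iso_choose:
  assumes "P \<in> gr_model"
  obtains x where "\<And>k. x k \<in> N k" "\<And>k. sym k (x k) = coeff P k"
proof -
  have "\<forall>k. \<exists>x. x \<in> N k \<and> sym k x = coeff P k"
    using gr_iso_rep [OF assms] by metis
  then show ?thesis using that by metis
qed

lemma gr_iso_add:
  assumes P: "P \<in> gr_model" and Q: "Q \<in> gr_model"
  shows "gr_iso P \<oplus>\<^bsub>graded_alg u\<^esub> gr_iso Q = gr_iso (P + Q)"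
proof
  fix k
  obtain x where x: "\<And>k. x k \<in> N k" "\<And>k. sym k (x k) = coeff P k"
    using gr_iso_choose [OF P] by blast
  have "{y + z |y z. y \<in> gr_iso P k \<and> z \<in> gr_iso Q k} = gr_iso (P + Q) k"
  proof (intro equalityI subsetI)
    fix w assume "w \<in> {y + z |y z. y \<in> gr_iso P k \<and> z \<in> gr_iso Q k}"
    then show "w \<in> gr_iso (P + Q) k" by (auto simp: gr_iso_def N_add sym_add)
  next
    fix w assume "w \<in> gr_iso (P + Q) k"
    then have "x k \<in> gr_iso P k" "w - x k \<in> gr_iso Q k"
      using x by (auto simp: gr_iso_def N_diff sym_diff)
    then show "w \<in> {y + z |y z. y \<in> gr_iso P k \<and> z \<in> gr_iso Q k}"
      by (intro CollectI exI [of _ "x k"] exI [of _ "w - x k"]) simp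
  qed
  then show "(gr_iso P \<oplus>\<^bsub>graded_alg u\<^esub> gr_iso Q) k = gr_iso (P + Q) k"
    by (simp add: graded_alg_def)
qed

lemma gr_iso_scal:
  assumes P: "P \<in> gr_model"
  shows "c \<odot>\<^bsub>graded_alg u\<^esub> gr_iso P = gr_iso (gr_scal c P)"
proof
  fix k
  obtain x where x: "\<And>k. x k \<in> N k" "\<And>k. sym k (x k) = coeff P k"
    using gr_iso_choose [OF P] by blast
  have "{scal c y + z |y z. y \<in> gr_iso P k \<and> z \<in> nil_filt u (int k - 1)} = gr_iso (gr_scal c P) k"
  proof (intro equalityI subsetI)
    fix w assume "w \<in> {scal c y + z |y z. y \<in> gr_iso P k \<and> z \<in> nil_filt u (int k - 1)}"
    then show "w \<in> gr_iso (gr_scal c P) k"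
      by (auto simp: gr_iso_def N_pred_iff N_add N_scal sym_add [of _ k] sym_scal [of _ k] gr_scal_def)
  next
    fix w assume "w \<in> gr_iso (gr_scal c P) k"
    then have "x k \<in> gr_iso P k" "w - scal c (x k) \<in> nil_filt u (int k - 1)"
      using x by (auto simp: gr_iso_def N_pred_iff N_diff N_scal sym_diff [of _ k] sym_scal [of _ k] gr_scal_def)
    then show "w \<in> {scal c y + z |y z. y \<in> gr_iso P k \<and> z \<in> nil_filt u (int k - 1)}"
      by (intro CollectI exI [of _ "x k"] exI [of _ "w - scal c (x k)"]) simp
  qed
  then show "(c \<odot>\<^bsub>graded_alg u\<^esub> gr_iso P) k = gr_iso (gr_scal c P) k"
    by (simp add: graded_alg_def)
qed

text \<open>The product of families ranges over all choices of representatives, but all the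
  resulting sums have the same symbol. Conversely a single choice reaches the whole fibre, because
  the extra summand \<open>c\<close> runs through the previous level.\<close>

lemma gr_iso_mult:
  assumes P: "P \<in> gr_model" and Q: "Q \<in> gr_model"
  shows "gr_iso P \<otimes>\<^bsub>graded_alg u\<^esub> gr_iso Q = gr_iso (P * Q)"
proof
  fix k
  have conv: "(\<Sum>i\<le>k. y i * z (k - i)) \<in> N k"
    "sym k (\<Sum>i\<le>k. y i * z (k - i)) = coeff (P * Q) k"
    if y: "\<And>i. y i \<in> gr_iso P i" and z: "\<And>i. z i \<in> gr_iso Q i" for y z
  proof -
    have *: "y i * z (k - i) \<in> N k" "sym k (y i * z (k - i)) = coeff P i * coeff Q (k - i)"
      if "i \<le> k" for i
      using y [of i] z [of "k - i"] that N_mult(1) [of "y i" i "z (k - i)" "k - i"]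
        sym_mult [of "y i" i "z (k - i)" "k - i"] by (simp_all add: gr_iso_def)
    then show "(\<Sum>i\<le>k. y i * z (k - i)) \<in> N k" by (intro N_sum) simp
    show "sym k (\<Sum>i\<le>k. y i * z (k - i)) = coeff (P * Q) k"
      by (subst sym_sum [of _ _ k]) (simp_all add: * coeff_mult)
  qed
  obtain x where x: "\<And>k. x k \<in> N k" "\<And>k. sym k (x k) = coeff P k"
    using gr_iso_choose [OF P] by blast
  obtain x' where x': "\<And>k. x' k \<in> N k" "\<And>k. sym k (x' k) = coeff Q k"
    using gr_iso_choose [OF Q] by blast
  have "{(\<Sum>i\<le>k. y i * z (k - i)) + c |y z c. (\<forall>i. y i \<in> gr_iso P i) \<and> (\<forall>j. z j \<in> gr_iso Q j) \<and>
      c \<in> nil_filt u (int k - 1)} = gr_iso (P * Q) k" (is "?L = _")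
  proof (intro equalityI subsetI)
    fix w assume "w \<in> ?L"
    then obtain y z c where w: "w = (\<Sum>i\<le>k. y i * z (k - i)) + c" "\<And>i. y i \<in> gr_iso P i"
        "\<And>i. z i \<in> gr_iso Q i" "c \<in> nil_filt u (int k - 1)" by blast
    have c: "c \<in> N k" "sym k c = 0" using w(4) by (simp_all add: N_pred_iff)
    show "w \<in> gr_iso (P * Q) k"
      unfolding w(1) gr_iso_def using conv [OF w(2,3)] c
      by (simp add: N_add sym_add [of _ k])
  next
    fix w assume w: "w \<in> gr_iso (P * Q) k"
    have xx: "\<And>i. x i \<in> gr_iso P i" "\<And>i. x' i \<in> gr_iso Q i"
      using x x' by (simp_all add: gr_iso_def)
    note s = conv [OF xx]
    have "w - (\<Sum>i\<le>k. x i * x' (k - i)) \<in> nil_filt u (int k - 1)"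
      using w s by (simp add: gr_iso_def N_pred_iff N_diff sym_diff [of _ k])
    then show "w \<in> ?L"
      using xx by (intro CollectI exI [of _ x] exI [of _ x'] exI [of _ "w - (\<Sum>i\<le>k. x i * x' (k - i))"]) simp
  qed
  then show "(gr_iso P \<otimes>\<^bsub>graded_alg u\<^esub> gr_iso Q) k = gr_iso (P * Q) k"
    by (simp add: graded_alg_def)
qed

sublocale graded: represented_algebra gr_model gr_scal gr_iso "graded_alg u"
proof
  show "\<one>\<^bsub>graded_alg u\<^esub> = gr_iso 1"
  proof -
    have "sym 0 1 = 1"
      by (rule poly_mapping_eqI) (simp add: lookup_sym [OF one_in_N [of 0]] pc_1 lookup_one when_def)
    then show ?thesis
      using graded_elem_eq [OF one_in_N [of 0]] by (simp add: graded_alg_def monom_0 one_pCons)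
  qed
  show "\<zero>\<^bsub>graded_alg u\<^esub> = gr_iso 0"
    by (simp add: graded_alg_def fun_eq_iff gr_iso_def filt_coset_eq)
  fix c c' P Q
  show "gr_scal (c + c') P = gr_scal c P + gr_scal c' P"
    by (simp add: gr_scal_def single_add smult_add_left)
  show "gr_scal (c * c') P = gr_scal c (gr_scal c' P)"
    by (simp add: gr_scal_def mult_single)
  show "gr_scal 1 P = P"
    by (simp add: gr_scal_def single_one)
  show "P * gr_scal c Q = gr_scal c (P * Q)" "gr_scal c P * Q = gr_scal c (P * Q)"
    "gr_scal c (P + Q) = gr_scal c P + gr_scal c Q"
    by (simp_all add: gr_scal_def smult_add_right)
qed (simp_all add: gr_model_1 gr_model_add gr_model_uminus gr_model_mult gr_model_scal gr_iso_inj
    gr_iso_carrier gr_iso_mult gr_iso_add gr_iso_scal)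

sublocale nilpotent: represented_algebra "nil_set u" scal "\<lambda>x. x" "nil_alg u"
proof
  show one: "1 \<in> nil_set u" unfolding nil_set_eq using one_in_N by blast
  show "- x \<in> nil_set u" if "x \<in> nil_set u" for x
    using nil_set_closed(2) [of "x - x" x] nil_set_closed(2) [OF that that] that by simp
qed (simp_all add: nil_set_closed scal_simps nil_alg_def)

subsection \<open>Noetherianity\<close>

lemma nilpotent_fin_gen:
  fixes act
  assumes act: "\<And>k l x y. x \<in> N k \<Longrightarrow> y \<in> N l \<Longrightarrow>
      act x y \<in> N (k + l) \<and> sym (k + l) (act x y) = sym k x * sym l y"
  shows "nilpotent.fin_gen act"
  unfolding nilpotent.fin_gen_def
proof (intro allI impI)
  fix I assume I: "I \<subseteq> nil_set u" "\<forall>x\<in>I. \<forall>y\<in>I. x - y \<in> I" "\<forall>z\<in>nil_set u. \<forall>y\<in>I. act z y \<in> I"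
  have N: "z \<in> nil_set u" if "z \<in> N k" for z k using that by (auto simp: nil_set_eq)
  obtain B where B: "finite B" "B \<subseteq> I"
    "\<And>J. B \<subseteq> J \<Longrightarrow> 0 \<in> J \<Longrightarrow> (\<And>x y. x \<in> J \<Longrightarrow> y \<in> J \<Longrightarrow> x + y \<in> J) \<Longrightarrow>
      (\<And>z y k. z \<in> N k \<Longrightarrow> y \<in> J \<Longrightarrow> act z y \<in> J) \<Longrightarrow> I \<subseteq> J"
  proof (rule nil.finite_generation [of act I])
    show "I \<subseteq> (\<Union>k. N k)" using I(1) by (simp add: nil_set_eq)
  qed (use act I(2,3) N in auto)
  show "\<exists>B\<subseteq>I. finite B \<and> (\<forall>J. B \<subseteq> J \<longrightarrow> 0 \<in> J \<longrightarrow> (\<forall>x\<in>J. \<forall>y\<in>J. x + y \<in> J) \<longrightarrow>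
      (\<forall>z\<in>nil_set u. \<forall>y\<in>J. act z y \<in> J) \<longrightarrow> I \<subseteq> J)"
  proof (intro exI [of _ B] conjI allI impI)
    fix J assume "B \<subseteq> J" "0 \<in> J" "\<forall>x\<in>J. \<forall>y\<in>J. x + y \<in> J" "\<forall>z\<in>nil_set u. \<forall>y\<in>J. act z y \<in> J"
    then show "I \<subseteq> J" using N by (intro B(3)) auto
  qed (use B(1,2) in auto)
qed

text \<open>Symbols commute, so multiplication from the right has the same effect on symbols as
  multiplication from the left and the same reduction applies.\<close>

lemma nil_alg_noetherian: "left_noetherian (nil_alg u)" "right_noetherian (nil_alg u)"
proof -
  show "left_noetherian (nil_alg u)"
    using N_mult(1) sym_mult by (intro nilpotent.left_noetherian nilpotent_fin_gen conjI)
  have "y * x \<in> N (k + l) \<and> sym (k + l) (y * x) = sym k x * sym l y" if "x \<in> N k" "y \<in> N l" for x y k l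
    using N_mult(1) [OF that(2,1)] sym_mult [OF that(2,1)] by (simp add: add.commute mult.commute)
  then show "right_noetherian (nil_alg u)"
    by (rule nilpotent.right_noetherian [OF nilpotent_fin_gen])
qed

text \<open>The model is itself filtered by polynomial degree, with the top coefficient as symbol.
  So the reduction argument for N(u) also proves that the graded algebra is Noetherian.\<close>

sublocale model: symbol_algebra a \<mu> "nat e" "\<lambda>k. {P \<in> gr_model. degree P \<le> k}"
  "\<lambda>k P. coeff P k"
proof
  fix P k assume P: "P \<in> {P \<in> gr_model. degree P \<le> Suc k}" "coeff P (Suc k) = 0"
  then have "degree P \<le> k"
    by (metis (mono_tags, lifting) degree_0 le0 le_Suc_eq leading_coeff_0_iff mem_Collect_eq)
  with P(1) show "P \<in> {P \<in> gr_model. degree P \<le> k}" by simp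
next
  fix P :: "(int \<Rightarrow>\<^sub>0 'k) poly" assume "P \<in> {P \<in> gr_model. degree P \<le> 0}" "coeff P 0 = 0"
  then show "P = 0" by (metis (mono_tags, lifting) le_0_eq leading_coeff_0_iff mem_Collect_eq)
next
  fix j k c assume "a j \<le> k"
  then show "\<exists>P\<in>{P \<in> gr_model. degree P \<le> k}. coeff P k = Poly_Mapping.single j c"
    by (intro bexI [of _ "monom (Poly_Mapping.single j c) k"])
       (simp_all add: gr_model_single degree_monom_le)
qed (auto simp: gr_model_diff degree_diff_le dest: gr_modelD)

lemma graded_noetherian: "noetherian_ring (graded_alg u)"
proof (rule graded.noetherian_ring)
  show "graded.fin_gen (*)"
    unfolding graded.fin_gen_def
  proof (intro allI impI)
    fix I assume I: "I \<subseteq> gr_model" "\<forall>x\<in>I. \<forall>y\<in>I. x - y \<in> I" "\<forall>z\<in>gr_model. \<forall>y\<in>I. z * y \<in> I"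
    obtain B where B: "finite B" "B \<subseteq> I"
      "\<And>J. B \<subseteq> J \<Longrightarrow> 0 \<in> J \<Longrightarrow> (\<And>x y. x \<in> J \<Longrightarrow> y \<in> J \<Longrightarrow> x + y \<in> J) \<Longrightarrow>
        (\<And>z y k. z \<in> {P \<in> gr_model. degree P \<le> k} \<Longrightarrow> y \<in> J \<Longrightarrow> z * y \<in> J) \<Longrightarrow> I \<subseteq> J"
    proof (rule model.finite_generation [of "(*)" I])
      show "I \<subseteq> (\<Union>k. {P \<in> gr_model. degree P \<le> k})" using I(1) by auto
      fix k l P Q assume "P \<in> {P \<in> gr_model. degree P \<le> k}" "Q \<in> {P \<in> gr_model. degree P \<le> l}"
      then show "P * Q \<in> {P \<in> gr_model. degree P \<le> k + l} \<and>
          coeff (P * Q) (k + l) = coeff P k * coeff Q l"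
        by (auto simp: gr_model_mult coeff_mult_top intro: degree_mult_le [THEN order_trans])
    qed (use I(2,3) in auto)
    show "\<exists>B\<subseteq>I. finite B \<and> (\<forall>J. B \<subseteq> J \<longrightarrow> 0 \<in> J \<longrightarrow> (\<forall>x\<in>J. \<forall>y\<in>J. x + y \<in> J) \<longrightarrow>
        (\<forall>z\<in>gr_model. \<forall>y\<in>J. z * y \<in> J) \<longrightarrow> I \<subseteq> J)"
    proof (intro exI [of _ B] conjI allI impI)
      fix J assume "B \<subseteq> J" "0 \<in> J" "\<forall>x\<in>J. \<forall>y\<in>J. x + y \<in> J" "\<forall>z\<in>gr_model. \<forall>y\<in>J. z * y \<in> J"
      then show "I \<subseteq> J" by (intro B(3)) auto
    qed (use B(1,2) in auto)
  qed
qed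

subsection \<open>Generators\<close>

lemma N_as_b:
  assumes "x \<in> N k"
  obtains h where "x = (\<Sum>j | pc x j \<noteq> 0. of_poly (h j) * b j)" "\<And>j. pc x j = h j * d j"
proof -
  have "\<forall>j. \<exists>h. pc x j = h * d j"
    using N_dvd [OF assms] by (metis dvd_def mult.commute)
  then obtain h where h: "\<And>j. pc x j = h j * d j" by metis
  have "x = (\<Sum>j | pc x j \<noteq> 0. of_poly (h j) * b j)"
    by (subst N_decompose [OF assms]) (intro sum.cong, auto simp: h b_def mult.assoc)
  with h that show ?thesis by blast
qed

lemma genH_N: "genH \<in> N 1"
proof -
  have "[:0, 1:] = monom (1 :: 'k) 1" by (simp add: monom_altdef)
  then have "be (1, 0) = genH" by (simp add: be_def genH_def)
  with be_N [of 1 0] show ?thesis by (simp add: a_0)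
qed

lemma b_N: "b j \<in> N (a j)"
  using be_N [of 0 j] by (simp add: be_eq)

text \<open>For indices from \<mu> on, b_j is a power of v; for indices up to -\<mu> it is v_{jt}, a
  power of X or of Y. In both ranges b_i b_j = b_{i+j} holds exactly, so H and finitely many b_j
  generate.\<close>

lemma nil_alg_affine: "affine_algebra (nil_alg u)"
proof (rule nilpotent.affine_algebra [of "insert genH (b ` {- 2 * int \<mu>..2 * int \<mu>})"])
  show "insert genH (b ` {- 2 * int \<mu>..2 * int \<mu>}) \<subseteq> nil_set u"
    unfolding nil_set_eq using genH_N b_N by blast
  fix T assume T: "insert genH (b ` {- 2 * int \<mu>..2 * int \<mu>}) \<subseteq> T" "1 \<in> T"
    "\<And>x y. x \<in> T \<Longrightarrow> y \<in> T \<Longrightarrow> x + y \<in> T" "\<And>x y. x \<in> T \<Longrightarrow> y \<in> T \<Longrightarrow> x * y \<in> T"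
    "\<And>c x. x \<in> T \<Longrightarrow> scal c x \<in> T"
  have "b j \<in> T" for j
  proof (rule exponents.generation [of "\<lambda>j. b j \<in> T"])
    show "b j \<in> T" if "\<bar>j\<bar> \<le> 2 * int \<mu>" for j
      using that by (intro subsetD [OF T(1)] insertI2 imageI) auto
  next
    fix i j assume *: "b i \<in> T" "b j \<in> T" "i \<ge> int \<mu> \<and> j \<ge> int \<mu> \<or> i \<le> - int \<mu> \<and> j \<le> - int \<mu>"
    have "b (i + j) = b i * b j"
      using *(3)
    proof
      assume ij: "i \<ge> int \<mu> \<and> j \<ge> int \<mu>"
      then have "d i = 1" "d j = 1" "d (i + j) = 1"
        using d_ge_mu [of "nat i"] d_ge_mu [of "nat j"] d_ge_mu [of "nat (i + j)"] by auto
      then show ?thesis by (simp add: b_def v_powi_add)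
    next
      assume ij: "i \<le> - int \<mu> \<and> j \<le> - int \<mu>"
      have "b l = vgen (l * t)" if "l \<le> - int \<mu>" for l
        using b_le_minus_mu [of "nat (- l)"] that by simp
      then have "b i = vgen (i * t)" "b j = vgen (j * t)" "b (i + j) = vgen ((i + j) * t)"
        using ij by auto
      moreover have "i * t \<ge> 0 \<and> j * t \<ge> 0 \<or> i * t \<le> 0 \<and> j * t \<le> 0"
        using ij by (cases "t \<ge> 0") (auto simp: mult_nonpos_nonneg mult_nonpos_nonpos)
      ultimately show ?thesis by (simp add: distrib_right vgen_add)
    qed
    with *(1,2) T(4) show "b (i + j) \<in> T" by simp
  qed
  moreover have "of_poly p \<in> T" for p
  proof (induction p)
    case 0
    show ?case using T(5) [OF T(2), of 0] by (simp add: scal_simps)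
  next
    case (pCons c p)
    have "pCons c p = [:c:] + [:0, 1:] * p" by simp
    then have "of_poly (pCons c p) = scal c 1 + genH * of_poly p"
      by (simp add: scal_def genH_def del: mult_pCons_left flip: of_poly_simps(3,5))
    then show ?case using pCons.IH T by auto
  qed
  ultimately have *: "of_poly p * b j \<in> T" for p j using T(4) by blast
  have zero: "0 \<in> T" using T(5) [OF T(2), of 0] by (simp add: scal_simps)
  show "nil_set u \<subseteq> T"
  proof
    fix x assume "x \<in> nil_set u"
    then obtain k where "x \<in> N k" by (auto simp: nil_set_eq)
    then obtain h where "x = (\<Sum>j | pc x j \<noteq> 0. of_poly (h j) * b j)" using N_as_b by blast
    moreover have "(\<Sum>j | pc x j \<noteq> 0. of_poly (h j) * b j) \<in> T"
      using zero T(3) * by (rule sum_in_closed)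
    ultimately show "x \<in> T" by simp
  qed
qed simp

text \<open>The generators are the symbols of H and of b_j for \<bar>j\<bar> \<le> 2 \<mu>. They
  multiply like monomials, so additivity of \<open>a\<close> outside the window produces the symbols
  of all b_j, and H raises the level.\<close>

lemma graded_affine: "affine_algebra (graded_alg u)"
proof (rule graded.affine_algebra [of "insert (monom 1 1)
      ((\<lambda>j. monom (Poly_Mapping.single j 1) (a j)) ` {- 2 * int \<mu>..2 * int \<mu>})"])
  have "monom 1 1 \<in> gr_model"
    by (rule gr_model_monom) (auto simp: a_0)
  then show "insert (monom 1 1) ((\<lambda>j. monom (Poly_Mapping.single j 1) (a j)) ` {- 2 * int \<mu>..2 * int \<mu>}) \<subseteq> gr_model"
    by (auto intro: gr_model_single)
  fix T assume T: "insert (monom 1 1) ((\<lambda>j. monom (Poly_Mapping.single j 1) (a j)) ` {- 2 * int \<mu>..2 * int \<mu>}) \<subseteq> T" "1 \<in> T"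
    "\<And>x y. x \<in> T \<Longrightarrow> y \<in> T \<Longrightarrow> x + y \<in> T" "\<And>x y. x \<in> T \<Longrightarrow> y \<in> T \<Longrightarrow> x * y \<in> T"
    "\<And>c x. x \<in> T \<Longrightarrow> gr_scal c x \<in> T"
  let ?m = "\<lambda>j k. monom (Poly_Mapping.single j (1 :: 'k)) k"
  have gen: "?m j (a j) \<in> T" for j
  proof (rule exponents.generation [of "\<lambda>j. ?m j (a j) \<in> T"])
    show "?m j (a j) \<in> T" if "\<bar>j\<bar> \<le> 2 * int \<mu>" for j
      using that by (intro subsetD [OF T(1)] insertI2 image_eqI [of _ _ j]) auto
  next
    fix i j assume *: "?m i (a i) \<in> T" "?m j (a j) \<in> T" "a i + a j = a (i + j)"
    have "?m i (a i) * ?m j (a j) = ?m (i + j) (a (i + j))"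
      by (simp add: mult_monom mult_single *(3))
    then show "?m (i + j) (a (i + j)) \<in> T" using T(4) [OF *(1,2)] by simp
  qed
  have gen': "?m j (a j + l) \<in> T" for j l
  proof (induction l)
    case (Suc l)
    have "monom 1 1 * ?m j (a j + l) = ?m j (a j + Suc l)"
      by (simp add: mult_monom)
    then show ?case using T(1) T(4) [of "monom 1 1" "?m j (a j + l)"] Suc by simp
  qed (simp add: gen)
  have zero: "0 \<in> T" using T(5) [OF T(2), of 0] by (simp add: gr_scal_def)
  have single: "monom (Poly_Mapping.single j c) k \<in> T" if "a j \<le> k" for j c k
    using T(5) [OF gen' [of j "k - a j"], of c] that by (simp add: gr_scal_monom)
  have monom: "monom f k \<in> T" if f: "\<And>j. j \<in> Poly_Mapping.keys f \<Longrightarrow> a j \<le> k" for f k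
  proof -
    have "monom f k = (\<Sum>j\<in>Poly_Mapping.keys f. monom (Poly_Mapping.single j (Poly_Mapping.lookup f j)) k)"
      by (rule monom_sum_single)
    also have "\<dots> \<in> T"
      by (rule sum_in_closed [OF zero]) (simp_all add: T(3) single f)
    finally show ?thesis .
  qed
  show "gr_model \<subseteq> T"
  proof
    fix P assume P: "P \<in> gr_model"
    have "P = (\<Sum>k\<le>degree P. monom (coeff P k) k)"
      by (rule poly_as_sum_of_monoms [symmetric])
    also have "\<dots> \<in> T"
      by (rule sum_in_closed [OF zero]) (simp_all add: T(3) monom gr_modelD [OF P])
    finally show "P \<in> T" .
  qed
qed simp


section \<open>Principal bases and degrees\<close>

text \<open>The only possible nonzero symbol coefficient at level i is \<open>coeff p i\<close>. It
  is nonzero at i = deg p, and every level containing the element is at least deg p.\<close>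

lemma ndeg_poly_v:
  assumes "d j dvd p" "p \<noteq> 0"
  shows "ndeg u (of_poly p * v powi j) = degree p"
  unfolding ndeg_def
proof (rule the_equality)
  let ?x = "of_poly p * v powi j"
  note x = N_poly_v [OF assms(1) order_refl]
  have look: "Poly_Mapping.lookup (sym i ?x) l = (if l = j then coeff p i else 0)" for i l
    unfolding lookup_sym [OF x(1)] x(2) by simp
  have "sym (degree p) ?x \<noteq> 0"
    using look [of "degree p" j] assms(2) by auto
  then show "?x \<in> nil_filt u (int (degree p)) - nil_filt u (int (degree p) - 1)"
    using x(1) by (simp add: N_pred_iff)
  fix i assume i: "?x \<in> nil_filt u (int i) - nil_filt u (int i - 1)"
  then have "?x \<in> N i" "sym i ?x \<noteq> 0" by (simp_all add: N_pred_iff)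
  then obtain l where "Poly_Mapping.lookup (sym i ?x) l \<noteq> 0"
    by (metis lookup_zero poly_mapping_eqI)
  then have "coeff p i \<noteq> 0" by (auto simp: look split: if_splits)
  then have "i \<le> degree p" by (rule le_degree)
  moreover have "degree p \<le> i" using N_degree [OF \<open>?x \<in> N i\<close>, of j] x(2) by simp
  ultimately show "i = degree p" by simp
qed

lemma ndeg_be: "ndeg u (be (i, j)) = i + a j"
proof -
  have "monom 1 i * d j \<noteq> 0" by (simp add: monom_eq_0_iff)
  then have "ndeg u (be (i, j)) = degree (monom 1 i * d j)"
    unfolding be_def prod.case by (intro ndeg_poly_v) simp_all
  then show ?thesis by (simp only: degree_monom_d)
qed

lemma inj_be: "inj be"
proof (rule injI)
  fix p q assume eq: "be p = be q"
  obtain i j i' j' where pq: "p = (i, j)" "q = (i', j')" by fastforce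
  have nz: "monom 1 i * d j \<noteq> 0" by (simp add: monom_eq_0_iff)
  have "monom 1 i * d j = (if j = j' then monom 1 i' * d j' else 0)"
    using pc_be [of i j j] pc_be [of i' j' j] eq pq by simp
  with nz have "j = j'" "monom 1 i * d j = monom 1 i' * d j"
    by (auto split: if_splits)
  moreover from this(2) have "monom (1 :: 'k) i = monom 1 i'" by simp
  then have "i = i'" by (simp add: monom_eq_iff')
  ultimately show "p = q" by (simp add: pq)
qed

lemma be_independent:
  assumes A: "finite A" and zero: "(\<Sum>p\<in>A. scal (c p) (be p)) = 0"
  shows "\<forall>p\<in>A. c p = 0"
proof
  fix p0 assume p0: "p0 \<in> A"
  obtain i0 j0 where ij: "p0 = (i0, j0)" by (cases p0)
  \<comment> \<open>A crude common level for all summands; on a fixed level \<open>pc\<close> is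
    additive.\<close>
  define K where "K = (\<Sum>(i, j)\<in>A. i + a j)"
  have mem: "be p \<in> N K" if "p \<in> A" for p
  proof -
    have "(case p of (i, j) \<Rightarrow> i + a j) \<le> K"
      unfolding K_def using that A by (intro member_le_sum) auto
    moreover obtain i j where p: "p = (i, j)" by (cases p)
    ultimately have "i + a j \<le> K" by simp
    with be_N show ?thesis unfolding p by (rule N_mono)
  qed
  \<comment> \<open>The index j0 isolates the summands with coefficient c H^i d_{j0}; after
    cancelling d_{j0}, the claim is the independence of the powers of H.\<close>
  define q where "q p = (if snd p = j0 then monom (c p) (fst p) else 0)" for p
  have "pc (\<Sum>p\<in>A. scal (c p) (be p)) j0 = (\<Sum>p\<in>A. smult (c p) (pc (be p) j0))"
    by (subst pc_sum [of _ _ K]) (auto intro: N_scal mem sum.cong simp: pc_scal [OF mem])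
  also have "\<dots> = (\<Sum>p\<in>A. q p * d j0)"
    by (intro sum.cong) (auto simp: q_def pc_be smult_monom simp flip: mult_smult_left)
  also have "\<dots> = (\<Sum>p\<in>A. q p) * d j0" by (rule sum_distrib_right [symmetric])
  finally have "(\<Sum>p\<in>A. q p) = 0" unfolding zero by simp
  then have "(\<Sum>p\<in>A. coeff (q p) i0) = 0" by (simp flip: coeff_sum)
  also have "(\<Sum>p\<in>A. coeff (q p) i0) = (\<Sum>p\<in>A. if p0 = p then c p else 0)"
    by (intro sum.cong) (auto simp: q_def ij)
  also have "\<dots> = c p0" using A p0 by (subst sum.delta') auto
  finally show "c p0 = 0" .
qed

lemma of_poly_monom: "of_poly (monom c i) * b j = scal c (be (i, j))"
proof -
  have "monom c i = [:c:] * monom 1 i" by (simp add: smult_monom)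
  then show ?thesis by (simp only: of_poly_simps scal_def be_def b_def prod.case mult.assoc)
qed

lemma be_spanning:
  assumes "x \<in> nil_set u"
  shows "\<exists>A c. finite A \<and> A \<subseteq> UNIV \<and> x = (\<Sum>p\<in>A. scal (c p) (be p))"
proof -
  obtain k where x: "x \<in> N k" using assms by (auto simp: nil_set_eq)
  obtain h where h: "x = (\<Sum>j | pc x j \<noteq> 0. of_poly (h j) * b j)" "\<And>j. pc x j = h j * d j"
    using N_as_b [OF x] by blast
  let ?J = "{j. pc x j \<noteq> 0}"
  have "of_poly (h j) * b j = (\<Sum>i\<le>k. scal (coeff (h j) i) (be (i, j)))" if j: "j \<in> ?J" for j
  proof -
    have "h j \<noteq> 0" using j h(2) by auto
    then have "degree (h j) \<le> degree (pc x j)"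
      using h(2) by (simp add: degree_mult_eq)
    then have "degree (h j) \<le> k" using N_degree [OF x] order_trans by blast
    then have "h j = (\<Sum>i\<le>k. monom (coeff (h j) i) i)"
      by (rule poly_as_sum_of_monoms' [symmetric])
    then have "of_poly (h j) * b j = (\<Sum>i\<le>k. of_poly (monom (coeff (h j) i) i)) * b j"
      by (metis of_poly_sum)
    then show ?thesis by (simp add: sum_distrib_right of_poly_monom)
  qed
  then have "x = (\<Sum>j\<in>?J. \<Sum>i\<le>k. scal (coeff (h j) i) (be (i, j)))"
    by (subst h(1)) (rule sum.cong [OF refl])
  also have "\<dots> = (\<Sum>i\<le>k. \<Sum>j\<in>?J. scal (coeff (h j) i) (be (i, j)))"
    by (rule sum.swap)
  also have "\<dots> = (\<Sum>p\<in>{..k} \<times> ?J. scal (coeff (h (snd p)) (fst p)) (be p))"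
    by (subst sum.cartesian_product) (simp add: case_prod_beta)
  finally have "x = (\<Sum>p\<in>{..k} \<times> ?J. scal (coeff (h (snd p)) (fst p)) (be p))" .
  moreover have "finite ({..k} \<times> ?J)" using finite_pc [OF x] by simp
  ultimately show ?thesis
    by (intro exI [of _ "{..k} \<times> ?J"] exI [of _ "\<lambda>p. coeff (h (snd p)) (fst p)"]) simp
qed

text \<open>The principal symbol of \<open>be (i, j)\<close> in the model. Because of the shift by
  a_j, every admissible exponent (k, j) occurs exactly once.\<close>

definition ge where "ge = (\<lambda>(i, j). monom (Poly_Mapping.single j (1 :: 'k)) (i + a j))"

lemma gr_scal_ge: "gr_scal c (ge (i, j)) = monom (Poly_Mapping.single j c) (i + a j)"
  by (simp add: ge_def gr_scal_monom)

lemma principal_symbol_be: "principal_symbol u (be p) = gr_iso (ge p)"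
  unfolding principal_symbol_def
  by (cases p) (simp add: ndeg_be graded_elem_eq [OF be_N] sym_be ge_def del: of_nat_add)

lemma ge_independent:
  assumes A: "finite A" and zero: "(\<Sum>p\<in>A. gr_scal (c p) (ge p)) = 0"
  shows "\<forall>p\<in>A. c p = 0"
proof
  fix p0 assume p0: "p0 \<in> A"
  obtain i0 j0 where ij: "p0 = (i0, j0)" by (cases p0)
  have "Poly_Mapping.lookup (coeff (\<Sum>p\<in>A. gr_scal (c p) (ge p)) (i0 + a j0)) j0
      = (\<Sum>p\<in>A. Poly_Mapping.lookup (coeff (gr_scal (c p) (ge p)) (i0 + a j0)) j0)"
    by (simp add: coeff_sum lookup_sum)
  also have "\<dots> = (\<Sum>p\<in>A. if p0 = p then c p else 0)"
    by (intro sum.cong) (auto simp: gr_scal_ge ij lookup_single when_def split: if_splits)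
  also have "\<dots> = c p0" using A p0 by (subst sum.delta') auto
  finally show "c p0 = 0" unfolding zero by simp
qed

lemma ge_spanning:
  assumes P: "P \<in> gr_model"
  shows "\<exists>A c. finite A \<and> A \<subseteq> UNIV \<and> P = (\<Sum>p\<in>A. gr_scal (c p) (ge p))"
proof -
  define A where "A = Sigma {..degree P} (\<lambda>k. Poly_Mapping.keys (coeff P k))"
  \<comment> \<open>Undoes that shift; on A the subtraction is genuine, which also gives
    injectivity.\<close>
  define g where "g = (\<lambda>(k, j). (k - a j, j))"
  define c where "c = (\<lambda>(i, j). Poly_Mapping.lookup (coeff P (i + a j)) j)"
  have le: "a j \<le> k" if "(k, j) \<in> A" for k j
    using that gr_modelD [OF P] by (auto simp: A_def)
  have inj: "inj_on g A"
  proof (rule inj_onI)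
    fix p q assume pq: "p \<in> A" "q \<in> A" "g p = g q"
    obtain k j k' j' where eq: "p = (k, j)" "q = (k', j')" by fastforce
    then have "a j \<le> k" "a j' \<le> k'" using le pq by auto
    then show "p = q" using pq(3) by (auto simp: eq g_def)
  qed
  have fin: "finite A" by (simp add: A_def)
  have "P = (\<Sum>k\<le>degree P. monom (coeff P k) k)"
    by (rule poly_as_sum_of_monoms [symmetric])
  also have "\<dots> = (\<Sum>k\<le>degree P. \<Sum>j\<in>Poly_Mapping.keys (coeff P k).
      monom (Poly_Mapping.single j (Poly_Mapping.lookup (coeff P k) j)) k)"
    by (intro sum.cong refl) (rule monom_sum_single)
  also have "\<dots> = (\<Sum>(k, j)\<in>A. monom (Poly_Mapping.single j (Poly_Mapping.lookup (coeff P k) j)) k)"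
    unfolding A_def by (rule sum.Sigma) simp_all
  also have "\<dots> = (\<Sum>p\<in>A. gr_scal (c (g p)) (ge (g p)))"
    using le by (intro sum.cong) (auto simp: g_def c_def gr_scal_ge)
  also have "\<dots> = (\<Sum>p\<in>g ` A. gr_scal (c p) (ge p))"
    using inj by (simp add: sum.reindex)
  finally show ?thesis using fin by (intro exI [of _ "g ` A"] exI [of _ c]) simp
qed

lemma principal_basis_be: "principal_basis u (range be) (\<lambda>x. x)"
  unfolding principal_basis_def
proof
  show "family_basis (nil_alg u) (range be) (\<lambda>x. x)"
  proof (rule nilpotent.family_basisI [where e = be])
    have "be (i, j) \<in> nil_set u" for i j
      unfolding nil_set_eq using be_N by (rule UN_I [OF UNIV_I])
    then show "range be \<subseteq> nil_set u" by auto
  qed (use inj_be be_independent be_spanning in auto)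
  show "family_basis (graded_alg u) (range be) (principal_symbol u)"
  proof (rule graded.family_basisI [where e = ge])
    show "range ge \<subseteq> gr_model" by (auto simp: ge_def intro: gr_model_single)
  qed (use inj_be principal_symbol_be ge_independent ge_spanning in auto)
qed

section \<open>The direct sum decomposition\<close>

lemma direct_sum: "internal_direct_sum (nil_set u) UNIV (\<lambda>j. KH_span (b j))"
  unfolding internal_direct_sum_def
proof (intro conjI allI impI ballI)
  have elem: "of_poly p * b j \<in> nil_set u" for p j
  proof -
    have "of_poly (p * d j) * v powi j \<in> N (degree (p * d j))"
      by (rule N_poly_v) simp_all
    then show ?thesis unfolding nil_set_eq by (auto simp: b_def mult.assoc)
  qed
  show "nil_set u = {sum x A |x A. finite A \<and> A \<subseteq> UNIV \<and> (\<forall>i\<in>A. x i \<in> KH_span (b i))}"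
  proof (intro equalityI subsetI)
    fix x assume "x \<in> nil_set u"
    then obtain k where x: "x \<in> N k" by (auto simp: nil_set_eq)
    then obtain h where "x = (\<Sum>j | pc x j \<noteq> 0. of_poly (h j) * b j)" using N_as_b by blast
    then show "x \<in> {sum x A |x A. finite A \<and> A \<subseteq> UNIV \<and> (\<forall>i\<in>A. x i \<in> KH_span (b i))}"
      using finite_pc [OF x] by (intro CollectI exI [of _ "\<lambda>j. of_poly (h j) * b j"] exI [of _ "{j. pc x j \<noteq> 0}"])
        (auto simp: KH_span_def)
  next
    fix y assume "y \<in> {sum x A |x A. finite A \<and> A \<subseteq> UNIV \<and> (\<forall>i\<in>A. x i \<in> KH_span (b i))}"
    then obtain x A where "y = sum x A" "\<forall>i\<in>A. x i \<in> KH_span (b i)" by auto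
    then show "y \<in> nil_set u" using elem by (auto simp: KH_span_def intro!: nilpotent.S_sum)
  qed
  fix x A i assume *: "finite A \<and> A \<subseteq> UNIV \<and> (\<forall>i\<in>A. x i \<in> KH_span (b i)) \<and> sum x A = 0" and i: "i \<in> A"
  then have "\<forall>i\<in>A. \<exists>p. x i = of_poly p * b i" by (auto simp: KH_span_def)
  then obtain p where p: "\<And>i. i \<in> A \<Longrightarrow> x i = of_poly (p i) * b i" by metis
  have coord: "coord (x j) (i * t) = (if i = j then to_fract (p j * d j) * \<nu> j else 0)" if "j \<in> A" for j
    using t_nz by (simp add: p [OF that] b_def v_powi_eq of_poly_eq coord_monom mult.assoc)
  have "coord (sum x A) (i * t) = (\<Sum>j\<in>A. if i = j then to_fract (p j * d j) * \<nu> j else 0)"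
    unfolding coord_sum by (intro sum.cong) (simp_all only: coord)
  also have "\<dots> = to_fract (p i * d i) * \<nu> i"
    using * i by (subst sum.delta') auto
  finally have "p i = 0" using * by simp
  then show "x i = 0" using p [OF i] by simp
qed

text \<open>The dictionary between the summands of the statement and the b_j: negative indices are
  read through \<open>F\<close> and \<open>vgen\<close>, nonnegative ones through \<open>d\<close>
  and powers of v, and from \<mu> on \<open>F\<close> respectively \<open>d\<close> is 1. The same
  dictionary underlies \<open>basis_eq\<close>.\<close>

lemma summands_eq:
  "(\<lambda>j. if j \<le> - int \<mu> then KH_span (vgen (j * t))
     else if j < 0 then KH_span (of_poly (canon_f u n (nat (- j))) * vgen (j * t))
     else if j = 0 then KH_span 1
     else if j < int \<mu> then KH_span (of_poly (canon_g u n (nat j)) * v ^ nat j)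
     else KH_span (v ^ nat j)) = (\<lambda>j. KH_span (b j))"
proof
  fix j
  show "(if j \<le> - int \<mu> then KH_span (vgen (j * t))
     else if j < 0 then KH_span (of_poly (canon_f u n (nat (- j))) * vgen (j * t))
     else if j = 0 then KH_span 1
     else if j < int \<mu> then KH_span (of_poly (canon_g u n (nat j)) * v ^ nat j)
     else KH_span (v ^ nat j)) = KH_span (b j)"
  proof (cases "j < 0")
    case True
    define l where "l = nat (- j)"
    have j: "j = - int l" using True by (simp add: l_def)
    show ?thesis
      using True b_le_minus_mu [of l] b_eq_F [of "- int l"] by (auto simp: j canon_f_eq)
  next
    case False
    define l where "l = nat j"
    have j: "j = int l" using False by (simp add: l_def)
    show ?thesis
      using b_ge_mu [of l] b_def [of "int l"] mu_pos by (auto simp: j canon_g_eq)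
  qed
qed

lemma basis_eq:
  "{genH ^ k * vgen (- int i * t) | k i. \<mu> \<le> i} \<union>
   {genH ^ k * of_poly (canon_f u n j) * vgen (- int j * t) | k j. 1 \<le> j \<and> j \<le> \<mu> - 1} \<union>
   {genH ^ k | k. True} \<union>
   {genH ^ k * of_poly (canon_g u n j) * v ^ j | k j. 1 \<le> j \<and> j \<le> \<mu> - 1} \<union>
   {genH ^ k * v ^ i | k i. \<mu> \<le> i} = range be" (is "?A \<union> ?B \<union> ?C \<union> ?D \<union> ?E = _")
proof (intro equalityI subsetI)
  have A: "genH ^ k * vgen (- int i * t) = be (k, - int i)" if "\<mu> \<le> i" for k i
    using b_le_minus_mu [OF that] by (simp add: be_eq)
  have B: "genH ^ k * of_poly (canon_f u n j) * vgen (- int j * t) = be (k, - int j)" for k j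
    using b_eq_F [of "- int j"] by (simp add: be_eq canon_f_eq mult.assoc)
  have C: "genH ^ k = be (k, 0)" for k by (simp add: be_eq)
  have D: "genH ^ k * of_poly (canon_g u n j) * v ^ j = be (k, int j)" for k j
    using b_def [of "int j"] by (simp add: be_eq canon_g_eq mult.assoc)
  have E: "genH ^ k * v ^ i = be (k, int i)" if "\<mu> \<le> i" for k i
    using b_ge_mu [OF that] by (simp add: be_eq)
  have "?A \<subseteq> range be" by clarify (simp only: A rangeI)
  moreover have "?B \<subseteq> range be" by clarify (simp only: B rangeI)
  moreover have "?C \<subseteq> range be" by clarify (simp only: C rangeI)
  moreover have "?D \<subseteq> range be" by clarify (simp only: D rangeI)
  moreover have "?E \<subseteq> range be" by clarify (simp only: E rangeI)
  ultimately have "?A \<union> ?B \<union> ?C \<union> ?D \<union> ?E \<subseteq> range be"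
    by (intro Un_least)
  then show "x \<in> range be" if "x \<in> ?A \<union> ?B \<union> ?C \<union> ?D \<union> ?E" for x
    using that by (rule subsetD)
  show "x \<in> ?A \<union> ?B \<union> ?C \<union> ?D \<union> ?E" if "x \<in> range be" for x
  proof -
    from that obtain p where "x = be p" by (rule rangeE)
    then obtain k j where x: "x = be (k, j)" by (cases p) simp
    consider i where "j = - int i" "\<mu> \<le> i" | i where "j = - int i" "1 \<le> i \<and> i \<le> \<mu> - 1" | "j = 0"
      | i where "j = int i" "1 \<le> i \<and> i \<le> \<mu> - 1" | i where "j = int i" "\<mu> \<le> i"
    proof -
      obtain i where "j = int i \<or> j = - int i" by (cases j rule: int_cases2) auto
      moreover have "i = 0 \<or> 1 \<le> i \<and> i \<le> \<mu> - 1 \<or> \<mu> \<le> i" by auto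
      ultimately show ?thesis
        using that(1) [of i] that(2) [of i] that(3) that(4) [of i] that(5) [of i] by auto
    qed
    then show ?thesis
    proof cases
      case (1 i)
      then have "x \<in> ?A" using A x by (intro CollectI exI [of _ k] exI [of _ i]) simp
      then show ?thesis by blast
    next
      case (2 i)
      then have "x \<in> ?B" using B x by (intro CollectI exI [of _ k] exI [of _ i]) simp
      then show ?thesis by blast
    next
      case 3
      then have "x \<in> ?C" using C x by (intro CollectI exI [of _ k]) simp
      then show ?thesis by blast
    next
      case (4 i)
      then have "x \<in> ?D" using D x by (intro CollectI exI [of _ k] exI [of _ i]) simp
      then show ?thesis by blast
    next
      case (5 i)
      then have "x \<in> ?E" using E x by (intro CollectI exI [of _ k] exI [of _ i]) simp
      then show ?thesis by blast
    qed
  qed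
qed

lemma ndeg_b: "ndeg u (b j) = degree (d j)"
  unfolding b_def by (rule ndeg_poly_v) simp_all

lemma ndeg_v_minus:
  "i \<ge> \<mu> \<Longrightarrow> int (ndeg u (vgen (- int i * t))) = int i * (\<bar>t\<bar> + deg_H (canon_gamma u n))"
  using ndeg_b [of "- int i"] degree_d_minus [of i]
  by (simp add: b_le_minus_mu F_le_minus_mu e_def canon_gamma_eq)

lemma ndeg_f_v:
  "int (ndeg u (of_poly (canon_f u n j) * vgen (- int j * t)))
     = int (degree (canon_f u n j)) + int j * (\<bar>t\<bar> + deg_H (canon_gamma u n))"
  using ndeg_b [of "- int j"] degree_d_minus [of j] b_eq_F [of "- int j"]
  by (simp add: canon_f_eq e_def canon_gamma_eq)

lemma ndeg_g_v: "ndeg u (of_poly (canon_g u n j) * v ^ j) = degree (canon_g u n j)"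
  using ndeg_b [of "int j"] by (simp add: canon_g_eq b_def)

end

theorem theorem3p2:
  shows "(\<forall>(\<alpha> :: 'k::field_char_0 poly) (n :: int). lead_coeff \<alpha> = 1 \<and> n \<noteq> 0 \<longrightarrow>
    (let u = of_poly \<alpha> * vgen n;
         v = canon_v u n;
         t = canon_t u n;
         \<gamma> = canon_gamma u n;
         \<mu> = canon_mu u n;
         f = canon_f u n;
         g = canon_g u n
     in
      \<comment> \<open>(i): the summand of index \<open>j > 0\<close> involves \<open>v\<^sup>j\<close>, that of index \<open>-j < 0\<close> involves \<open>v\<^bsub>-jt\<^esub>\<close>\<close>
      internal_direct_sum (nil_set u) (UNIV :: int set)
        (\<lambda>j. if j \<le> - int \<mu> then KH_span (vgen (j * t))
             else if j < 0 then KH_span (of_poly (f (nat (- j))) * vgen (j * t))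
             else if j = 0 then KH_span 1
             else if j < int \<mu> then KH_span (of_poly (g (nat j)) * v ^ nat j)
             else KH_span (v ^ nat j)) \<and>
      \<comment> \<open>(ii)\<close>
      principal_basis u
        ({genH ^ k * vgen (- int i * t) | k i. \<mu> \<le> i} \<union>
         {genH ^ k * of_poly (f j) * vgen (- int j * t) | k j. 1 \<le> j \<and> j \<le> \<mu> - 1} \<union>
         {genH ^ k | k. True} \<union>
         {genH ^ k * of_poly (g j) * v ^ j | k j. 1 \<le> j \<and> j \<le> \<mu> - 1} \<union>
         {genH ^ k * v ^ i | k i. \<mu> \<le> i})
        (\<lambda>e. e) \<and>
      (\<forall>i\<ge>\<mu>. int (ndeg u (vgen (- int i * t))) = int i * (\<bar>t\<bar> + deg_H \<gamma>)) \<and>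
      (\<forall>j\<in>{1..\<mu> - 1}.
         int (ndeg u (of_poly (f j) * vgen (- int j * t)))
           = int (Polynomial.degree (f j)) + int j * (\<bar>t\<bar> + deg_H \<gamma>) \<and>
         ndeg u (of_poly (g j) * v ^ j) = Polynomial.degree (g j)) \<and>
      \<comment> \<open>(iii)\<close>
      algebra (ring_of_type_algebra :: 'k ring) (graded_alg u) \<and>
      affine_algebra (graded_alg u) \<and>
      noetherian_ring (graded_alg u) \<and>
      \<comment> \<open>(iv)\<close>
      assoc_algebra (ring_of_type_algebra :: 'k ring) (nil_alg u) \<and>
      affine_algebra (nil_alg u) \<and>
      left_noetherian (nil_alg u) \<and> right_noetherian (nil_alg u))) \<and>
   (\<forall>u :: 'k skew. u \<in> range of_poly - range (\<lambda>c. scal c 1) \<longrightarrow>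
      nil_set u = range of_poly \<and> range of_poly = centralizer u)"
proof ((rule conjI; intro allI impI), goal_cases)
  case (1 \<alpha> n)
  then interpret homogeneous \<alpha> n by unfold_locales auto
  show ?case
    unfolding Let_def u_def [symmetric] v_def [symmetric] t_def [symmetric] \<mu>_def [symmetric]
    using direct_sum [folded summands_eq] principal_basis_be [folded basis_eq]
      ndeg_v_minus ndeg_f_v ndeg_g_v graded.algebra [OF mult.commute] graded_affine graded_noetherian
      nilpotent.assoc_algebra nil_alg_affine nil_alg_noetherian
    by (intro conjI allI ballI impI)
next
  case (2 u)
  then obtain p where p: "u = of_poly p" by auto
  have "p \<notin> range (\<lambda>c. [:c:])" using 2 by (auto simp: p scal_def)
  from nil_set_of_poly [OF this] show ?case
    by (simp add: p)
qed

end
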